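(* Let $\alpha\in(0,2]$, $n,d\in\mathbb N$ (both at least $1$), and let $m>1$ be related to $n,d,\alpha$ by one of the following conditions, which also fixes the joint law of the renewal times of the random flight $X^n$ (see the context for all definitions): (i) $d=1$, the renewal times have joint density $f_1$, and, for some integer $j\ge1$, either $n=2j+1$ and $m=\frac{\alpha}{n-1}+1=\frac{\alpha}{2j}+1$, or $n=2j+2$ and $m=\frac{\alpha}{n-2}+1=\frac{\alpha}{2j}+1$; (ii) $d\ge2$, the renewal times have joint density $f_2$, and $m=\frac{\alpha}{n(d-1)-2}+1$ with $d>\frac2n+1$; (iii) $d\ge3$, the renewal times have joint density $f_3$, and $m=\frac{\alpha}{n(d-2)-2}+1$ with $d>\frac2n+2$. Put $$\beta=\frac{1}{d(m-1)+\alpha},\qquad \kappa=\frac{d\,\Gamma(d/2)}{(d(m-1)+\alpha)\,2^\alpha\,\Gamma(1+\frac\alpha2)\,\Gamma(\frac{d+\alpha}{2})},\qquad \mathrm c=\kappa^{-1/\alpha},$$ let $X^n$ be the random flight in $\mathbb R^d$ with speed $\mathrm c$, and let $Y^n(t)=X^n(t^\beta)$ and $\mathsf R^n(t)=\|Y^n(t)\|$. Then the following hold: 1) the probability density function of $\mathsf R^n$ is $$\frac{P(\mathsf R^n(t)\in\mathrm dr)}{\mathrm dr}=\frac{2\,\Gamma(\frac d2+\frac{\alpha}{2(m-1)}+1)}{\Gamma(\frac{\alpha}{2(m-1)}+1)\,\Gamma(\frac d2)}\,\frac{r^{d-1}}{(\mathrm ct^\beta)^d}\Big(1-\frac{r^2}{\mathrm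 c^2t^{2\beta}}\Big)_+^{\frac{\alpha}{2(m-1)}},\qquad t>0;$$ 2) let $p\ge1$ and $d\ge2$; then $$E\big[(\mathsf R^n(t))^p\big]=\frac{\Gamma(\frac d2+\frac{\alpha}{2(m-1)}+1)\,\Gamma(\frac{d+p}{2})}{\Gamma(\frac{\alpha}{2(m-1)}+1+\frac{d+p}{2})\,\Gamma(\frac d2)}\,(\mathrm ct^\beta)^p,$$ while for $d=1$ $$E\big[(\mathsf R^n(t))^p\big]=\begin{cases}0,& p\text{ odd},\\[1mm] \dfrac{\Gamma(\frac12+\frac{\alpha}{2(m-1)}+1)\,\Gamma(\frac{1+p}{2})}{\Gamma(\frac{\alpha}{2(m-1)}+1+\frac{p+1}{2})\,\sqrt\pi}\,(\mathrm ct^\beta)^p,& p\text{ even};\end{cases}$$ 3) the rescaled process $\big(\frac{X^n(t^\beta)}{\mathrm ct^\beta},t>0\big)$ has distribution law independent of the time $t$ and with compact support the closed unit ball $\{x\in\mathbb R^d:\|x\|\le1\}$; i.e. $$w(x,t):=\frac{P\big(\frac{X^n(t^\beta)}{\mathrm ct^\beta}\in\mathrm dx\big)}{\mathrm dx}=\frac{\Gamma(\frac d2+\frac{\alpha}{2(m-1)}+1)}{\pi^{d/2}\,\Gamma(\frac{\alpha}{2(m-1)}+1)}\,(1-\|x\|^2)_+^{\frac{\alpha}{2(m-1)}}.$$ Furthermore $$\mathcal Fw(\xi,t)=\frac{1}{(2\pi)^{d/2}}\Big(\frac{2}{\|\xi\|}\Big)^{\frac d2+\frac{\alpha}{2(m-1)}}\Gamma\Big(\frac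 d2+\frac{\alpha}{2(m-1)}+1\Big)J_{\frac d2+\frac{\alpha}{2(m-1)}}(\|\xi\|);$$ 4) the rescaled distance process $\big(\frac{\mathsf R^n(t)}{\mathrm ct^\beta},t>0\big)$ admits the probability density function of a Beta random variable with parameters $\frac d2$ and $\frac{\alpha}{2(m-1)}+1$.
   Context: Notation: $(a)_+=\max(a,0)$; $\|\cdot\|$ is the Euclidean norm; $\mathbb S_1^{d-1}=\{x\in\mathbb R^d:\|x\|=1\}$. The Fourier transform in the space variable is $\mathcal Fv(\xi)=(2\pi)^{-d/2}\int_{\mathbb R^d}v(x)e^{ix\cdot\xi}\,\mathrm dx$, $\xi\in\mathbb R^d$, and $J_\mu(x)=\sum_{k=0}^\infty(-1)^k\frac{(x/2)^{2k+\mu}}{k!\,\Gamma(k+\mu+1)}$ is the Bessel function. Random flight with speed $\mathrm c>0$. Let $(T_k,k\in\mathbb N_0)$ be a sequence of random arrival epochs with $T_0=0$, and let $(V_k,k\in\mathbb N_0)$ be the sequence of directions: for $d=1$, $V_k=(-1)^kV(0)$ with $V(0)$ uniform on $\{-1,+1\}$; for $d\ge2$, the $V_k$ are independent and uniformly distributed on $\mathbb S_1^{d-1}$. The directions are independent of the arrival epochs. A particle starts at the origin and during $[0,t]$ takes the directions $V_0,V_1,\dots,V_n$ at the moments $T_0,T_1,\dots,T_n$. With $V^n(t)=V_k$ for $T_k\le t<T_{k+1}$, $0\le k\le n$, the random flight $X^n=(X^n(t),t\ge0)$ is $$X^n(t)=\mathrm c\int_0^tV^n(s)\,\mathrm ds=\mathrm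 c\sum_{k=0}^{n-1}V_k(T_{k+1}-T_k)+\mathrm c(t-T_n)V_n,\qquad X^n(0)=0.$$ Law of the renewal times. Put $\tau_{k+1}=T_{k+1}-T_k$. For the flight observed at time $t$, the vector $(\tau_1,\dots,\tau_n)$ is assumed to have one of the following joint densities: $$f_1=\frac{n!}{t^n}1_{S_n}\quad(d=1),$$ $$f_2=\frac{\Gamma((n+1)(d-1))}{(\Gamma(d-1))^{n+1}}\frac{1}{t^{(n+1)(d-1)-1}}\Big(\prod_{j=1}^{n+1}\tau_j^{d-2}\Big)1_{S_n}\quad(d\ge2),$$ $$f_3=\frac{\Gamma((n+1)(\frac d2-1))}{(\Gamma(\frac d2-1))^{n+1}}\frac{1}{t^{(n+1)(\frac d2-1)-1}}\Big(\prod_{j=1}^{n+1}\tau_j^{\frac d2-2}\Big)1_{S_n}\quad(d\ge3),$$ where $$S_n=\Big\{(\tau_1,\dots,\tau_n)\in\mathbb R^n:\ 0<\tau_j<t-\sum_{i=0}^{j-1}\tau_i,\ 1\le j\le n\Big\},\quad \tau_0=0,\quad \tau_{n+1}=t-\sum_{j=1}^n\tau_j .$$ For $Y^n(t)=X^n(t^\beta)$ these densities are taken with $t^\beta$ in place of $t$.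
   Formalization: In 2), for d=1 and p odd, the vanishing moment is that of the signed position Y^n(t), since E[(R^n(t))^p]>0. In 4), it is the square of R^n(t)/(ct^β) that has the Beta(d/2, α/(2(m-1))+1) density; by 1) the unsquared ratio does not. *)

theory Defs
  imports "HOL-Probability.Probability"
begin

definition bessel_J :: "real \<Rightarrow> real \<Rightarrow> real" where
  "bessel_J \<mu> x =
     (\<Sum>k. (-1) ^ k * (x / 2) powr (2 * real k + \<mu>) / (fact k * Gamma (real k + \<mu> + 1)))"

definition fourier :: "(real ^ 'd \<Rightarrow> complex) \<Rightarrow> real ^ 'd \<Rightarrow> complex" where
  "fourier v \<xi> = complex_of_real ((2 * pi) powr (- (real CARD('d) / 2))) *
     (LINT x|lborel. v x * exp (\<i> * complex_of_real (x \<bullet> \<xi>)))"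

definition beta_density :: "real \<Rightarrow> real \<Rightarrow> real \<Rightarrow> real" where
  "beta_density a b x = x powr (a - 1) * (1 - x) powr (b - 1) / Beta a b * indicator {0<..<1} x"

definition measure_support :: "'a::topological_space measure \<Rightarrow> 'a set" where
  "measure_support \<mu> = {x. \<forall>U. open U \<and> x \<in> U \<longrightarrow> emeasure \<mu> U \<noteq> 0}"

text \<open>Normalised surface measure on the unit sphere, as the image of the uniform
  distribution on the unit ball under radial projection (\<^term>\<open>sgn x\<close> is
  \<^term>\<open>x /\<^sub>R norm x\<close>): the mass of a set of directions is the normalised volume
  of the cone over it.\<close>

definition uniform_sphere :: "(real ^ 'd) measure" where
  "uniform_sphere = distr (uniform_measure lborel (ball 0 1)) borel sgn"

text \<open>Independence of two random variables that may have different value types; the library's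
  \<^const>\<open>prob_space.indep_var\<close> forces both types to be equal.\<close>

definition independent_rvs ::
  "'w measure \<Rightarrow> 'b measure \<Rightarrow> ('w \<Rightarrow> 'b) \<Rightarrow> 'c measure \<Rightarrow> ('w \<Rightarrow> 'c) \<Rightarrow> bool" where
  "independent_rvs M S X N Y \<longleftrightarrow>
     X \<in> measurable M S \<and> Y \<in> measurable M N \<and>
     prob_space.indep_set M {X -` A \<inter> space M | A. A \<in> sets S} {Y -` B \<inter> space M | B. B \<in> sets N}"

text \<open>In dimension one \<^term>\<open>1 :: real ^ 'd\<close> is the vector with single entry 1.\<close>

definition flight_directions :: "'w measure \<Rightarrow> (nat \<Rightarrow> 'w \<Rightarrow> real ^ 'd) \<Rightarrow> bool" where
  "flight_directions M V \<longleftrightarrow>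
     (if CARD('d) = 1
      then V 0 \<in> borel_measurable M \<and>
           measure M {\<omega> \<in> space M. V 0 \<omega> = 1} = 1 / 2 \<and>
           measure M {\<omega> \<in> space M. V 0 \<omega> = - 1} = 1 / 2 \<and>
           (\<forall>k. \<forall>\<omega>\<in>space M. V k \<omega> = (-1) ^ k *\<^sub>R V 0 \<omega>)
      else prob_space.indep_vars M (\<lambda>_. borel) V UNIV \<and>
           (\<forall>k. distr M borel (V k) = uniform_sphere))"

text \<open>The law of the arrival epochs depends on the time \<open>t\<close> at which the flight is
  observed, so they form a family \<open>T t k\<close>, with one sequence of epochs for each
  observation time \<open>t > 0\<close>.\<close>

definition arrival_epochs ::
  "'w measure \<Rightarrow> (nat \<Rightarrow> 'w \<Rightarrow> real ^ 'd) \<Rightarrow> (real \<Rightarrow> nat \<Rightarrow> 'w \<Rightarrow> real) \<Rightarrow> bool" where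
  "arrival_epochs M V T \<longleftrightarrow>
     (\<forall>t>0. (\<forall>\<omega>\<in>space M. T t 0 \<omega> = 0) \<and>
        independent_rvs M (PiM UNIV (\<lambda>_. borel)) (\<lambda>\<omega> k. V k \<omega>)
                          (PiM UNIV (\<lambda>_. borel)) (\<lambda>\<omega> k. T t k \<omega>))"

definition renewal_simplex :: "nat \<Rightarrow> real \<Rightarrow> (nat \<Rightarrow> real) set" where
  "renewal_simplex n t = {\<tau>. \<forall>j\<in>{1..n}. 0 < \<tau> j \<and> \<tau> j < t - (\<Sum>i\<in>{1..<j}. \<tau> i)}"

text \<open>The product over \<open>1 \<le> j \<le> n + 1\<close> of the powers of the renewal times, where
  the last factor belongs to the remaining time up to \<open>t\<close>.\<close>

definition gap_product :: "nat \<Rightarrow> real \<Rightarrow> real \<Rightarrow> (nat \<Rightarrow> real) \<Rightarrow> real" where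
  "gap_product n t a \<tau> = (\<Prod>j=1..n. \<tau> j powr a) * (t - (\<Sum>j=1..n. \<tau> j)) powr a"

definition f1 :: "nat \<Rightarrow> real \<Rightarrow> (nat \<Rightarrow> real) \<Rightarrow> real" where
  "f1 n t \<tau> = fact n / t ^ n * indicator (renewal_simplex n t) \<tau>"

definition f2 :: "nat \<Rightarrow> nat \<Rightarrow> real \<Rightarrow> (nat \<Rightarrow> real) \<Rightarrow> real" where
  "f2 d n t \<tau> =
     Gamma ((real n + 1) * (real d - 1)) / Gamma (real d - 1) ^ (n + 1) *
     (1 / t powr ((real n + 1) * (real d - 1) - 1)) *
     gap_product n t (real d - 2) \<tau> * indicator (renewal_simplex n t) \<tau>"

definition f3 :: "nat \<Rightarrow> nat \<Rightarrow> real \<Rightarrow> (nat \<Rightarrow> real) \<Rightarrow> real" where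
  "f3 d n t \<tau> =
     Gamma ((real n + 1) * (real d / 2 - 1)) / Gamma (real d / 2 - 1) ^ (n + 1) *
     (1 / t powr ((real n + 1) * (real d / 2 - 1) - 1)) *
     gap_product n t (real d / 2 - 2) \<tau> * indicator (renewal_simplex n t) \<tau>"

definition renewal_law ::
  "'w measure \<Rightarrow> nat \<Rightarrow> (real \<Rightarrow> nat \<Rightarrow> 'w \<Rightarrow> real) \<Rightarrow> (real \<Rightarrow> (nat \<Rightarrow> real) \<Rightarrow> real) \<Rightarrow> bool" where
  "renewal_law M n T f \<longleftrightarrow>
     (\<forall>t>0. distributed M (PiM {1..n} (\<lambda>_. lborel))
        (\<lambda>\<omega>. \<lambda>j\<in>{1..n}. T t j \<omega> - T t (j - 1) \<omega>) (\<lambda>\<tau>. ennreal (f t \<tau>)))"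

text \<open>The direction at time \<open>u\<close> is \<open>V k\<close> for the last of the \<open>n\<close> changes
  with \<open>T k \<le> u\<close>; for increasing epochs this is \<open>V k\<close> on
  \<open>T k \<le> u < T (k + 1)\<close> if \<open>k < n\<close>, and \<open>V n\<close> from \<open>T n\<close> on.\<close>

definition direction_at :: "nat \<Rightarrow> (nat \<Rightarrow> real) \<Rightarrow> (nat \<Rightarrow> real ^ 'd) \<Rightarrow> real \<Rightarrow> real ^ 'd" where
  "direction_at n T V u = V (Max {k. k \<le> n \<and> T k \<le> u})"

definition random_flight ::
  "real \<Rightarrow> nat \<Rightarrow> (real \<Rightarrow> nat \<Rightarrow> 'w \<Rightarrow> real) \<Rightarrow> (nat \<Rightarrow> 'w \<Rightarrow> real ^ 'd) \<Rightarrow> real \<Rightarrow> 'w \<Rightarrow> real ^ 'd" where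
  "random_flight c n T V t \<omega> =
     c *\<^sub>R (LINT u:{0..t}|lborel. direction_at n (\<lambda>k. T t k \<omega>) (\<lambda>k. V k \<omega>) u)"

lemma direction_at_eq_sum:
  assumes "T 0 = 0" and mono: "\<And>i j. i \<le> j \<Longrightarrow> j \<le> n \<Longrightarrow> T i \<le> T j" and "0 \<le> u"
  shows "direction_at n T V u =
    (\<Sum>k<n. indicator {T k..<T (Suc k)} u *\<^sub>R V k) + indicator {T n..} u *\<^sub>R V n"
proof -
  define A where "A = {k. k \<le> n \<and> T k \<le> u}"
  define K where "K = Max A"
  have fin: "finite A" and "0 \<in> A" using assms by (auto simp: A_def)
  then have "K \<in> A" unfolding K_def by (intro Max_in) auto
  then have K: "K \<le> n" "T K \<le> u" by (auto simp: A_def)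
  have less: "u < T k" if "K < k" "k \<le> n" for k
  proof (rule ccontr)
    assume "\<not> u < T k"
    then have "k \<in> A" using that by (auto simp: A_def)
    then show False using Max_ge[OF fin, of k] that by (simp add: K_def)
  qed
  have ind: "indicator {T k..<T (Suc k)} u = (if k = K then 1 else (0::real))" if "k < n" for k
  proof -
    consider "k < K" | "k = K" | "K < k" by linarith
    then show ?thesis
    proof cases
      case 1
      then have "T (Suc k) \<le> T K" using K by (intro mono) auto
      then show ?thesis using 1 K by (auto simp: indicator_def)
    next
      case 2
      then show ?thesis using K less[of "Suc K"] that by (auto simp: indicator_def)
    next
      case 3
      then show ?thesis using less[of k] that by (auto simp: indicator_def)
    qed
  qed
  have last: "indicator {T n..} u = (if n = K then 1 else (0::real))"
    using K less[of n] by (auto simp: indicator_def not_le)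
  have "(\<Sum>k<n. indicator {T k..<T (Suc k)} u *\<^sub>R V k) = (\<Sum>k<n. if k = K then V k else 0)"
    by (intro sum.cong refl) (auto simp: ind)
  also have "\<dots> = (if K < n then V K else 0)" by (simp add: sum.delta)
  finally show ?thesis
    using K last by (auto simp: direction_at_def K_def[symmetric] A_def[symmetric])
qed

lemma random_flight_eq_sum:
  fixes T :: "real \<Rightarrow> nat \<Rightarrow> 'w \<Rightarrow> real"
  assumes "T t 0 \<omega> = 0" and mono: "\<And>i j. i \<le> j \<Longrightarrow> j \<le> n \<Longrightarrow> T t i \<omega> \<le> T t j \<omega>"
    and le: "T t n \<omega> \<le> t"
  shows "random_flight c n T V t \<omega> =
    c *\<^sub>R (\<Sum>k<n. (T t (k + 1) \<omega> - T t k \<omega>) *\<^sub>R V k \<omega>) + (c * (t - T t n \<omega>)) *\<^sub>R V n \<omega>"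
proof -
  let ?T = "\<lambda>k. T t k \<omega>" and ?V = "\<lambda>k. V k \<omega>"
  have nn: "0 \<le> ?T k" if "k \<le> n" for k using mono[of 0 k] assms(1) that by simp
  have leT: "?T k \<le> t" if "k \<le> n" for k using mono[of k n] le that by simp
  have pt: "indicator {0..t} u *\<^sub>R direction_at n ?T ?V u =
    (\<Sum>k<n. indicator {?T k..<?T (Suc k)} u *\<^sub>R ?V k) + indicator {?T n..t} u *\<^sub>R ?V n" for u
  proof (cases "0 \<le> u \<and> u \<le> t")
    case True
    then show ?thesis
      using direction_at_eq_sum[of ?T n u ?V] assms by (auto simp: indicator_def)
  next
    case False
    have "indicator {?T k..<?T (Suc k)} u = (0::real)" if "k < n" for k
      using False nn[of k] leT[of "Suc k"] that by (auto simp: indicator_def)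
    moreover have "indicator {?T n..t} u = (0::real)"
      using False nn[of n] by (auto simp: indicator_def)
    moreover have "indicator {0..t} u = (0::real)" using False by (auto simp: indicator_def)
    ultimately show ?thesis by simp
  qed
  have "has_bochner_integral lborel
     (\<lambda>u. (\<Sum>k<n. indicator {?T k..<?T (Suc k)} u *\<^sub>R ?V k) + indicator {?T n..t} u *\<^sub>R ?V n)
     ((\<Sum>k<n. measure lborel {?T k..<?T (Suc k)} *\<^sub>R ?V k) + measure lborel {?T n..t} *\<^sub>R ?V n)"
    by (intro has_bochner_integral_add has_bochner_integral_sum has_bochner_integral_indicator)
       (auto simp: emeasure_lborel_Icc_eq emeasure_lborel_Ico mono)
  then have "(LINT u:{0..t}|lborel. direction_at n ?T ?V u) =
     (\<Sum>k<n. measure lborel {?T k..<?T (Suc k)} *\<^sub>R ?V k) + measure lborel {?T n..t} *\<^sub>R ?V n"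
    unfolding set_lebesgue_integral_def pt by (rule has_bochner_integral_integral_eq)
  also have "\<dots> = (\<Sum>k<n. (?T (k + 1) - ?T k) *\<^sub>R ?V k) + (t - ?T n) *\<^sub>R ?V n"
    using le by (intro arg_cong2[where f="(+)"] sum.cong) (auto simp: mono)
  finally show ?thesis
    by (simp add: random_flight_def scaleR_add_right)
qed

end

theory Submission
  imports Defs
begin

text \<open>
  For gaps with a Dirichlet law with all parameters equal to \<open>a\<close>, and \<open>A = (n + 1) * a\<close>, the
  Markov-Krein identity \<open>E (\<Sum>k. \<tau> k * y k) powr (- A) = t powr (- A) * (\<Prod>k. y k powr (- a))\<close>
  holds. With \<open>Z = X t / (c * t)\<close>, a unit vector \<open>e\<close> and \<open>\<bar>s\<bar> < 1\<close>, independence therefore gives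
  \<open>E (1 - s * (e \<bullet> Z)) powr (- A) = E (\<Prod>k. (1 - s * (e \<bullet> V k)) powr (- a))\<close>.
  The projections of a uniform direction and of the density \<open>w\<close> are both laws on \<open>[-1, 1]\<close> with
  density proportional to \<open>(1 - x\<^sup>2) powr (b - 1)\<close>, for \<open>b = (d - 1) / 2\<close> (if
  \<open>d \<ge> 2\<close>) and \<open>b = d / 2 + \<gamma> + 1 / 2\<close>. For such a law \<open>E (1 - s * U) powr (- p)\<close> is
  \<open>(1 - s\<^sup>2) powr (- b)\<close> if \<open>p = 2 * b\<close>, \<open>(1 - s\<^sup>2) powr (- b - 1)\<close> if \<open>p = 2 * b + 1\<close> and
  \<open>(2 / (1 + sqrt (1 - s\<^sup>2))) powr p\<close> if \<open>p = b - 1 / 2\<close>, so for \<open>d \<ge> 2\<close> the product has the same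
  form as its factors and equals the value for \<open>w\<close>; for \<open>d = 1\<close> it is elementary. Expanding in \<open>s\<close>, all projections of \<open>Z\<close> have
  the moments of those of \<open>w\<close>, which by Stone-Weierstrass determines the law of \<open>Z\<close>.
\<close>

section \<open>Polar coordinates\<close>

text \<open>The exponent \<open>- A\<close> is dictated by the gaps: \<open>A\<close> is the total
  parameter of their Dirichlet law, and with it they integrate out to a product over the directions.
  This is why the moments are collected with the coefficients
  \<open>pochhammer A k / fact k\<close>. The value of
  \<open>\<gamma> = \<alpha> / (2 * (m - 1))\<close> is what makes the two sides agree. For
  \<open>f2\<close>, a direction has \<open>a = d - 1 = 2 * b\<close>, and matching
  \<open>A = 2 * b\<close> for \<open>w\<close> means
  \<open>d / 2 + \<gamma> + 1 / 2 = A / 2\<close>, that is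
  \<open>\<gamma> = (n * (d - 1) - 2) / 2\<close>. For \<open>f3\<close>, a direction has
  \<open>a = d / 2 - 1 = b - 1 / 2\<close>, and matching \<open>A = b - 1 / 2\<close> for
  \<open>w\<close> means \<open>d / 2 + \<gamma> = A\<close>, that is
  \<open>\<gamma> = n * (d / 2 - 1) - 1\<close>. For \<open>d = 1\<close>, \<open>A = n + 1\<close>
  is \<open>2 * (j + 1)\<close> or \<open>2 * (j + 1) + 1\<close>, and \<open>\<gamma> = j\<close>
  both times. The first two generating functions come from cancelling Pochhammer symbols term by
  term. The third does not simplify this way; it rests on an integral of the generating function of
  the Gegenbauer polynomials.\<close>

lemma distr_norm_powr_cone:
  fixes B :: "'a::euclidean_space set"
  assumes B [measurable]: "B \<in> sets borel" and p: "0 < p"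
  shows "distr (density lborel (\<lambda>x::'a. indicator B (sgn x))) borel (\<lambda>x. norm x powr p) =
    density lborel (\<lambda>r. emeasure lborel {x \<in> ball 0 1. sgn x \<in> B} *
      ennreal (indicator {0..} r * (DIM('a) / p * r powr (DIM('a) / p - 1))))"
    (is "?M = ?N")
proof (rule measure_eqI_generator_eq)
  let ?D = "real DIM('a)"
  define S where "S r = {x \<in> ball 0 r. sgn x \<in> B}" for r :: real
  have [measurable]: "S r \<in> sets borel" for r
    unfolding S_def by measurable
  have fin: "emeasure lborel (S r) < \<infinity>" for r
    by (rule le_less_trans[OF emeasure_mono emeasure_lborel_ball_finite[of 0 r]])
       (auto simp: S_def)
  \<comment> \<open>A cone meets the ball of radius \<open>r\<close> in the \<open>r\<close>-fold
    dilate of its part in the unit ball, so its mass grows like \<open>r ^ DIM('a)\<close>. This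
    gives both measures on the half-lines \<open>{..<r}\<close>, which generate the Borel
    sets.\<close>
  have cone: "emeasure lborel (S r) = ennreal (r ^ DIM('a)) * emeasure lborel (S 1)"
    if r: "0 < r" for r
  proof -
    have "emeasure lborel (S r) =
      emeasure (density (distr lborel borel (\<lambda>x::'a. 0 + r *\<^sub>R x)) (\<lambda>_. ennreal (\<bar>r\<bar> ^ DIM('a)))) (S r)"
      using lborel_affine[of r "0::'a"] r by simp
    also have "\<dots> = ennreal (r ^ DIM('a)) * emeasure lborel ((\<lambda>x. r *\<^sub>R x) -` S r)"
      using r by (simp add: emeasure_density nn_integral_cmult_indicator emeasure_distr)
    also have "(\<lambda>x. r *\<^sub>R x) -` S r = S 1"
      using r by (auto simp: S_def sgn_scaleR)
    finally show ?thesis .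
  qed
  have N: "emeasure ?N {..<r} = emeasure lborel (S 1) * ennreal (r powr (?D / p))" if "0 < r" for r
  proof -
    have "((\<lambda>x. ?D / p * x powr (?D / p - 1)) has_integral ?D / p * (r powr (?D / p) / (?D / p))) {0..r}"
      using p that has_integral_powr_from_0[of "?D / p - 1" r]
      by (intro has_integral_mult_right) auto
    then have I: "(\<integral>\<^sup>+x. ennreal (?D / p * x powr (?D / p - 1)) * indicator {0..r} x \<partial>lborel) =
        ennreal (r powr (?D / p))"
      using p that by (subst nn_integral_has_integral_lebesgue') auto
    have "emeasure ?N {..<r} =
      (\<integral>\<^sup>+x. emeasure lborel (S 1) * (ennreal (?D / p * x powr (?D / p - 1)) * indicator {0..r} x) \<partial>lborel)"
      using p AE_lborel_singleton[of r]
      by (auto simp: emeasure_density S_def intro!: nn_integral_cong_AE split: split_indicator)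
    also have "\<dots> = emeasure lborel (S 1) *
      (\<integral>\<^sup>+x. ennreal (?D / p * x powr (?D / p - 1)) * indicator {0..r} x \<partial>lborel)"
      by (rule nn_integral_cmult) measurable
    finally show ?thesis unfolding I .
  qed
  have M: "emeasure ?M {..<r} = emeasure lborel (S (r powr (1 / p)))" if "0 < r" for r
  proof -
    have "norm x powr p < r \<longleftrightarrow> norm x < r powr (1 / p)" for x :: 'a
    proof -
      have "norm x < r powr (1 / p) \<longleftrightarrow> norm x powr p < (r powr (1 / p)) powr p"
        using p by (metis norm_ge_zero powr_ge_zero powr_less_mono2 powr_less_cancel2 not_less_iff_gr_or_eq)
      then show ?thesis using p that by (simp add: powr_powr)
    qed
    then have "(\<lambda>x. norm x powr p) -` {..<r} = ball (0::'a) (r powr (1 / p))"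
      by auto
    then have "emeasure ?M {..<r} = (\<integral>\<^sup>+x. indicator (S (r powr (1 / p))) x \<partial>lborel)"
      by (subst emeasure_distr, simp_all, subst emeasure_density)
         (auto simp: S_def simp flip: nn_integral_indicator
           intro!: nn_integral_cong borel_measurable_indicator split: split_indicator)
    then show ?thesis by simp
  qed
  show "emeasure ?M X = emeasure ?N X" if X_in: "X \<in> range (\<lambda>r. {..<r})" for X
  proof -
    obtain r where X: "X = {..<r}" using X_in by auto
    show ?thesis
    proof (cases "0 < r")
      case True
      have "(r powr (1 / p)) ^ DIM('a) = r powr (?D / p)"
        using True by (simp add: powr_realpow[symmetric] powr_powr)
      then show ?thesis
        using True N[of r] M[of r] cone[of "r powr (1 / p)"] by (simp add: X mult.commute)
    next
      case False
      then have "(\<lambda>x::'a. norm x powr p) -` X = {}"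
        by (auto simp: X) (metis linorder_not_less order.trans powr_ge_zero)
      then have "emeasure ?M X = 0" by (simp add: emeasure_distr X)
      moreover have "emeasure ?N X = 0"
        using False by (auto simp: X emeasure_density nn_integral_0_iff_AE split: split_indicator)
      ultimately show ?thesis by simp
    qed
  qed
  show "Int_stable (range (\<lambda>r::real. {..<r}))"
  proof -
    have "{..<a} \<inter> {..<b} = {..<min a b}" for a b :: real by auto
    then show ?thesis by (auto simp: Int_stable_def)
  qed
  show "range (\<lambda>n::nat. {..<real n}) \<subseteq> range (\<lambda>r. {..<r})" by auto
  show "(\<Union>n::nat. {..<real n}) = UNIV"
    using reals_Archimedean2 by auto
  show "emeasure ?M {..<real n} \<noteq> \<infinity>" for n :: nat
  proof (cases "n = 0")
    case True
    then have "(\<lambda>x::'a. norm x powr p) -` {..<real n} = {}"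
      by auto
    then show ?thesis by (simp add: emeasure_distr)
  qed (use M[of n] fin[of "real n powr (1 / p)"] in auto)
  show "sets ?M = sigma_sets UNIV (range (\<lambda>r. {..<r}))" "sets ?N = sigma_sets UNIV (range (\<lambda>r. {..<r}))"
    by (simp_all add: borel_Iio)
qed simp_all

text \<open>For fixed \<open>g\<close> both sides are integrals of \<open>h\<close> against a
  measure on directions. On a set \<open>B\<close> of directions these measures agree by
  \<open>distr_norm_powr_cone\<close>, and equality of measures gives all \<open>h\<close> at once.
  The exponent \<open>p\<close> is kept free because \<open>p = 2\<close> leads directly to Gamma
  and Beta integrals, while \<open>p = 1\<close> gives the law of the norm itself.\<close>

lemma nn_integral_polar:
  fixes h :: "'a::euclidean_space \<Rightarrow> ennreal" and g :: "real \<Rightarrow> ennreal"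
  assumes [measurable]: "h \<in> borel_measurable borel" "g \<in> borel_measurable borel" and p: "0 < p"
  shows "(\<integral>\<^sup>+x. h (sgn x) * g (norm x powr p) \<partial>lborel) =
    (\<integral>\<^sup>+x. h (sgn x) * indicator (ball 0 1) x \<partial>lborel) *
    (\<integral>\<^sup>+r. g r * ennreal (indicator {0..} r * (DIM('a) / p * r powr (DIM('a) / p - 1))) \<partial>lborel)"
proof -
  define K where "K = (\<integral>\<^sup>+r. g r * ennreal (indicator {0..} r * (DIM('a) / p * r powr (DIM('a) / p - 1))) \<partial>lborel)"
  let ?\<mu> = "distr (density lborel (\<lambda>x::'a. g (norm x powr p))) borel sgn"
  let ?\<nu> = "scale_measure K (distr (density lborel (\<lambda>x::'a. indicator (ball 0 1) x)) borel sgn)"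
  have [measurable, simp]: "(indicator (ball 0 1) :: 'a \<Rightarrow> ennreal) \<in> borel_measurable borel"
    by (intro borel_measurable_indicator) auto
  have "?\<mu> = ?\<nu>"
  proof (rule measure_eqI)
    fix B assume "B \<in> sets ?\<mu>"
    then have B [measurable]: "B \<in> sets borel" by simp
    have "emeasure ?\<mu> B = (\<integral>\<^sup>+x. g (norm x powr p) * indicator B (sgn x) \<partial>lborel)"
      by (subst emeasure_distr, simp_all, subst emeasure_density)
         (auto simp: measurable_sets_borel[OF _ B] intro!: nn_integral_cong split: split_indicator)
    also have "\<dots> = (\<integral>\<^sup>+r. g r \<partial>distr (density lborel (\<lambda>x::'a. indicator B (sgn x))) borel (\<lambda>x. norm x powr p))"
      by (simp add: nn_integral_distr nn_integral_density mult.commute)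
    also have "\<dots> = emeasure lborel {x \<in> ball 0 1. sgn x \<in> B} * K"
      by (subst distr_norm_powr_cone[OF B p])
         (simp add: nn_integral_density nn_integral_cmult[symmetric] K_def mult_ac)
    also have "emeasure lborel {x \<in> ball 0 1. sgn x \<in> B} =
        emeasure (distr (density lborel (\<lambda>x::'a. indicator (ball 0 1) x)) borel sgn) B"
    proof -
      have "emeasure (distr (density lborel (\<lambda>x::'a. indicator (ball 0 1) x)) borel sgn) B =
          (\<integral>\<^sup>+x. indicator {x \<in> ball 0 1. sgn x \<in> B} x \<partial>lborel)"
        by (subst emeasure_distr, simp_all, subst emeasure_density)
           (auto simp: measurable_sets_borel[OF _ B] simp flip: nn_integral_indicator
             intro!: nn_integral_cong borel_measurable_indicator split: split_indicator)
      then show ?thesis by simp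
    qed
    finally show "emeasure ?\<mu> B = emeasure ?\<nu> B" by (simp add: mult.commute)
  qed simp
  then have "(\<integral>\<^sup>+x. h x \<partial>?\<mu>) = (\<integral>\<^sup>+x. h x \<partial>?\<nu>)" by simp
  then show ?thesis
    by (simp add: nn_integral_scale_measure nn_integral_distr nn_integral_density K_def mult_ac)
qed

lemma nn_integral_radial:
  fixes g :: "real \<Rightarrow> ennreal"
  assumes [measurable]: "g \<in> borel_measurable borel" and p: "0 < p"
  shows "(\<integral>\<^sup>+x. g (norm (x::'a::euclidean_space) powr p) \<partial>lborel) =
    ennreal (unit_ball_vol DIM('a)) *
    (\<integral>\<^sup>+r. g r * ennreal (indicator {0..} r * (DIM('a) / p * r powr (DIM('a) / p - 1))) \<partial>lborel)"
  using nn_integral_polar[of "\<lambda>_::'a. 1" g p] p by (simp add: emeasure_ball)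

section \<open>Dirichlet weights on the renewal simplex\<close>

lemma Gamma_real_neq_0: "0 < x \<Longrightarrow> Gamma x \<noteq> (0 :: real)"
  by (rule less_imp_neq[OF Gamma_real_pos, symmetric])

lemma nn_integral_PiM_scale:
  fixes g :: "('i \<Rightarrow> real) \<Rightarrow> ennreal"
  assumes "finite I" and c: "0 < c" and "g \<in> borel_measurable (PiM I (\<lambda>_. lborel))"
  shows "(\<integral>\<^sup>+\<tau>. g \<tau> \<partial>PiM I (\<lambda>_. lborel)) =
    ennreal (c ^ card I) * (\<integral>\<^sup>+\<tau>. g (\<lambda>i\<in>I. c * \<tau> i) \<partial>PiM I (\<lambda>_. lborel))"
  using assms(1,3)
proof (induction I arbitrary: g rule: finite_induct)
  case empty
  interpret product_sigma_finite "\<lambda>_::'i. lborel :: real measure" ..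
  show ?case by (simp add: PiM_empty nn_integral_count_space_finite)
next
  case (insert i I)
  interpret product_sigma_finite "\<lambda>_::'i. lborel :: real measure" ..
  note [measurable] = insert.prems
  have meas [measurable]: "(\<lambda>x. \<lambda>i\<in>insert i I. c * x i) \<in>
      PiM (insert i I) (\<lambda>_. lborel) \<rightarrow>\<^sub>M PiM (insert i I) (\<lambda>_. lborel)"
    by (rule measurable_restrict) (simp add: measurable_component_singleton)
  have "(\<integral>\<^sup>+\<tau>. g \<tau> \<partial>PiM (insert i I) (\<lambda>_. lborel)) =
      (\<integral>\<^sup>+x. \<integral>\<^sup>+y. g (x(i := y)) \<partial>lborel \<partial>PiM I (\<lambda>_. lborel))"
    using insert by (simp add: product_nn_integral_insert)
  also have "\<dots> = (\<integral>\<^sup>+x. ennreal c * \<integral>\<^sup>+y. g (x(i := c * y)) \<partial>lborel \<partial>PiM I (\<lambda>_. lborel))"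
  proof (rule nn_integral_cong)
    fix x :: "'i \<Rightarrow> real" assume x: "x \<in> space (PiM I (\<lambda>_. lborel))"
    have "(\<lambda>y. x(i := y)) \<in> lborel \<rightarrow>\<^sub>M PiM (insert i I) (\<lambda>_. lborel)"
      using measurable_component_update[OF x insert.hyps(2)] by simp
    then have "(\<lambda>y. g (x(i := y))) \<in> borel_measurable lborel" by measurable
    then have "(\<lambda>y. g (x(i := y))) \<in> borel_measurable borel" by simp
    then show "(\<integral>\<^sup>+y. g (x(i := y)) \<partial>lborel) = ennreal c * \<integral>\<^sup>+y. g (x(i := c * y)) \<partial>lborel"
      using nn_integral_real_affine[of "\<lambda>y. g (x(i := y))" c 0] c by simp
  qed
  also have "\<dots> = ennreal c * (\<integral>\<^sup>+x. (\<integral>\<^sup>+y. g (x(i := c * y)) \<partial>lborel) \<partial>PiM I (\<lambda>_. lborel))"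
    by (rule nn_integral_cmult) measurable
  also have "(\<integral>\<^sup>+x. (\<integral>\<^sup>+y. g (x(i := c * y)) \<partial>lborel) \<partial>PiM I (\<lambda>_. lborel)) =
      ennreal (c ^ card I) *
      (\<integral>\<^sup>+x. (\<integral>\<^sup>+y. g ((\<lambda>i\<in>I. c * x i)(i := c * y)) \<partial>lborel) \<partial>PiM I (\<lambda>_. lborel))"
    by (rule insert.IH) measurable
  also have "(\<integral>\<^sup>+x. (\<integral>\<^sup>+y. g ((\<lambda>i\<in>I. c * x i)(i := c * y)) \<partial>lborel) \<partial>PiM I (\<lambda>_. lborel)) =
      (\<integral>\<^sup>+x. (\<integral>\<^sup>+y. g (\<lambda>j\<in>insert i I. c * (x(i := y)) j) \<partial>lborel) \<partial>PiM I (\<lambda>_. lborel))"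
    using insert.hyps(2)
    by (intro nn_integral_cong arg_cong[where f = g]) (auto simp: fun_eq_iff)
  also have "\<dots> = (\<integral>\<^sup>+\<tau>. g (\<lambda>i\<in>insert i I. c * \<tau> i) \<partial>PiM (insert i I) (\<lambda>_. lborel))"
    using insert.hyps by (subst product_nn_integral_insert) auto
  also have "ennreal c * (ennreal (c ^ card I) * \<dots>) = ennreal (c ^ card (insert i I)) * \<dots>"
  proof -
    have "ennreal (c ^ card (insert i I)) = ennreal c * ennreal (c ^ card I)"
      using insert.hyps c by (simp add: ennreal_mult)
    then show ?thesis by (simp only: mult.assoc)
  qed
  finally show ?case .
qed

lemma nn_integral_Gamma:
  assumes x: "0 < x" and c: "0 < c"
  shows "(\<integral>\<^sup>+t. ennreal (indicator {0<..} t * (t powr (x - 1) * exp (- (c * t)))) \<partial>lborel) =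
    ennreal (Gamma x * c powr (- x))"
proof -
  have "(\<integral>\<^sup>+t. ennreal (t powr (x - 1) / exp t) * indicator {0..} t \<partial>lborel) = ennreal (Gamma x)"
    by (rule nn_integral_has_integral_lebesgue'[OF _ Gamma_integral_real[OF x]]) auto
  moreover have "(\<integral>\<^sup>+t. ennreal (t powr (x - 1) / exp t) * indicator {0..} t \<partial>lborel) =
    (\<integral>\<^sup>+t. ennreal (indicator {0<..} t * (t powr (x - 1) * exp (- t))) \<partial>lborel)"
    using AE_lborel_singleton[of 0]
    by (intro nn_integral_cong_AE, eventually_elim)
       (auto simp: exp_minus field_simps split: split_indicator)
  ultimately have "ennreal (Gamma x) = (\<integral>\<^sup>+t. ennreal (indicator {0<..} t * (t powr (x - 1) * exp (- t))) \<partial>lborel)"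
    by simp
  also have "\<dots> = ennreal c *
     (\<integral>\<^sup>+t. ennreal (indicator {0<..} (c * t) * ((c * t) powr (x - 1) * exp (- (c * t)))) \<partial>lborel)"
    using c by (subst nn_integral_real_affine[where c = c and t = 0]) simp_all
  also have "\<dots> = ennreal c * (\<integral>\<^sup>+t. ennreal (c powr (x - 1)) *
      ennreal (indicator {0<..} t * (t powr (x - 1) * exp (- (c * t)))) \<partial>lborel)"
    using c by (intro arg_cong2[where f = "(*)"] nn_integral_cong)
      (auto simp: ennreal_mult[symmetric] powr_mult zero_less_mult_iff split: split_indicator)
  also have "\<dots> = ennreal c * (ennreal (c powr (x - 1)) *
      (\<integral>\<^sup>+t. ennreal (indicator {0<..} t * (t powr (x - 1) * exp (- (c * t)))) \<partial>lborel))"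
    by (subst nn_integral_cmult) simp_all
  also have "\<dots> = ennreal (c powr x) *
      (\<integral>\<^sup>+t. ennreal (indicator {0<..} t * (t powr (x - 1) * exp (- (c * t)))) \<partial>lborel)"
    using c by (simp add: mult.assoc[symmetric] ennreal_mult[symmetric] powr_diff)
  finally have eq: "ennreal (Gamma x) = ennreal (c powr x) *
      (\<integral>\<^sup>+t. ennreal (indicator {0<..} t * (t powr (x - 1) * exp (- (c * t)))) \<partial>lborel)" .
  have "ennreal (c powr (- x)) * ennreal (Gamma x) = ennreal (c powr (- x) * c powr x) *
      (\<integral>\<^sup>+t. ennreal (indicator {0<..} t * (t powr (x - 1) * exp (- (c * t)))) \<partial>lborel)"
    unfolding eq by (simp add: mult.assoc[symmetric] ennreal_mult)
  also have "c powr (- x) * c powr x = 1"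
    using c by (simp flip: powr_add)
  finally show ?thesis
    by (simp only: ennreal_1 mult_1_left ennreal_mult'[OF powr_ge_zero] mult.commute[of "Gamma x"])
qed

declare One_nat_def [simp del]

text \<open>A linear form in all \<open>n + 1\<close> gaps. The last gap is determined by the others
  and is no coordinate of the simplex, hence its separate coefficient \<open>z\<close>.\<close>

definition gap_sum :: "nat \<Rightarrow> real \<Rightarrow> (nat \<Rightarrow> real) \<Rightarrow> real \<Rightarrow> (nat \<Rightarrow> real) \<Rightarrow> real" where
  "gap_sum n t y z x = (\<Sum>j=1..n. x j * y j) + (t - sum x {1..n}) * z"

abbreviation gap_weight :: "nat \<Rightarrow> real \<Rightarrow> real \<Rightarrow> (nat \<Rightarrow> real) \<Rightarrow> real" where
  "gap_weight n t a x \<equiv> gap_product n t (a - 1) x * indicator (renewal_simplex n t) x"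

abbreviation lborel_gaps :: "nat \<Rightarrow> (nat \<Rightarrow> real) measure" where
  "lborel_gaps n \<equiv> PiM {1..n} (\<lambda>_. lborel)"

lemma renewal_simplexD:
  assumes "x \<in> renewal_simplex n t" "1 \<le> n"
  shows "sum x {1..n} < t" "\<And>j. j \<in> {1..n} \<Longrightarrow> 0 < x j"
proof -
  have "{1..n} = insert n {1..<n}" using \<open>1 \<le> n\<close> by auto
  then have "sum x {1..n} = x n + (\<Sum>j\<in>{1..<n}. x j)" by simp
  then show "sum x {1..n} < t"
    using assms(2) bspec[OF assms(1)[unfolded renewal_simplex_def mem_Collect_eq], of n] by simp
  show "\<And>j. j \<in> {1..n} \<Longrightarrow> 0 < x j"
    using assms by (auto simp: renewal_simplex_def)
qed

text \<open>With positive gaps the partial sums increase, so the successive upper bounds reduce to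
  the one on the total sum. For \<open>n = 0\<close> the defining condition is empty and says
  nothing about \<open>t\<close>, hence \<open>1 \<le> n\<close>.\<close>

lemma renewal_simplex_iff:
  assumes "1 \<le> n"
  shows "x \<in> renewal_simplex n t \<longleftrightarrow> (\<forall>j\<in>{1..n}. 0 < x j) \<and> sum x {1..n} < t"
proof (intro iffI conjI ballI)
  assume r: "(\<forall>j\<in>{1..n}. 0 < x j) \<and> sum x {1..n} < t"
  have "x j < t - (\<Sum>i\<in>{1..<j}. x i)" if j: "j \<in> {1..n}" for j
  proof -
    have "(\<Sum>i\<in>insert j {1..<j}. x i) \<le> (\<Sum>i=1..n. x i)"
      using r j by (intro sum_mono2) (auto intro: less_imp_le)
    then show ?thesis using r by simp
  qed
  then show "x \<in> renewal_simplex n t" using r by (simp add: renewal_simplex_def)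
qed (use renewal_simplexD[OF _ assms] in auto)

lemma gap_sum_pos:
  assumes "x \<in> renewal_simplex n t" "1 \<le> n" "\<And>j. j \<in> {1..n} \<Longrightarrow> 0 < y j" "0 < z"
  shows "0 < gap_sum n t y z x"
  using renewal_simplexD[OF assms(1,2)] assms(3,4) unfolding gap_sum_def
  by (intro add_nonneg_pos sum_nonneg mult_pos_pos) (auto intro!: mult_nonneg_nonneg less_imp_le)

context
  fixes n :: nat
  assumes n: "1 \<le> n"
begin

lemma measurable_component_PiM [measurable]:
  "j \<in> {1..n} \<Longrightarrow> (\<lambda>x. x j) \<in> borel_measurable (lborel_gaps n)"
  using measurable_component_singleton[of j "{1..n}" "\<lambda>_. lborel :: real measure"]
  by simp

lemma pred_renewal_simplex [measurable]:
  "(\<lambda>x. x \<in> renewal_simplex n t) \<in> measurable (lborel_gaps n) (count_space UNIV)"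
  unfolding renewal_simplex_iff[OF n] by measurable

lemma indicator_renewal_simplex_measurable [measurable]:
  "(\<lambda>x. indicator (renewal_simplex n t) x :: real) \<in> borel_measurable (lborel_gaps n)"
  unfolding indicator_def by (simp add: of_bool_def) measurable

lemma gap_product_measurable [measurable]:
  "gap_product n t a \<in> borel_measurable (lborel_gaps n)"
  unfolding gap_product_def [abs_def] by measurable

lemma gap_sum_measurable [measurable]:
  "gap_sum n t y z \<in> borel_measurable (lborel_gaps n)"
  unfolding gap_sum_def [abs_def] by measurable

lemma gap_product_nonneg: "0 \<le> gap_product n t a x"
  by (simp add: gap_product_def prod_nonneg)

text \<open>The dilation by \<open>t\<close> contributes \<open>n\<close> powers from Lebesgue
  measure and \<open>(n + 1) * (a - 1)\<close> from the weight, together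
  \<open>(n + 1) * a - 1\<close>.\<close>

lemma nn_integral_renewal_simplex_scale:
  assumes t: "0 < t" and [measurable]: "\<psi> \<in> borel_measurable borel"
  shows "(\<integral>\<^sup>+x. ennreal (gap_weight n t a x) *
      \<psi> (gap_sum n t y z x) \<partial>lborel_gaps n) =
    ennreal (t powr ((real n + 1) * a - 1)) *
    (\<integral>\<^sup>+x. ennreal (gap_weight n 1 a x) *
      \<psi> (t * gap_sum n 1 y z x) \<partial>lborel_gaps n)"
proof -
  have S: "(\<lambda>j\<in>{1..n}. t * x j) \<in> renewal_simplex n t \<longleftrightarrow> x \<in> renewal_simplex n 1" for x
    using t by (auto simp: renewal_simplex_iff[OF n] zero_less_mult_iff sum_distrib_left[symmetric])
  have G: "gap_sum n t y z (\<lambda>j\<in>{1..n}. t * x j) = t * gap_sum n 1 y z x" for x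
    by (simp add: gap_sum_def sum_distrib_left algebra_simps)
  have P: "gap_product n t (a - 1) (\<lambda>j\<in>{1..n}. t * x j) =
      t powr ((real n + 1) * (a - 1)) * gap_product n 1 (a - 1) x" if "x \<in> renewal_simplex n 1" for x
  proof -
    have "(\<Prod>j=1..n. (t * x j) powr (a - 1)) = (\<Prod>j=1..n. t powr (a - 1) * x j powr (a - 1))"
      using t renewal_simplexD(2)[OF that n]
      by (intro prod.cong) (auto simp: powr_mult less_imp_le)
    also have "\<dots> = t powr (real n * (a - 1)) * (\<Prod>j=1..n. x j powr (a - 1))"
      using t by (simp add: prod.distrib powr_power mult.commute)
    finally have 1: "(\<Prod>j=1..n. (t * x j) powr (a - 1)) = \<dots>" .
    have "t - (\<Sum>j=1..n. t * x j) = t * (1 - sum x {1..n})"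
      by (simp add: sum_distrib_left algebra_simps)
    then have 2: "(t - (\<Sum>j=1..n. t * x j)) powr (a - 1) =
        t powr (a - 1) * (1 - sum x {1..n}) powr (a - 1)"
      using t renewal_simplexD(1)[OF that n] by (simp add: powr_mult)
    have "t powr ((real n + 1) * (a - 1)) = t powr (real n * (a - 1)) * t powr (a - 1)"
      by (simp add: powr_add[symmetric] algebra_simps)
    then show ?thesis
      using 1 2 by (simp add: gap_product_def)
  qed
  have e: "t ^ n * t powr ((real n + 1) * (a - 1)) = t powr ((real n + 1) * a - 1)"
    using t by (simp add: powr_realpow[symmetric] powr_add[symmetric] algebra_simps)
  have "(\<integral>\<^sup>+x. ennreal (gap_weight n t a x) *
      \<psi> (gap_sum n t y z x) \<partial>lborel_gaps n) =
    ennreal (t ^ n) * (\<integral>\<^sup>+x. ennreal (gap_product n t (a - 1) (\<lambda>j\<in>{1..n}. t * x j) *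
        indicator (renewal_simplex n t) (\<lambda>j\<in>{1..n}. t * x j)) *
      \<psi> (gap_sum n t y z (\<lambda>j\<in>{1..n}. t * x j)) \<partial>lborel_gaps n)"
    using t by (subst nn_integral_PiM_scale[where c = t]) simp_all
  also have "\<dots> = ennreal (t ^ n) * (\<integral>\<^sup>+x. ennreal (t powr ((real n + 1) * (a - 1))) *
      (ennreal (gap_weight n 1 a x) *
      \<psi> (t * gap_sum n 1 y z x)) \<partial>lborel_gaps n)"
    by (rule arg_cong2[where f = "(*)", OF refl], rule nn_integral_cong)
       (auto simp: G S P ennreal_mult gap_product_nonneg mult.assoc split: split_indicator)
  also have "\<dots> = ennreal (t ^ n) * (ennreal (t powr ((real n + 1) * (a - 1))) *
      (\<integral>\<^sup>+x. (ennreal (gap_weight n 1 a x) *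
      \<psi> (t * gap_sum n 1 y z x)) \<partial>lborel_gaps n))"
    by (subst nn_integral_cmult) simp_all
  finally show ?thesis
    using t by (simp add: mult.assoc[symmetric] ennreal_mult[symmetric] e)
qed

text \<open>Integrating over \<open>t\<close> as well frees the last gap: after Fubini a translation
  by the sum of the others makes it an independent variable, and \<open>n + 1\<close> separate Gamma
  integrals remain.\<close>

lemma nn_integral_renewal_simplex_exp:
  assumes a: "0 < a" and y: "\<And>j. j \<in> {1..n} \<Longrightarrow> 0 < y j" and z: "0 < z"
  shows "(\<integral>\<^sup>+t. ennreal (indicator {0<..} t) *
      (\<integral>\<^sup>+x. ennreal (gap_weight n t a x) *
        ennreal (exp (- gap_sum n t y z x)) \<partial>lborel_gaps n) \<partial>lborel) =
    ennreal (Gamma a ^ (n + 1) * (z powr (- a) * (\<Prod>j=1..n. y j powr (- a))))"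
proof -
  interpret product_sigma_finite "\<lambda>_::nat. lborel :: real measure" ..
  interpret P: sigma_finite_measure "lborel_gaps n"
    by (rule sigma_finite) simp
  interpret PP: pair_sigma_finite "lborel :: real measure" "lborel_gaps n" ..
  let ?P = "lborel_gaps n"
  define G where "G y t = ennreal (indicator {0<..} t * (t powr (a - 1) * exp (- (y * t))))" for y t :: real
  have G_meas [measurable]: "G y \<in> borel_measurable borel" for y
    unfolding G_def by measurable
  have G_int: "(\<integral>\<^sup>+t. G y t \<partial>lborel) = ennreal (Gamma a * y powr (- a))" if "0 < y" for y
    unfolding G_def by (rule nn_integral_Gamma[OF a that])
  \<comment> \<open>The product form holds for all \<open>t\<close> and \<open>x\<close>: off the
    simplex some gap is not positive, so one of the factors \<open>G\<close> vanishes, and on the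
    simplex \<open>0 < t\<close> is automatic.\<close>
  have eq: "ennreal (indicator {0<..} t) * (ennreal (gap_weight n t a x) *
        ennreal (exp (- gap_sum n t y z x))) = (\<Prod>j=1..n. G (y j) (x j)) * G z (t - sum x {1..n})" for t x
  proof (cases "x \<in> renewal_simplex n t")
    case True
    note D = renewal_simplexD[OF True n]
    have e: "exp (- gap_sum n t y z x) =
        (\<Prod>j=1..n. exp (- (y j * x j))) * exp (- (z * (t - sum x {1..n})))"
      by (simp add: gap_sum_def exp_add[symmetric] exp_sum[symmetric] sum_negf mult.commute)
    have "0 < t" using D(1) sum_nonneg[of "{1..n}" x] D(2) by (force intro: less_imp_le le_less_trans)
    moreover have "(\<Prod>j=1..n. G (y j) (x j)) = ennreal (\<Prod>j=1..n. x j powr (a - 1) * exp (- (y j * x j)))"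
      using D(2) by (subst prod_ennreal[symmetric]) (auto simp: G_def intro!: prod.cong)
    moreover have "G z (t - sum x {1..n}) =
        ennreal ((t - sum x {1..n}) powr (a - 1) * exp (- (z * (t - sum x {1..n}))))"
      using D(1) by (simp add: G_def)
    ultimately show ?thesis
      using True
      by (simp add: e ennreal_mult[symmetric] gap_product_nonneg prod_nonneg gap_product_def prod.distrib mult_ac)
  next
    case False
    then have "sum x {1..n} \<ge> t \<or> (\<exists>j\<in>{1..n}. x j \<le> 0)"
      by (auto simp: renewal_simplex_iff[OF n] not_less)
    then have "(\<Prod>j=1..n. G (y j) (x j)) = 0 \<or> G z (t - sum x {1..n}) = 0"
    proof (elim disjE bexE)
      fix j assume "j \<in> {1..n}" "x j \<le> 0"
      then show ?thesis by (intro disjI1 prod_zero) (auto simp: G_def intro!: bexI[of _ j])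
    qed (simp add: G_def)
    then show ?thesis using False by auto
  qed
  have "(\<integral>\<^sup>+t. ennreal (indicator {0<..} t) *
      (\<integral>\<^sup>+x. ennreal (gap_weight n t a x) *
        ennreal (exp (- gap_sum n t y z x)) \<partial>?P) \<partial>lborel) =
      (\<integral>\<^sup>+t. \<integral>\<^sup>+x. (\<Prod>j=1..n. G (y j) (x j)) * G z (t - sum x {1..n}) \<partial>?P \<partial>lborel)"
    unfolding eq[symmetric] by (intro nn_integral_cong nn_integral_cmult[symmetric]) measurable
  also have "\<dots> = (\<integral>\<^sup>+x. \<integral>\<^sup>+t. (\<Prod>j=1..n. G (y j) (x j)) * G z (t - sum x {1..n}) \<partial>lborel \<partial>?P)"
    by (rule PP.Fubini'[symmetric]) measurable
  also have "\<dots> = (\<integral>\<^sup>+x. (\<Prod>j=1..n. G (y j) (x j)) * ennreal (Gamma a * z powr (- a)) \<partial>?P)"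
  proof (rule nn_integral_cong)
    fix x :: "nat \<Rightarrow> real"
    have "(\<integral>\<^sup>+t. G z (t - sum x {1..n}) \<partial>lborel) = (\<integral>\<^sup>+t. G z t \<partial>lborel)"
      using nn_integral_real_affine[of "G z" 1 "- sum x {1..n}"] by simp
    then show "(\<integral>\<^sup>+t. (\<Prod>j=1..n. G (y j) (x j)) * G z (t - sum x {1..n}) \<partial>lborel) =
        (\<Prod>j=1..n. G (y j) (x j)) * ennreal (Gamma a * z powr (- a))"
      by (simp add: nn_integral_cmult G_int z)
  qed
  also have "\<dots> = (\<integral>\<^sup>+x. (\<Prod>j=1..n. G (y j) (x j)) \<partial>?P) * ennreal (Gamma a * z powr (- a))"
    by (rule nn_integral_multc) measurable
  also have "(\<integral>\<^sup>+x. (\<Prod>j=1..n. G (y j) (x j)) \<partial>?P) = (\<Prod>j=1..n. \<integral>\<^sup>+t. G (y j) t \<partial>lborel)"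
    by (rule product_nn_integral_prod) simp_all
  also have "\<dots> = ennreal (\<Prod>j=1..n. Gamma a * y j powr (- a))"
    using y a by (subst prod_ennreal[symmetric]) (auto simp: G_int Gamma_real_pos less_imp_le intro!: prod.cong)
  finally show ?thesis
    using a by (simp add: ennreal_mult[symmetric] prod.distrib prod_nonneg Gamma_real_nonneg
      power_add mult_ac)
qed

text \<open>Both sides of this Markov-Krein type identity are obtained from the Laplace transform in
  \<open>t\<close> of an iterated convolution of Gamma densities: by Fubini it factorises, and by scaling it
  is a Gamma integral.\<close>

lemma nn_integral_renewal_simplex_powr:
  assumes a: "0 < a" and t: "0 < t" and y: "\<And>j. j \<in> {1..n} \<Longrightarrow> 0 < y j" and z: "0 < z"
  shows "(\<integral>\<^sup>+x. ennreal (gap_weight n t a x) *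
      ennreal (gap_sum n t y z x powr (- ((real n + 1) * a))) \<partial>lborel_gaps n) =
    ennreal (Gamma a ^ (n + 1) / Gamma ((real n + 1) * a) / t * (z powr (- a) * (\<Prod>j=1..n. y j powr (- a))))"
proof -
  interpret product_sigma_finite "\<lambda>_::nat. lborel :: real measure" ..
  interpret P: sigma_finite_measure "lborel_gaps n"
    by (rule sigma_finite) simp
  interpret PP: pair_sigma_finite "lborel :: real measure" "lborel_gaps n" ..
  let ?P = "lborel_gaps n"
  define A where "A = (real n + 1) * a"
  have A: "0 < A" using a by (simp add: A_def add_pos_nonneg)
  let ?w = "\<lambda>x. ennreal (gap_weight n 1 a x)"
  let ?g = "gap_sum n 1 y z"
  let ?K = "Gamma a ^ (n + 1) * (z powr (- a) * (\<Prod>j=1..n. y j powr (- a)))"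
  have "ennreal ?K = (\<integral>\<^sup>+t. ennreal (indicator {0<..} t) *
      (\<integral>\<^sup>+x. ennreal (gap_weight n t a x) *
        ennreal (exp (- gap_sum n t y z x)) \<partial>?P) \<partial>lborel)"
    by (rule nn_integral_renewal_simplex_exp[OF a y z, symmetric])
  \<comment> \<open>Moving to the unit simplex leaves \<open>t\<close> only in the power
    \<open>A - 1\<close> and as a factor in the exponential. The remaining Gamma integral in
    \<open>t\<close> then produces exactly the power \<open>- A\<close> of
    \<open>gap_sum\<close>.\<close>
  also have "\<dots> = (\<integral>\<^sup>+t. ennreal (indicator {0<..} t) *
      (ennreal (t powr (A - 1)) * (\<integral>\<^sup>+x. ?w x * ennreal (exp (- (t * ?g x))) \<partial>?P)) \<partial>lborel)"
    using nn_integral_renewal_simplex_scale[of _ "\<lambda>x. ennreal (exp (- x))"]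
    by (intro nn_integral_cong) (auto simp: A_def split: split_indicator)
  also have "\<dots> = (\<integral>\<^sup>+t. \<integral>\<^sup>+x. ?w x *
      ennreal (indicator {0<..} t * (t powr (A - 1) * exp (- (?g x * t)))) \<partial>?P \<partial>lborel)"
    by (intro nn_integral_cong, subst nn_integral_cmult[symmetric], simp, measurable,
        subst nn_integral_cmult[symmetric], simp, measurable)
       (auto intro!: nn_integral_cong simp: ennreal_mult mult_ac)
  also have "\<dots> = (\<integral>\<^sup>+x. \<integral>\<^sup>+t. ?w x *
      ennreal (indicator {0<..} t * (t powr (A - 1) * exp (- (?g x * t)))) \<partial>lborel \<partial>?P)"
    by (rule PP.Fubini'[symmetric]) measurable
  also have "\<dots> = (\<integral>\<^sup>+x. ennreal (Gamma A) * (?w x * ennreal (?g x powr (- A))) \<partial>?P)"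
  proof (rule nn_integral_cong)
    fix x :: "nat \<Rightarrow> real"
    have "(\<integral>\<^sup>+t. ?w x * ennreal (indicator {0<..} t * (t powr (A - 1) * exp (- (?g x * t)))) \<partial>lborel) =
        ?w x * (\<integral>\<^sup>+t. ennreal (indicator {0<..} t * (t powr (A - 1) * exp (- (?g x * t)))) \<partial>lborel)"
      by (rule nn_integral_cmult) simp
    also have "\<dots> = ennreal (Gamma A) * (?w x * ennreal (?g x powr (- A)))"
    proof (cases "x \<in> renewal_simplex n 1")
      case True
      have "0 < ?g x" by (rule gap_sum_pos[OF True n y z])
      then show ?thesis
        using A by (subst nn_integral_Gamma) (simp_all add: ennreal_mult' mult_ac Gamma_real_nonneg)
    qed simp
    finally show "(\<integral>\<^sup>+t. ?w x * ennreal (indicator {0<..} t * (t powr (A - 1) * exp (- (?g x * t)))) \<partial>lborel) = \<dots>" .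
  qed
  also have "\<dots> = ennreal (Gamma A) * (\<integral>\<^sup>+x. ?w x * ennreal (?g x powr (- A)) \<partial>?P)"
    by (rule nn_integral_cmult) measurable
  finally have K: "ennreal ?K = \<dots>" .
  have "(\<integral>\<^sup>+x. ennreal (gap_weight n t a x) *
      ennreal (gap_sum n t y z x powr (- A)) \<partial>?P) =
      ennreal (t powr (A - 1)) * (\<integral>\<^sup>+x. ?w x * ennreal ((t * ?g x) powr (- A)) \<partial>?P)"
    unfolding A_def using nn_integral_renewal_simplex_scale[OF t, of "\<lambda>x. ennreal (x powr (- ((real n + 1) * a)))"]
    by simp
  also have "(\<integral>\<^sup>+x. ?w x * ennreal ((t * ?g x) powr (- A)) \<partial>?P) =
      (\<integral>\<^sup>+x. ennreal (t powr (- A)) * (?w x * ennreal (?g x powr (- A))) \<partial>?P)"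
    using t gap_sum_pos[OF _ n y z]
    by (intro nn_integral_cong)
       (auto simp: powr_mult ennreal_mult mult_ac less_imp_le split: split_indicator)
  also have "\<dots> = ennreal (t powr (- A)) * (\<integral>\<^sup>+x. ?w x * ennreal (?g x powr (- A)) \<partial>?P)"
    by (rule nn_integral_cmult) measurable
  also have "(\<integral>\<^sup>+x. ?w x * ennreal (?g x powr (- A)) \<partial>?P) = ennreal (1 / Gamma A) * ennreal ?K"
  proof -
    have "ennreal (1 / Gamma A) * ennreal (Gamma A) = 1"
      using A Gamma_real_neq_0[OF A] by (simp add: ennreal_mult[symmetric])
    then show ?thesis unfolding K by (simp add: mult.assoc[symmetric])
  qed
  also have "ennreal (t powr (A - 1)) * (ennreal (t powr (- A)) * \<dots>) = ennreal (1 / t * (1 / Gamma A * ?K))"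
  proof -
    have "t powr (A - 1) * t powr (- A) = 1 / t"
      using t by (simp add: powr_add[symmetric] powr_neg_one)
    moreover have "ennreal (t powr (A - 1)) * (ennreal (t powr (- A)) * (ennreal (1 / Gamma A) * ennreal ?K)) =
        ennreal (t powr (A - 1) * t powr (- A) * (1 / Gamma A * ?K))"
      using A a by (simp only: mult.assoc ennreal_mult'[OF powr_ge_zero] ennreal_mult' Gamma_real_nonneg
        zero_le_divide_1_iff less_imp_le)
    ultimately show ?thesis by simp
  qed
  finally show ?thesis by (simp add: A_def field_simps)
qed

end

declare measurable_component_PiM [measurable del] pred_renewal_simplex [measurable del]
  indicator_renewal_simplex_measurable [measurable del] gap_product_measurable [measurable del]
  gap_sum_measurable [measurable del]

declare One_nat_def [simp]

section \<open>Generating functions of moments\<close>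

text \<open>The moments of the law on \<open>[-1, 1]\<close> with density proportional to \<open>(1 - x\<^sup>2) powr (b - 1)\<close>.\<close>

definition sym_beta_moment :: "real \<Rightarrow> nat \<Rightarrow> real" where
  "sym_beta_moment b k = (if even k then pochhammer (1/2) (k div 2) / pochhammer (b + 1/2) (k div 2) else 0)"

lemma powr_neg_sums:
  fixes x a :: real
  assumes "\<bar>x\<bar> < 1"
  shows "(\<lambda>k. pochhammer a k / fact k * x ^ k) sums (1 - x) powr (- a)"
proof -
  have "(\<lambda>k. (- a gchoose k) * (- x) ^ k) sums (1 + - x) powr (- a)"
    using assms by (intro gen_binomial_real) simp
  also have "(\<lambda>k. (- a gchoose k) * (- x) ^ k) = (\<lambda>k. pochhammer a k / fact k * x ^ k)"
    by (simp add: gbinomial_pochhammer fun_eq_iff power_mult_distrib[symmetric] flip: mult.assoc)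
  finally show ?thesis by simp
qed

lemma sums_even_iff:
  fixes f :: "nat \<Rightarrow> 'a::real_normed_vector"
  assumes "\<And>k. odd k \<Longrightarrow> f k = 0"
  shows "f sums S \<longleftrightarrow> (\<lambda>k. f (2 * k)) sums S"
proof -
  have "f n = 0" if "n \<notin> range ((*) 2)" for n
    using assms that by (metis evenE rangeI)
  then show ?thesis
    using sums_mono_reindex[of "(*) (2::nat)" f S] by (auto simp: strict_mono_def)
qed

text \<open>Duplication splits \<open>pochhammer (2 * b) (2 * k)\<close> into
  \<open>4 ^ k * pochhammer b k * pochhammer (b + 1/2) k\<close> and \<open>fact (2 * k)\<close>
  into \<open>4 ^ k * pochhammer (1/2) k * fact k\<close>. The half-integer symbols cancel against
  the moment, and a binomial series in \<open>s\<^sup>2\<close> remains.\<close>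

lemma sym_beta_generating_2b:
  assumes s: "\<bar>s\<bar> < 1" and b: "0 < b"
  shows "(\<lambda>k. pochhammer (2 * b) k / fact k * s ^ k * sym_beta_moment b k) sums (1 - s\<^sup>2) powr (- b)"
proof (subst sums_even_iff)
  have s2: "\<bar>s\<^sup>2\<bar> < 1" using s by (simp add: power_less_one_iff abs_square_less_1)
  have "pochhammer (2 * b) (2 * k) / fact (2 * k) * s ^ (2 * k) * sym_beta_moment b (2 * k) =
      pochhammer b k / fact k * s\<^sup>2 ^ k" for k
  proof -
    have "pochhammer (b + 1/2) k \<noteq> 0" "pochhammer (1/2 :: real) k \<noteq> 0"
      using pochhammer_pos[of "b + 1/2" k] pochhammer_pos[of "1/2 :: real" k] b by auto
    moreover have "pochhammer (2 * b) (2 * k) = 2 ^ (2 * k) * (pochhammer b k * pochhammer (b + 1/2) k)"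
      using pochhammer_double[of b k] by simp
    ultimately show ?thesis
      unfolding sym_beta_moment_def fact_double power_mult[of s] by (simp del: power_mult)
  qed
  then show "(\<lambda>k. pochhammer (2 * b) (2 * k) / fact (2 * k) * s ^ (2 * k) * sym_beta_moment b (2 * k))
      sums (1 - s\<^sup>2) powr (- b)"
    using powr_neg_sums[OF s2, of b] by simp
qed (simp add: sym_beta_moment_def)

text \<open>The same cancellation, with duplication started at \<open>b + 1/2\<close>: its second
  factor is now \<open>pochhammer (b + 1) k\<close>, which raises the exponent by one.\<close>

lemma sym_beta_generating_2b1:
  assumes s: "\<bar>s\<bar> < 1" and b: "0 < b"
  shows "(\<lambda>k. pochhammer (2 * b + 1) k / fact k * s ^ k * sym_beta_moment b k) sums (1 - s\<^sup>2) powr (- (b + 1))"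
proof (subst sums_even_iff)
  have s2: "\<bar>s\<^sup>2\<bar> < 1" using s by (simp add: power_less_one_iff abs_square_less_1)
  have "pochhammer (2 * b + 1) (2 * k) / fact (2 * k) * s ^ (2 * k) * sym_beta_moment b (2 * k) =
      pochhammer (b + 1) k / fact k * s\<^sup>2 ^ k" for k
  proof -
    have "pochhammer (b + 1/2) k \<noteq> 0" "pochhammer (1/2 :: real) k \<noteq> 0"
      using pochhammer_pos[of "b + 1/2" k] pochhammer_pos[of "1/2 :: real" k] b by auto
    moreover have "pochhammer (2 * b + 1) (2 * k) =
        2 ^ (2 * k) * (pochhammer (b + 1/2) k * pochhammer (b + 1) k)"
      using pochhammer_double[of "b + 1/2" k] by (simp add: add.assoc)
    ultimately show ?thesis
      unfolding sym_beta_moment_def fact_double power_mult[of s] by (simp del: power_mult)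
  qed
  then show "(\<lambda>k. pochhammer (2 * b + 1) (2 * k) / fact (2 * k) * s ^ (2 * k) * sym_beta_moment b (2 * k))
      sums (1 - s\<^sup>2) powr (- (b + 1))"
    using powr_neg_sums[OF s2, of "b + 1"] by simp
qed (simp add: sym_beta_moment_def)

section \<open>Exchanging power series with expectations, and recovering moments\<close>

text \<open>The coefficients lie in a Banach space so that one interchange serves the real series
  for \<open>powr\<close> and \<open>exp\<close> and the complex one for the Fourier
  integral.\<close>

lemma sums_integral_power_series:
  fixes c :: "nat \<Rightarrow> 'b::{banach, second_countable_topology}" and Z :: "'a \<Rightarrow> real"
  assumes "finite_measure N" and Z [measurable]: "Z \<in> borel_measurable N"
    and bd: "AE w in N. \<bar>Z w\<bar> \<le> r" and sm: "summable (\<lambda>k. r ^ k * norm (c k))"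
  shows "integrable N (\<lambda>w. (\<Sum>k. Z w ^ k *\<^sub>R c k))"
    and "(\<lambda>k. (LINT w|N. Z w ^ k) *\<^sub>R c k) sums (LINT w|N. (\<Sum>k. Z w ^ k *\<^sub>R c k))"
proof -
  interpret finite_measure N by fact
  have le: "norm (z ^ k *\<^sub>R c k) \<le> r ^ k * norm (c k)" if "\<bar>z\<bar> \<le> r" for z k
    using that by (simp add: power_abs mult_right_mono power_mono)
  have zk: "integrable N (\<lambda>w. Z w ^ k)" for k
  proof (rule integrable_const_bound[where B = "r ^ k"])
    show "AE w in N. norm (Z w ^ k) \<le> r ^ k"
      using bd by eventually_elim (simp add: power_abs power_mono)
  qed measurable
  then have i: "integrable N (\<lambda>w. Z w ^ k *\<^sub>R c k)" for k
    by (rule integrable_scaleR_left)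
  have ae: "AE w in N. summable (\<lambda>k. norm (Z w ^ k *\<^sub>R c k))"
    using bd
  proof eventually_elim
    case (elim w)
    show ?case by (rule summable_comparison_test'[OF sm, of 0]) (use le[OF elim] in simp)
  qed
  have nb: "(LINT w|N. norm (Z w ^ k *\<^sub>R c k)) \<le> measure N (space N) * (r ^ k * norm (c k))" for k
  proof -
    have "(LINT w|N. norm (Z w ^ k *\<^sub>R c k)) \<le> (LINT w|N. r ^ k * norm (c k))"
    proof (rule integral_mono_AE[OF integrable_norm[OF i]])
      show "AE w in N. norm (Z w ^ k *\<^sub>R c k) \<le> r ^ k * norm (c k)"
        using bd by eventually_elim (rule le)
    qed simp
    then show ?thesis by simp
  qed
  have smi: "summable (\<lambda>k. LINT w|N. norm (Z w ^ k *\<^sub>R c k))"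
    by (rule summable_comparison_test'[OF summable_mult[OF sm], of 0]) (use nb in auto)
  show "integrable N (\<lambda>w. (\<Sum>k. Z w ^ k *\<^sub>R c k))"
    by (rule integrable_suminf[OF i ae smi])
  show "(\<lambda>k. (LINT w|N. Z w ^ k) *\<^sub>R c k) sums (LINT w|N. (\<Sum>k. Z w ^ k *\<^sub>R c k))"
    using sums_integral[OF i ae smi] unfolding integral_scaleR_left[OF zk] .
qed

lemma sums_expectation_powr:
  fixes Z :: "'a \<Rightarrow> real"
  assumes N: "finite_measure N" and Z [measurable]: "Z \<in> borel_measurable N"
    and bd: "AE w in N. \<bar>Z w\<bar> \<le> 1" and s: "\<bar>s\<bar> < 1"
  shows "integrable N (\<lambda>w. (1 - s * Z w) powr (- a))"
    and "(\<lambda>k. pochhammer a k / fact k * s ^ k * (LINT w|N. Z w ^ k)) sums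
      (LINT w|N. (1 - s * Z w) powr (- a))"
proof -
  let ?c = "\<lambda>k. pochhammer a k / fact k * s ^ k"
  \<comment> \<open>Convergence at the midpoint between \<open>\<bar>s\<bar>\<close> and
    \<open>1\<close> gives absolute convergence at \<open>s\<close>.\<close>
  have "summable (\<lambda>k. pochhammer a k / fact k * ((\<bar>s\<bar> + 1) / 2) ^ k)"
    using s by (intro sums_summable[OF powr_neg_sums]) auto
  then have "summable (\<lambda>k. norm (?c k))"
    using s by (intro powser_insidea) auto
  then have sm: "summable (\<lambda>k. 1 ^ k * norm (?c k))" by simp
  note S = sums_integral_power_series[OF N Z bd sm]
  have eq: "AE w in N. (\<Sum>k. Z w ^ k *\<^sub>R ?c k) = (1 - s * Z w) powr (- a)"
    using bd
  proof eventually_elim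
    case (elim w)
    have "\<bar>s * Z w\<bar> < 1"
      using s elim mult_left_le[of "\<bar>Z w\<bar>" "\<bar>s\<bar>"] by (simp add: abs_mult)
    from sums_unique[OF powr_neg_sums[OF this, of a]] show ?case
      by (simp add: power_mult_distrib mult_ac)
  qed
  show "integrable N (\<lambda>w. (1 - s * Z w) powr (- a))"
    by (rule integrable_cong_AE_imp[OF S(1)]) (use eq in auto)
  have "(LINT w|N. (\<Sum>k. Z w ^ k *\<^sub>R ?c k)) = (LINT w|N. (1 - s * Z w) powr (- a))"
    using eq by (intro integral_cong_AE borel_measurable_integrable[OF S(1)]) auto
  then show "(\<lambda>k. ?c k * (LINT w|N. Z w ^ k)) sums (LINT w|N. (1 - s * Z w) powr (- a))"
    using S(2) by (simp add: mult.commute)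
qed

lemma powser_coeff_eq:
  fixes f g :: "nat \<Rightarrow> real"
  assumes r: "0 < r" and f: "\<And>x. \<bar>x\<bar> < r \<Longrightarrow> (\<lambda>k. f k * x ^ k) sums F x"
    and g: "\<And>x. \<bar>x\<bar> < r \<Longrightarrow> (\<lambda>k. g k * x ^ k) sums F x"
  shows "f = g"
proof -
  have z: "(\<lambda>k. (f k - g k) * x ^ k) sums 0" if "\<bar>x\<bar> < r" for x
    using sums_diff[OF f[OF that] g[OF that]] by (simp add: algebra_simps)
  show ?thesis
  proof (rule ccontr)
    assume "f \<noteq> g"
    then have ex: "\<exists>m. f m - g m \<noteq> 0" by (auto simp: fun_eq_iff)
    \<comment> \<open>Removing the factor \<open>x ^ m\<close> of the first differing coefficient
      leaves a power series that is \<open>0\<close> for all small \<open>x \<noteq> 0\<close>; its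
      limit at \<open>0\<close> is this very coefficient.\<close>
    define m where "m = (LEAST m. f m - g m \<noteq> 0)"
    have m: "f m - g m \<noteq> 0" unfolding m_def by (rule LeastI_ex[OF ex])
    have lt: "f k - g k = 0" if "k < m" for k
      using not_less_Least[of k "\<lambda>m. f m - g m \<noteq> 0"] that by (auto simp: m_def)
    define h where "h k = f (k + m) - g (k + m)" for k
    have hs: "(\<lambda>k. h k * x ^ k) sums 0" if "\<bar>x\<bar> < r" "x \<noteq> 0" for x
    proof -
      have "(\<lambda>k. (f (k + m) - g (k + m)) * x ^ (k + m)) sums (0 - (\<Sum>i<m. (f i - g i) * x ^ i))"
        using z[OF that(1)] by (subst sums_iff_shift) auto
      then have "(\<lambda>k. h k * x ^ k * x ^ m) sums 0"
        using lt by (simp add: h_def power_add mult.assoc)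
      then have "(\<lambda>k. h k * x ^ k * x ^ m / x ^ m) sums (0 / x ^ m)"
        by (rule sums_divide)
      then show ?thesis using that by simp
    qed
    have "(\<lambda>_::real. 0) \<midarrow>0\<rightarrow> h 0"
      by (rule powser_limit_0_strong[where a = h and s = r, OF r]) (use hs in auto)
    from LIM_unique[OF this tendsto_const] have "h 0 = 0" by simp
    then show False using m by (simp add: h_def)
  qed
qed

text \<open>For \<open>0 < a\<close> every coefficient \<open>pochhammer a k / fact k\<close> is
  positive, so it can be cancelled and the generating function determines each moment.\<close>

lemma moments_eqI:
  fixes Z :: "'a \<Rightarrow> real"
  assumes N: "finite_measure N" "Z \<in> borel_measurable N" "AE w in N. \<bar>Z w\<bar> \<le> 1" and a: "0 < a"
    and F: "\<And>s. \<bar>s\<bar> < 1 \<Longrightarrow> (LINT w|N. (1 - s * Z w) powr (- a)) = F s"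
    and \<mu>: "\<And>s. \<bar>s\<bar> < 1 \<Longrightarrow> (\<lambda>k. pochhammer a k / fact k * s ^ k * \<mu> k) sums F s"
  shows "(LINT w|N. Z w ^ k) = \<mu> k"
proof -
  have "(\<lambda>k. pochhammer a k / fact k * (LINT w|N. Z w ^ k)) = (\<lambda>k. pochhammer a k / fact k * \<mu> k)"
  proof (rule powser_coeff_eq[where r = 1 and F = F])
    fix s :: real assume s: "\<bar>s\<bar> < 1"
    show "(\<lambda>k. pochhammer a k / fact k * (LINT w|N. Z w ^ k) * s ^ k) sums F s"
      using sums_expectation_powr(2)[OF N s, of a] unfolding F[OF s] by (simp only: mult_ac)
    show "(\<lambda>k. pochhammer a k / fact k * \<mu> k * s ^ k) sums F s"
      using \<mu>[OF s] by (simp only: mult_ac)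
  qed simp
  then have "pochhammer a k / fact k * (LINT w|N. Z w ^ k) = pochhammer a k / fact k * \<mu> k"
    by (rule fun_cong)
  then show ?thesis using pochhammer_pos[OF a, of k] by simp
qed

section \<open>Measures determined by the moments of their projections\<close>

text \<open>Finite sums of exponentials instead of polynomials in the coordinates: the integral of
  \<open>exp (\<xi> \<bullet> x)\<close> expands into moments of the single projection
  \<open>\<xi> \<bullet> x\<close>, so no mixed moments are required. The law of exponents makes the
  set closed under products.\<close>

inductive_set exp_span :: "('a::euclidean_space \<Rightarrow> real) set" where
  exp: "(\<lambda>x. c * exp (\<xi> \<bullet> x)) \<in> exp_span"
| add: "f \<in> exp_span \<Longrightarrow> g \<in> exp_span \<Longrightarrow> (\<lambda>x. f x + g x) \<in> exp_span"

lemma exp_span_mult_exp: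
  assumes "g \<in> exp_span"
  shows "(\<lambda>x. (c * exp (\<xi> \<bullet> x)) * g x) \<in> exp_span"
  using assms
proof induction
  case (exp c' \<xi>')
  have "(\<lambda>x. (c * exp (\<xi> \<bullet> x)) * (c' * exp (\<xi>' \<bullet> x))) = (\<lambda>x. (c * c') * exp ((\<xi> + \<xi>') \<bullet> x))"
    by (simp add: fun_eq_iff inner_add_left exp_add)
  then show ?case using exp_span.exp[of "c * c'" "\<xi> + \<xi>'"] by simp
next
  case (add f g)
  then show ?case using exp_span.add[OF add.IH] by (simp add: distrib_left)
qed

lemma exp_span_mult:
  assumes "f \<in> exp_span" "g \<in> exp_span"
  shows "(\<lambda>x. f x * g x) \<in> exp_span"
  using assms(1)
proof induction
  case (exp c \<xi>)
  show ?case by (rule exp_span_mult_exp[OF assms(2)])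
next
  case (add f h)
  then show ?case using exp_span.add[OF add.IH] by (simp add: distrib_right)
qed

lemma exp_span_continuous: "f \<in> exp_span \<Longrightarrow> continuous_on S f"
  by (induction rule: exp_span.induct) (auto intro!: continuous_intros)

lemma function_ring_exp_span:
  assumes "compact S"
  shows "function_ring_on exp_span (S :: 'a::euclidean_space set)"
proof
  show "(\<lambda>_::'a. c) \<in> exp_span" for c :: real
    using exp_span.exp[of c 0] by simp
  show "\<exists>f\<in>exp_span. f x \<noteq> f y" if "x \<noteq> y" for x y :: 'a
  proof
    have "(x - y) \<bullet> x \<noteq> (x - y) \<bullet> y"
      using that by (metis inner_diff_right inner_eq_zero_iff right_minus_eq)
    then show "1 * exp ((x - y) \<bullet> x) \<noteq> 1 * exp ((x - y) \<bullet> y)" by simp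
  qed (rule exp_span.exp)
qed (use assms in \<open>auto intro: exp_span.add exp_span_mult exp_span_continuous\<close>)

lemma finite_measure_eqI_closed:
  fixes \<mu> \<nu> :: "'a::euclidean_space measure"
  assumes "finite_measure \<mu>" "finite_measure \<nu>" and S: "sets \<mu> = sets borel" "sets \<nu> = sets borel"
    and eq: "\<And>C. closed C \<Longrightarrow> measure \<mu> C = measure \<nu> C"
  shows "\<mu> = \<nu>"
proof -
  interpret M: finite_measure \<mu> by fact
  interpret N: finite_measure \<nu> by fact
  have b: "sets borel = sigma_sets UNIV (Collect (closed :: 'a set \<Rightarrow> bool))"
    by (subst borel_eq_closed) simp
  show ?thesis
  proof (rule measure_eqI_generator_eq[where E = "Collect closed" and \<Omega> = UNIV and A = "\<lambda>_. UNIV"])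
    show "emeasure \<mu> X = emeasure \<nu> X" if "X \<in> Collect closed" for X
      using eq[of X] that by (simp add: M.emeasure_eq_measure N.emeasure_eq_measure)
  qed (auto simp: S b Int_stable_def)
qed

lemma measure_eqI_continuous:
  fixes \<mu> \<nu> :: "'a::euclidean_space measure"
  assumes fin: "finite_measure \<mu>" "finite_measure \<nu>" and S: "sets \<mu> = sets borel" "sets \<nu> = sets borel"
    and eq: "\<And>f. continuous_on UNIV f \<Longrightarrow> (\<And>x. 0 \<le> f x) \<Longrightarrow> (\<And>x. f x \<le> 1) \<Longrightarrow>
      (LINT x|\<mu>. f x) = (LINT x|\<nu>. f x :: real)"
  shows "\<mu> = \<nu>"
proof (rule finite_measure_eqI_closed[OF fin S])
  fix C :: "'a set" assume C: "closed C"
  note [measurable_cong] = S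
  show "measure \<mu> C = measure \<nu> C"
  \<comment> \<open>\<open>infdist\<close> to the empty set is \<open>0\<close>, so the
    approximation below would tend to \<open>1\<close> there.\<close>
  proof (cases "C = {}")
    case False
    \<comment> \<open>Continuous functions with values in \<open>[0, 1]\<close> that tend pointwise
      to the indicator of the closed set \<open>C\<close>.\<close>
    define f where "f k x = max 0 (1 - real k * infdist x C)" for k :: nat and x
    have cont: "continuous_on UNIV (f k)" for k
      unfolding f_def by (intro continuous_intros)
    have [measurable]: "f k \<in> borel_measurable borel" for k
      using cont by (rule borel_measurable_continuous_onI)
    have bd: "0 \<le> f k x" "f k x \<le> 1" for k x
      by (auto simp: f_def infdist_nonneg)
    have lim: "(\<lambda>k. f k x) \<longlonglongrightarrow> indicator C x" for x
    proof (cases "x \<in> C")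
      case False
      then have pos: "0 < infdist x C"
        using C \<open>C \<noteq> {}\<close> by (simp add: infdist_pos_not_in_closed)
      then obtain K :: nat where K: "1 < real K * infdist x C"
        using reals_Archimedean3 by blast
      have "f k x = 0" if "K \<le> k" for k
      proof -
        have "real K * infdist x C \<le> real k * infdist x C"
          using that pos by (intro mult_right_mono) auto
        then show ?thesis using K by (simp add: f_def)
      qed
      then have "eventually (\<lambda>k. f k x = indicator C x) sequentially"
        using False by (auto simp: eventually_sequentially)
      then show ?thesis by (rule tendsto_eventually)
    qed (simp add: f_def)
    have conv: "(\<lambda>k. LINT x|N. f k x) \<longlonglongrightarrow> measure N C"
      if "finite_measure N" and N: "sets N = sets borel" for N
    proof -
      interpret finite_measure N by fact
      note [measurable_cong] = N
      have [measurable]: "C \<in> sets N" using C N by simp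
      have "(\<lambda>k. LINT x|N. f k x) \<longlonglongrightarrow> (LINT x|N. indicator C x)"
        using bd lim C by (intro integral_dominated_convergence[where w = "\<lambda>_. 1"]) auto
      then show ?thesis using sets_eq_imp_space_eq[OF N] by simp
    qed
    show ?thesis
      using conv[OF fin(1) S(1)] conv[OF fin(2) S(2)] eq[OF cont bd] LIMSEQ_unique by simp
  qed simp
qed

text \<open>Stone-Weierstrass applied to the algebra spanned by exponentials of linear forms.\<close>

lemma measure_eqI_moments:
  fixes \<mu> \<nu> :: "'a::euclidean_space measure"
  assumes fin: "finite_measure \<mu>" "finite_measure \<nu>" and S: "sets \<mu> = sets borel" "sets \<nu> = sets borel"
    and bd: "AE x in \<mu>. norm x \<le> 1" "AE x in \<nu>. norm x \<le> 1"
    and eq: "\<And>e k. norm e = 1 \<Longrightarrow> (LINT x|\<mu>. (e \<bullet> x) ^ k) = (LINT x|\<nu>. (e \<bullet> x) ^ k)"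
  shows "\<mu> = \<nu>"
proof -
  have int: "integrable N f" if "finite_measure N" "sets N = sets borel" "AE x in N. norm x \<le> 1"
    and f: "continuous_on UNIV f" for N :: "'a measure" and f :: "'a \<Rightarrow> real"
  proof -
    interpret finite_measure N by fact
    note [measurable_cong] = that(2)
    have "bounded (f ` cball 0 1)"
      by (intro compact_imp_bounded compact_continuous_image continuous_on_subset[OF f]) auto
    then obtain B where "\<forall>x\<in>cball 0 1. norm (f x) \<le> B"
      by (auto simp: bounded_iff)
    then show ?thesis
      using that(3) borel_measurable_continuous_onI[OF f]
      by (intro integrable_const_bound[of _ B]) (auto elim!: eventually_mono)
  qed
  \<comment> \<open>Homogeneity extends the hypothesis from unit vectors to all
    \<open>\<xi>\<close>. For \<open>\<xi> = 0\<close> only \<open>k = 0\<close> has content, and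
    there any unit vector supplies the equality of total masses.\<close>
  have pow: "(LINT x|\<mu>. (\<xi> \<bullet> x) ^ k) = (LINT x|\<nu>. (\<xi> \<bullet> x) ^ k)" for \<xi> k
  proof (cases "\<xi> = 0")
    case True
    obtain e :: 'a where "norm e = 1" using vector_choose_size[of 1] by auto
    from eq[OF this, of 0] show ?thesis using True by (cases k) auto
  next
    case False
    have "(\<xi> \<bullet> x) ^ k = norm \<xi> ^ k * (sgn \<xi> \<bullet> x) ^ k" for x
      using False by (simp add: sgn_div_norm power_mult_distrib[symmetric] mult.assoc[symmetric])
    then show ?thesis
      using eq[of "sgn \<xi>" k] False by (simp add: norm_sgn)
  qed
  have exp_sums: "(\<lambda>k. (LINT x|N. (\<xi> \<bullet> x) ^ k) / fact k) sums (LINT x|N. exp (\<xi> \<bullet> x))"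
    if N: "finite_measure N" "sets N = sets borel" "AE x in N. norm x \<le> 1" for N and \<xi> :: 'a
  proof -
    interpret finite_measure N by fact
    note [measurable_cong] = N(2)
    have bd: "AE x in N. \<bar>\<xi> \<bullet> x\<bar> \<le> norm \<xi>"
      using N(3)
    proof eventually_elim
      case (elim x)
      then show ?case
        using Cauchy_Schwarz_ineq2[of \<xi> x] mult_left_le[of "norm x" "norm \<xi>"] by simp
    qed
    have "summable (\<lambda>k. norm \<xi> ^ k * norm (1 / fact k :: real))"
      using summable_exp[of "norm \<xi>"] by (simp add: divide_inverse mult.commute)
    from sums_integral_power_series(2)[OF N(1) _ bd this]
    have "(\<lambda>k. (LINT x|N. (\<xi> \<bullet> x) ^ k) *\<^sub>R (1 / fact k)) sums (LINT x|N. (\<Sum>k. (\<xi> \<bullet> x) ^ k *\<^sub>R (1 / fact k :: real)))"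
      by simp
    then show ?thesis by (simp add: exp_def divide_inverse mult.commute)
  qed
  have span: "(LINT x|\<mu>. f x) = (LINT x|\<nu>. f x)" if "f \<in> exp_span" for f
    using that
  proof induction
    case (exp c \<xi>)
    have "(LINT x|\<mu>. exp (\<xi> \<bullet> x)) = (LINT x|\<nu>. exp (\<xi> \<bullet> x))"
      using exp_sums[OF fin(1) S(1) bd(1), of \<xi>] exp_sums[OF fin(2) S(2) bd(2), of \<xi>]
      unfolding pow by (rule sums_unique2)
    then show ?case by simp
  next
    case (add f g)
    then show ?case
      using int[OF fin(1) S(1) bd(1) exp_span_continuous] int[OF fin(2) S(2) bd(2) exp_span_continuous]
      by simp
  qed
  interpret function_ring_on exp_span "cball (0::'a) 1"
    by (rule function_ring_exp_span) simp
  show ?thesis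
  proof (rule measure_eqI_continuous[OF fin S])
    fix f :: "'a \<Rightarrow> real" assume f: "continuous_on UNIV f"
    have close: "\<bar>(LINT x|N. f x) - (LINT x|N. g x)\<bar> \<le> \<epsilon> * measure N (space N)"
      if N: "finite_measure N" "sets N = sets borel" "AE x in N. norm x \<le> 1"
        and g: "g \<in> exp_span" and le: "\<And>x. norm x \<le> 1 \<Longrightarrow> \<bar>f x - g x\<bar> < \<epsilon>" for N g \<epsilon>
    proof -
      interpret finite_measure N by fact
      note i = int[OF N f] int[OF N exp_span_continuous[OF g]]
      have "\<bar>(LINT x|N. f x) - (LINT x|N. g x)\<bar> = \<bar>LINT x|N. f x - g x\<bar>"
        using i by simp
      also have "\<dots> \<le> (LINT x|N. \<bar>f x - g x\<bar>)"
        by (rule integral_abs_bound)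
      also have "\<dots> \<le> (LINT x|N. \<epsilon>)"
        using i N(3) by (intro integral_mono_AE) (auto elim!: eventually_mono dest!: le)
      finally show ?thesis by (simp add: mult.commute)
    qed
    let ?a = "measure \<mu> (space \<mu>) + measure \<nu> (space \<nu>)"
    have "\<bar>(LINT x|\<mu>. f x) - (LINT x|\<nu>. f x)\<bar> \<le> 0 + e" if e: "0 < e" for e
    proof -
      have a: "0 \<le> ?a" by simp
      \<comment> \<open>The total error is \<open>\<epsilon>\<close> times the two masses; adding
        \<open>1\<close> keeps the denominator positive when both masses are
        \<open>0\<close>.\<close>
      define \<epsilon> where "\<epsilon> = e / (?a + 1)"
      have "0 < \<epsilon>" unfolding \<epsilon>_def using a by (intro divide_pos_pos e) linarith
      then obtain g where g: "g \<in> exp_span" "\<And>x. norm x \<le> 1 \<Longrightarrow> \<bar>f x - g x\<bar> < \<epsilon>"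
        using Stone_Weierstrass_basic[of f \<epsilon>] continuous_on_subset[OF f] by auto
      have "\<bar>(LINT x|\<mu>. f x) - (LINT x|\<nu>. f x)\<bar> \<le> \<epsilon> * ?a"
        using close[OF fin(1) S(1) bd(1) g] close[OF fin(2) S(2) bd(2) g] span[OF g(1)]
        by (simp add: algebra_simps)
      also have "\<dots> \<le> \<epsilon> * (?a + 1)" using \<open>0 < \<epsilon>\<close> by simp
      also have "\<dots> = e"
      proof -
        have "?a + 1 \<noteq> 0" using a by linarith
        then show ?thesis unfolding \<epsilon>_def by (rule nonzero_eq_divide_eq[THEN iffD1]) (rule refl)
      qed
      finally show ?thesis by simp
    qed
    then show "(LINT x|\<mu>. f x) = (LINT x|\<nu>. f x)"
      using field_le_epsilon[of "\<bar>(LINT x|\<mu>. f x) - (LINT x|\<nu>. f x)\<bar>" 0] by simp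
  qed
qed

section \<open>The uniform law on the sphere\<close>

text \<open>Completing the square: the integrand is \<open>exp (l\<^sup>2 / 4)\<close> times the
  Gaussian weight centred at \<open>(l / 2) *\<^sub>R e\<close>, and Lebesgue measure is translation
  invariant.\<close>

lemma nn_integral_inner_exp:
  fixes e :: "'a::euclidean_space"
  assumes e: "norm e = 1"
  shows "(\<integral>\<^sup>+x. ennreal (exp (l * (e \<bullet> x)) * exp (- (norm x)\<^sup>2)) \<partial>lborel) =
    ennreal (exp (l\<^sup>2 / 4)) * (\<integral>\<^sup>+(x::'a). ennreal (exp (- (norm x)\<^sup>2)) \<partial>lborel)"
proof -
  have eq: "exp (l * (e \<bullet> x)) * exp (- (norm x)\<^sup>2) = exp (l\<^sup>2 / 4) * exp (- (norm (x - (l / 2) *\<^sub>R e))\<^sup>2)" for x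
  proof -
    have "(norm (x - (l / 2) *\<^sub>R e))\<^sup>2 = (norm x)\<^sup>2 - l * (e \<bullet> x) + l\<^sup>2 / 4"
      using e unfolding power2_norm_eq_inner
      by (simp add: inner_diff_left inner_diff_right inner_commute norm_eq_1 power2_eq_square field_simps)
    then show ?thesis by (simp add: exp_add[symmetric])
  qed
  have "(\<integral>\<^sup>+x. ennreal (exp (l * (e \<bullet> x)) * exp (- (norm x)\<^sup>2)) \<partial>lborel) =
    ennreal (exp (l\<^sup>2 / 4)) * (\<integral>\<^sup>+x. ennreal (exp (- (norm (x - (l / 2) *\<^sub>R e))\<^sup>2)) \<partial>lborel)"
    unfolding eq by (simp add: ennreal_mult nn_integral_cmult)
  also have "(\<integral>\<^sup>+x. ennreal (exp (- (norm (x - (l / 2) *\<^sub>R e))\<^sup>2)) \<partial>lborel) =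
      (\<integral>\<^sup>+x. ennreal (exp (- (norm x)\<^sup>2)) \<partial>distr lborel borel ((+) (- ((l / 2) *\<^sub>R e))))"
    by (simp add: nn_integral_distr)
  finally show ?thesis by (simp add: lborel_distr_plus)
qed

lemma nn_integral_gaussian:
  "(\<integral>\<^sup>+(x::'a::euclidean_space). ennreal (exp (- (norm x)\<^sup>2)) \<partial>lborel) = ennreal (pi powr (DIM('a) / 2))"
proof -
  have "(\<integral>\<^sup>+(x::'a). ennreal (exp (- (norm x)\<^sup>2)) \<partial>lborel) = (\<integral>\<^sup>+(x::'a). ennreal (exp (- (norm x powr 2))) \<partial>lborel)"
    by simp
  also have "\<dots> = ennreal (unit_ball_vol DIM('a)) * (\<integral>\<^sup>+r. ennreal (exp (- r)) *
       ennreal (indicator {0..} r * (DIM('a) / 2 * r powr (DIM('a) / 2 - 1))) \<partial>lborel)"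
    by (rule nn_integral_radial) auto
  also have "(\<integral>\<^sup>+r. ennreal (exp (- r)) *
       ennreal (indicator {0..} r * (DIM('a) / 2 * r powr (DIM('a) / 2 - 1))) \<partial>lborel) =
     (\<integral>\<^sup>+r. ennreal (DIM('a) / 2) *
       ennreal (indicator {0<..} r * (r powr (DIM('a) / 2 - 1) * exp (- (1 * r)))) \<partial>lborel)"
    using AE_lborel_singleton[of 0]
    by (intro nn_integral_cong_AE, eventually_elim)
       (auto simp: ennreal_mult[symmetric] mult_ac split: split_indicator)
  also have "\<dots> = ennreal (DIM('a) / 2) * ennreal (Gamma (DIM('a) / 2) * 1 powr (- (DIM('a) / 2)))"
    by (subst nn_integral_cmult, simp, subst nn_integral_Gamma) simp_all
  also have "ennreal (unit_ball_vol DIM('a)) * \<dots> = ennreal (pi powr (DIM('a) / 2))"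
  proof -
    have "Gamma (DIM('a) / 2 + 1) = DIM('a) / 2 * Gamma (DIM('a) / 2 :: real)"
      by (rule Gamma_plus1) (auto dest!: nonpos_Ints_nonpos)
    moreover have "Gamma (DIM('a) / 2 :: real) \<noteq> 0"
      by (rule Gamma_real_neq_0) simp
    ultimately show ?thesis
      by (simp add: unit_ball_vol_def ennreal_mult[symmetric])
  qed
  finally show ?thesis .
qed

lemma exp_even_sums: "(\<lambda>k. l ^ (2 * k) / fact (2 * k) * (x::real) ^ (2 * k)) sums ((exp (l * x) + exp (- (l * x))) / 2)"
proof -
  have "(\<lambda>k. if even k then (l * x) ^ k /\<^sub>R fact k else 0) sums cosh (l * x)"
    by (rule cosh_converges)
  then have "(\<lambda>k. (l * x) ^ (2 * k) /\<^sub>R fact (2 * k)) sums cosh (l * x)"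
    by (subst (asm) sums_even_iff) simp_all
  moreover have "(l * x) ^ (2 * k) /\<^sub>R fact (2 * k) = l ^ (2 * k) / fact (2 * k) * x ^ (2 * k)" for k
    by (simp only: power_mult_distrib real_scaleR_def divide_inverse mult_ac)
  moreover have "cosh (l * x) = (exp (l * x) + exp (- (l * x))) / 2"
    by (simp add: cosh_def)
  ultimately show ?thesis by (simp only:)
qed

text \<open>The moments are read off as coefficients of the exponential integral
  \<open>exp (l\<^sup>2 / 4)\<close>, so no orthonormal basis containing \<open>e\<close> is
  required. Averaging over \<open>l\<close> and \<open>- l\<close> leaves only nonnegative terms, so
  summation and integration can be exchanged before the moments are known to be finite.\<close>

lemma nn_integral_gaussian_moment:
  fixes e :: "'a::euclidean_space"
  assumes e: "norm e = 1"
  shows "(\<integral>\<^sup>+x. ennreal ((e \<bullet> x) ^ (2 * k) * exp (- (norm x)\<^sup>2)) \<partial>lborel) =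
    ennreal (fact (2 * k) / (4 ^ k * fact k) * pi powr (DIM('a) / 2))"
proof -
  let ?E = "\<lambda>l x. ennreal (exp (l * (e \<bullet> x)) * exp (- (norm x)\<^sup>2))"
  let ?P = "\<lambda>k x. (e \<bullet> x) ^ (2 * k) * exp (- (norm x)\<^sup>2)"
  define G where "G = pi powr (real DIM('a) / 2)"
  have G: "0 < G" by (simp add: G_def)
  define m where "m k = (\<integral>\<^sup>+x. ennreal (?P k x) \<partial>lborel)" for k
  have half: "ennreal (1/2) * (ennreal A + ennreal B) = ennreal ((A + B) / 2)" if "0 \<le> A" "0 \<le> B" for A B
  proof -
    have "ennreal (1/2) * (ennreal A + ennreal B) = ennreal (1/2) * ennreal (A + B)"
      using that by (simp only: ennreal_plus)
    also have "\<dots> = ennreal (1/2 * (A + B))"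
      using that by (intro ennreal_mult[symmetric]) auto
    finally show ?thesis by simp
  qed
  have S: "(\<Sum>k. ennreal (l ^ (2 * k) / fact (2 * k)) * m k) = ennreal (exp (l\<^sup>2 / 4) * G)" for l
  proof -
    have "(\<Sum>k. ennreal (l ^ (2 * k) / fact (2 * k)) * m k) =
        (\<Sum>k. \<integral>\<^sup>+x. ennreal (l ^ (2 * k) / fact (2 * k) * (?P k x)) \<partial>lborel)"
    proof (rule suminf_cong)
      show "ennreal (l ^ (2 * k) / fact (2 * k)) * m k =
        (\<integral>\<^sup>+x. ennreal (l ^ (2 * k) / fact (2 * k) * (?P k x)) \<partial>lborel)" for k
        unfolding m_def by (subst nn_integral_cmult[symmetric], measurable)
          (auto intro!: nn_integral_cong simp: ennreal_mult'[symmetric])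
    qed
    also have "\<dots> = (\<integral>\<^sup>+x. (\<Sum>k. ennreal (l ^ (2 * k) / fact (2 * k) * (?P k x))) \<partial>lborel)"
      by (rule nn_integral_suminf[symmetric]) measurable
    also have "\<dots> = (\<integral>\<^sup>+x. ennreal (1/2) * (?E l x +
        ?E (- l) x) \<partial>lborel)"
    proof (rule nn_integral_cong)
      fix x :: 'a
      have "(\<lambda>k. l ^ (2 * k) / fact (2 * k) * (?P k x)) sums
          ((exp (l * (e \<bullet> x)) + exp (- (l * (e \<bullet> x)))) / 2 * exp (- (norm x)\<^sup>2))"
        using sums_mult2[OF exp_even_sums[of l "e \<bullet> x"], of "exp (- (norm x)\<^sup>2)"] by (simp only: mult.assoc)
      then have "(\<Sum>k. ennreal (l ^ (2 * k) / fact (2 * k) * (?P k x))) =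
          ennreal ((exp (l * (e \<bullet> x)) + exp (- (l * (e \<bullet> x)))) / 2 * exp (- (norm x)\<^sup>2))"
        by (intro suminf_ennreal_eq) auto
      also have "\<dots> = ennreal (1/2) * (?E l x +
        ?E (- l) x)"
        by (subst half) (simp_all add: distrib_right)
      finally show "(\<Sum>k. ennreal (l ^ (2 * k) / fact (2 * k) * (?P k x))) = \<dots>" .
    qed
    also have "\<dots> = ennreal (1/2) * (ennreal (exp (l\<^sup>2 / 4)) * ennreal G + ennreal (exp ((- l)\<^sup>2 / 4)) * ennreal G)"
    proof -
      have "(\<integral>\<^sup>+x. ?E l x +
          ?E (- l) x \<partial>lborel) =
        (\<integral>\<^sup>+x. ?E l x \<partial>lborel) +
        (\<integral>\<^sup>+x. ?E (- l) x \<partial>lborel)"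
        by (rule nn_integral_add) measurable
      moreover have "(\<integral>\<^sup>+x. ennreal (1/2) * (?E l x +
          ?E (- l) x) \<partial>lborel) =
        ennreal (1/2) * (\<integral>\<^sup>+x. ?E l x +
          ?E (- l) x \<partial>lborel)"
        by (rule nn_integral_cmult) measurable
      ultimately show ?thesis
        unfolding nn_integral_inner_exp[OF e] nn_integral_gaussian G_def by (simp only:)
    qed
    also have "\<dots> = ennreal (exp (l\<^sup>2 / 4) * G)"
    proof -
      have "ennreal (exp (l\<^sup>2 / 4)) * ennreal G = ennreal (exp (l\<^sup>2 / 4) * G)"
        by (rule ennreal_mult'[symmetric]) simp
      then show ?thesis
        unfolding power2_minus using G by (simp only: half mult_nonneg_nonneg exp_ge_zero less_imp_le) simp
    qed
    finally show ?thesis .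
  qed
  \<comment> \<open>Each single term is bounded by the whole series at \<open>l = 1\<close>, whose
    value is finite.\<close>
  have fin: "m k < \<infinity>" for k
  proof -
    have "ennreal (1 / fact (2 * k)) * m k \<le> (\<Sum>k. ennreal (1 ^ (2 * k) / fact (2 * k)) * m k)"
      using sum_le_suminf[of "\<lambda>k. ennreal (1 ^ (2 * k) / fact (2 * k)) * m k" "{k}"] by simp
    also have "\<dots> < \<infinity>" unfolding S by simp
    finally show ?thesis
      by (auto simp: ennreal_mult_less_top)
  qed
  define \<mu> where "\<mu> k = enn2real (m k)" for k
  have m: "m k = ennreal (\<mu> k)" and \<mu>0: "0 \<le> \<mu> k" for k
    using fin[of k] by (auto simp: \<mu>_def)
  have sums: "(\<lambda>k. \<mu> k / fact (2 * k) * l ^ (2 * k)) sums (exp (l\<^sup>2 / 4) * G)" for l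
  proof -
    have "(\<Sum>k. ennreal (l ^ (2 * k) / fact (2 * k) * \<mu> k)) = ennreal (exp (l\<^sup>2 / 4) * G)"
      unfolding S[symmetric] m by (simp only: ennreal_mult''[OF \<mu>0])
    moreover have "(\<lambda>k. ennreal (l ^ (2 * k) / fact (2 * k) * \<mu> k)) sums
        (\<Sum>k. ennreal (l ^ (2 * k) / fact (2 * k) * \<mu> k))"
      by (rule summable_sums) (rule summableI)
    ultimately have "(\<lambda>k. ennreal (l ^ (2 * k) / fact (2 * k) * \<mu> k)) sums ennreal (exp (l\<^sup>2 / 4) * G)"
      by (simp only:)
    then have "(\<lambda>k. l ^ (2 * k) / fact (2 * k) * \<mu> k) sums (exp (l\<^sup>2 / 4) * G)"
      by (rule sums_ennreal[THEN iffD1, rotated 2]) (use G \<mu>0 in auto)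
    then show ?thesis by (simp add: mult.commute)
  qed
  \<comment> \<open>Both series run over even powers only; odd coefficients are filled with
    \<open>0\<close> to compare them as power series in \<open>l\<close>.\<close>
  define f where "f k = (if even k then \<mu> (k div 2) / fact k else 0)" for k
  define g where "g k = (if even k then G / (4 ^ (k div 2) * fact (k div 2)) else 0)" for k
  have "f = g"
  proof (rule powser_coeff_eq[of 1])
    show "(\<lambda>k. f k * l ^ k) sums (exp (l\<^sup>2 / 4) * G)" for l
      by (subst sums_even_iff) (use sums[of l] in \<open>simp_all add: f_def\<close>)
    show "(\<lambda>k. g k * l ^ k) sums (exp (l\<^sup>2 / 4) * G)" for l
    proof (subst sums_even_iff)
      have "(\<lambda>k. (l\<^sup>2 / 4) ^ k /\<^sub>R fact k * G) sums (exp (l\<^sup>2 / 4) * G)"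
        by (intro sums_mult2 exp_converges)
      moreover have "(l\<^sup>2 / 4) ^ k /\<^sub>R fact k * G = g (2 * k) * l ^ (2 * k)" for k
        unfolding power_mult[of l] power_divide by (simp add: g_def field_simps)
      ultimately show "(\<lambda>k. g (2 * k) * l ^ (2 * k)) sums (exp (l\<^sup>2 / 4) * G)"
        by (simp only:)
    qed (simp add: g_def)
  qed simp
  then have "f (2 * k) = g (2 * k)" by (rule fun_cong)
  then have eq: "\<mu> k / fact (2 * k) = G / (4 ^ k * fact k)"
    by (simp add: f_def g_def)
  have "\<mu> k = fact (2 * k) * (\<mu> k / fact (2 * k))"
    by (simp only: times_divide_eq_right nonzero_mult_div_cancel_left[OF fact_nonzero])
  also have "\<dots> = fact (2 * k) / (4 ^ k * fact k) * G"
    unfolding eq by (simp only: times_divide_eq_left times_divide_eq_right)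
  finally have "m k = ennreal (fact (2 * k) / (4 ^ k * fact k) * G)"
    by (rule trans[OF m arg_cong[of _ _ ennreal]])
  then show ?thesis unfolding m_def G_def .
qed

lemma radial_const:
  assumes d: "0 < d"
  shows "unit_ball_vol d * (d / 2) = pi powr (d / 2) / Gamma (d / 2)"
proof -
  have "Gamma (d / 2 + 1) = d / 2 * Gamma (d / 2)"
    using d by (intro Gamma_plus1) (auto dest!: nonpos_Ints_nonpos)
  then show ?thesis using d by (simp add: unit_ball_vol_def)
qed

lemma emeasure_unit_ball_pos:
  "emeasure lborel (ball (0::'a::euclidean_space) 1) \<noteq> 0" "emeasure lborel (ball (0::'a::euclidean_space) 1) \<noteq> \<top>"
  by (simp_all add: emeasure_ball less_imp_neq[OF unit_ball_vol_pos, symmetric])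

lemma sets_uniform_sphere [simp, measurable_cong]: "sets uniform_sphere = sets borel"
  by (simp add: uniform_sphere_def)

lemma prob_space_uniform_sphere: "prob_space (uniform_sphere :: (real ^ 'd) measure)"
proof -
  interpret prob_space "uniform_measure lborel (ball (0 :: real ^ 'd) 1)"
    by (rule prob_space_uniform_measure) (use emeasure_unit_ball_pos[where 'a = "real ^ 'd"] in simp_all)
  show ?thesis unfolding uniform_sphere_def by (rule prob_space_distr) measurable
qed

lemma AE_uniform_sphere: "AE x in (uniform_sphere :: (real ^ 'd) measure). norm x = 1"
proof -
  have "AE x in uniform_measure lborel (ball (0 :: real ^ 'd) 1). norm (sgn x) = 1"
    using AE_lborel_singleton[of "0 :: real ^ 'd"]
    by (intro AE_uniform_measureI) (auto simp: norm_sgn elim!: eventually_mono)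
  then show ?thesis unfolding uniform_sphere_def by (subst AE_distr_iff) auto
qed

lemma nn_integral_polar_sphere:
  fixes h :: "real ^ 'd \<Rightarrow> ennreal" and g :: "real \<Rightarrow> ennreal"
  assumes [measurable]: "h \<in> borel_measurable borel" "g \<in> borel_measurable borel" and p: "0 < p"
  shows "(\<integral>\<^sup>+x. h (sgn x) * g (norm x powr p) \<partial>lborel) =
    ennreal (unit_ball_vol CARD('d)) * (\<integral>\<^sup>+x. h x \<partial>uniform_sphere) *
    (\<integral>\<^sup>+r. g r * ennreal (indicator {0..} r * (CARD('d) / p * r powr (CARD('d) / p - 1))) \<partial>lborel)"
proof -
  let ?b = "emeasure lborel (ball (0 :: real ^ 'd) 1)"
  let ?I = "\<integral>\<^sup>+x. h (sgn x) * indicator (ball 0 1) x \<partial>lborel"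
  have "(\<integral>\<^sup>+x. h x \<partial>uniform_sphere) = ?I / ?b"
    unfolding uniform_sphere_def by (subst nn_integral_distr) (auto simp: nn_integral_uniform_measure)
  then have "?b * (\<integral>\<^sup>+x. h x \<partial>uniform_sphere) = ?I"
    using emeasure_unit_ball_pos[where 'a = "real ^ 'd"]
    by (metis ennreal_times_divide mult.commute mult_divide_eq_ennreal)
  then show ?thesis
    using nn_integral_polar[of h g p] p by (simp add: emeasure_ball)
qed

text \<open>Under any radial weight the direction is uniform and independent of the radius. A moment
  of the uniform direction can thus be extracted from the Gaussian weight and then used for the
  density on the ball.\<close>

lemma nn_integral_polar_radial:
  fixes h :: "real ^ 'd \<Rightarrow> ennreal" and g :: "real \<Rightarrow> ennreal"
  assumes [measurable]: "h \<in> borel_measurable borel" "g \<in> borel_measurable borel" and p: "0 < p"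
  shows "(\<integral>\<^sup>+x. h (sgn x) * g (norm x powr p) \<partial>lborel) =
    (\<integral>\<^sup>+v. h v \<partial>uniform_sphere) * (\<integral>\<^sup>+(x::real ^ 'd). g (norm x powr p) \<partial>lborel)"
  using nn_integral_polar_sphere[of h g p] nn_integral_radial[of g p, where 'a = "real ^ 'd"] p
  by (simp add: mult_ac)

lemma distr_norm_powr_radial_density:
  fixes g :: "real \<Rightarrow> ennreal"
  assumes [measurable]: "g \<in> borel_measurable borel" and p: "0 < p"
  shows "distr (density lborel (\<lambda>x::'a::euclidean_space. g (norm x powr p))) borel (\<lambda>x. norm x powr p) =
    density lborel (\<lambda>r. ennreal (unit_ball_vol DIM('a)) *
      (g r * ennreal (indicator {0..} r * (DIM('a) / p * r powr (DIM('a) / p - 1)))))" (is "?M = ?N")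
proof (rule measure_eqI)
  fix B assume "B \<in> sets ?M"
  then have [measurable]: "B \<in> sets borel" by simp
  have "emeasure ?M B = (\<integral>\<^sup>+x. indicator B (norm (x::'a) powr p) * g (norm x powr p) \<partial>lborel)"
    by (simp add: nn_integral_indicator[symmetric] nn_integral_distr nn_integral_density mult.commute
      del: nn_integral_indicator)
  also have "\<dots> = ennreal (unit_ball_vol DIM('a)) * (\<integral>\<^sup>+r. indicator B r * g r *
      ennreal (indicator {0..} r * (DIM('a) / p * r powr (DIM('a) / p - 1))) \<partial>lborel)"
    by (rule nn_integral_radial[OF _ p, where g = "\<lambda>r. indicator B r * g r"]) measurable
  also have "\<dots> = emeasure ?N B"
    by (simp add: emeasure_density nn_integral_cmult[symmetric] mult_ac)
  finally show "emeasure ?M B = emeasure ?N B" .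
qed simp

lemma nn_integral_Beta:
  assumes "0 < a" "0 < b"
  shows "(\<integral>\<^sup>+r. ennreal (indicator {0..1} r * (r powr (a - 1) * (1 - r) powr (b - 1))) \<partial>lborel) =
    ennreal (Beta a b)"
proof -
  have "(\<integral>\<^sup>+r. ennreal (r powr (a - 1) * (1 - r) powr (b - 1)) * indicator {0..1} r \<partial>lborel) = ennreal (Beta a b)"
    by (rule nn_integral_has_integral_lebesgue'[OF _ has_integral_Beta_real[OF assms]]) auto
  moreover have "ennreal (r powr (a - 1) * (1 - r) powr (b - 1)) * indicator {0..1} r =
      ennreal (indicator {0..1} r * (r powr (a - 1) * (1 - r) powr (b - 1)))" for r :: real
    by (simp split: split_indicator)
  ultimately show ?thesis by simp
qed

lemma lborel_distr_uminus_euclidean: "distr lborel borel uminus = (lborel :: 'a::euclidean_space measure)"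
  using lborel_affine[of "-1" "0::'a"] by (simp add: density_1)

lemma distr_density_uminus:
  fixes g :: "'a::euclidean_space \<Rightarrow> ennreal"
  assumes [measurable]: "g \<in> borel_measurable borel" and "\<And>x. g (- x) = g x"
  shows "distr (density lborel g) borel uminus = density lborel g"
proof -
  have "density (distr lborel borel uminus) g = distr (density lborel (\<lambda>x. g (- x))) borel uminus"
    by (rule density_distr) measurable
  then show ?thesis unfolding lborel_distr_uminus_euclidean assms(2) by (rule sym)
qed

lemma distr_uniform_sphere_uminus:
  "distr uniform_sphere borel uminus = (uniform_sphere :: (real ^ 'd) measure)"
proof -
  let ?U = "uniform_measure lborel (ball (0 :: real ^ 'd) 1)"
  have "distr ?U borel uminus = ?U"
    unfolding uniform_measure_def by (rule distr_density_uminus) (auto simp: indicator_def)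
  moreover have "distr (distr ?U borel uminus) borel sgn = distr uniform_sphere borel uminus"
    unfolding uniform_sphere_def
    by (subst (1 2) distr_distr) (auto simp: comp_def sgn_minus intro!: distr_cong)
  ultimately show ?thesis by (simp add: uniform_sphere_def)
qed

lemma odd_moment_eq_0:
  fixes N :: "'a::euclidean_space measure"
  assumes S: "sets N = sets borel" and N: "distr N borel uminus = N" and k: "odd k"
  shows "(LINT x|N. (e \<bullet> x) ^ k) = 0"
proof -
  note [measurable_cong] = S
  have "(LINT x|N. (e \<bullet> x) ^ k) = (LINT x|distr N borel uminus. (e \<bullet> x) ^ k)" by (simp add: N)
  also have "\<dots> = (LINT x|N. (e \<bullet> (- x)) ^ k)"
    by (rule integral_distr) (auto simp: measurable_cong_sets[OF S refl])
  also have "\<dots> = - (LINT x|N. (e \<bullet> x) ^ k)"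
    using k by simp
  finally show ?thesis by simp
qed

text \<open>For the Gaussian weight a projection moment is the direction moment times the integral
  of \<open>norm x ^ (2 * k)\<close>; both Gaussian quantities are known, and the quotient is the
  claim.\<close>

lemma nn_integral_sphere_even_moment:
  fixes e :: "real ^ 'd"
  assumes e: "norm e = 1"
  shows "(\<integral>\<^sup>+v. ennreal ((e \<bullet> v) ^ (2 * k)) \<partial>uniform_sphere) =
    ennreal (pochhammer (1/2) k / pochhammer (CARD('d) / 2) k)"
proof -
  define D where "D = real CARD('d)"
  have D: "0 < D" by (simp add: D_def)
  let ?m = "\<integral>\<^sup>+v. ennreal ((e \<bullet> v) ^ (2 * k)) \<partial>(uniform_sphere :: (real ^ 'd) measure)"
  have pt: "ennreal ((e \<bullet> sgn x) ^ (2 * k)) * ennreal ((norm x powr 2) ^ k * exp (- (norm x powr 2))) =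
      ennreal ((e \<bullet> x) ^ (2 * k) * exp (- (norm x)\<^sup>2))" for x :: "real ^ 'd"
  proof -
    have "(e \<bullet> sgn x) ^ (2 * k) * ((norm x)\<^sup>2) ^ k = (e \<bullet> x) ^ (2 * k)"
      by (cases "x = 0"; cases "k = 0")
         (simp_all add: sgn_div_norm power_mult_distrib power_mult[symmetric] power_inverse)
    then show ?thesis by (simp add: ennreal_mult'[symmetric] mult.assoc[symmetric])
  qed
  have I: "(\<integral>\<^sup>+r. ennreal (r ^ k * exp (- r)) * ennreal (indicator {0..} r * (D / 2 * r powr (D / 2 - 1))) \<partial>lborel) =
      ennreal (D / 2 * Gamma (D / 2 + k))"
  proof -
    have "(\<integral>\<^sup>+r. ennreal (r ^ k * exp (- r)) * ennreal (indicator {0..} r * (D / 2 * r powr (D / 2 - 1))) \<partial>lborel) =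
      (\<integral>\<^sup>+r. ennreal (D / 2) * ennreal (indicator {0<..} r * (r powr (D / 2 + k - 1) * exp (- (1 * r)))) \<partial>lborel)"
    proof (rule nn_integral_cong_AE, rule AE_mp[OF AE_lborel_singleton[of 0]], rule AE_I2, rule impI)
      fix r :: real assume "r \<noteq> 0"
      show "ennreal (r ^ k * exp (- r)) * ennreal (indicator {0..} r * (D / 2 * r powr (D / 2 - 1))) =
        ennreal (D / 2) * ennreal (indicator {0<..} r * (r powr (D / 2 + k - 1) * exp (- (1 * r))))"
      proof (cases "0 < r")
        case True
        have "r powr (D / 2 + k - 1) = r ^ k * r powr (D / 2 - 1)"
          using True by (simp add: powr_realpow[symmetric] powr_add[symmetric] algebra_simps)
        then have "r ^ k * exp (- r) * (indicator {0..} r * (D / 2 * r powr (D / 2 - 1))) =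
            D / 2 * (indicator {0<..} r * (r powr (D / 2 + k - 1) * exp (- (1 * r))))"
          using True by simp
        then have "ennreal (r ^ k * exp (- r) * (indicator {0..} r * (D / 2 * r powr (D / 2 - 1)))) =
            ennreal (D / 2 * (indicator {0<..} r * (r powr (D / 2 + k - 1) * exp (- (1 * r)))))"
          by (rule arg_cong)
        moreover have "0 \<le> r ^ k * exp (- r)" "0 \<le> D / 2" using True D by simp_all
        ultimately show ?thesis by (simp only: ennreal_mult')
      qed (use \<open>r \<noteq> 0\<close> in simp)
    qed
    also have "\<dots> = ennreal (D / 2) * ennreal (Gamma (D / 2 + k) * 1 powr (- (D / 2 + k)))"
      using D by (subst nn_integral_cmult, simp, subst nn_integral_Gamma) (simp_all add: add_pos_nonneg)
    also have "\<dots> = ennreal (D / 2 * Gamma (D / 2 + k))"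
      by (subst ennreal_mult'[symmetric]) (use D in simp_all)
    finally show ?thesis .
  qed
  \<comment> \<open>The Gaussian integral of \<open>norm x ^ (2 * k)\<close> in dimension
    \<open>D\<close>: polar coordinates give \<open>Gamma (D / 2 + k) / Gamma (D / 2)\<close> times
    \<open>pi powr (D / 2)\<close>.\<close>
  define c where "c = pi powr (D / 2) * pochhammer (D / 2) k"
  have c0: "0 < c" unfolding c_def using D by (simp add: pochhammer_pos)
  have R: "(\<integral>\<^sup>+(x::real ^ 'd). ennreal ((norm x powr 2) ^ k * exp (- (norm x powr 2))) \<partial>lborel) = ennreal c"
  proof -
    have "(\<integral>\<^sup>+(x::real ^ 'd). ennreal ((norm x powr 2) ^ k * exp (- (norm x powr 2))) \<partial>lborel) =
        ennreal (unit_ball_vol D) * ennreal (D / 2 * Gamma (D / 2 + k))"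
      unfolding I[symmetric] using nn_integral_radial[of "\<lambda>r. ennreal (r ^ k * exp (- r))" 2, where 'a = "real ^ 'd"]
      by (simp add: D_def)
    also have "\<dots> = ennreal (unit_ball_vol D * (D / 2) * Gamma (D / 2 + k))"
      by (subst ennreal_mult'[symmetric]) (use D in simp_all)
    also have "unit_ball_vol D * (D / 2) * Gamma (D / 2 + k) = c"
      unfolding c_def radial_const[OF D] using D
      by (subst pochhammer_Gamma) (auto dest!: nonpos_Ints_nonpos)
    finally show ?thesis .
  qed
  have f: "fact (2 * k) / (4 ^ k * fact k) = (pochhammer (1/2) k :: real)"
    unfolding fact_double by (simp add: power_mult)
  have "ennreal (fact (2 * k) / (4 ^ k * fact k) * pi powr (D / 2)) =
      (\<integral>\<^sup>+(x::real ^ 'd). ennreal ((e \<bullet> sgn x) ^ (2 * k)) * ennreal ((norm x powr 2) ^ k * exp (- (norm x powr 2))) \<partial>lborel)"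
    unfolding pt nn_integral_gaussian_moment[OF e] by (simp add: D_def)
  also have "\<dots> = ?m * ennreal c"
    unfolding R[symmetric] by (rule nn_integral_polar_radial[where g = "\<lambda>r. ennreal (r ^ k * exp (- r))"]) auto
  finally have "ennreal (pochhammer (1/2) k * pi powr (D / 2)) = ?m * ennreal c" unfolding f .
  moreover have "ennreal c * ennreal (1 / c) = 1"
    by (subst ennreal_mult'[symmetric]) (use c0 in simp_all)
  ultimately have "?m = ennreal (pochhammer (1/2) k * pi powr (D / 2)) * ennreal (1 / c)"
    by (simp add: mult.assoc)
  also have "\<dots> = ennreal (pochhammer (1/2) k / pochhammer (D / 2) k)"
    by (subst ennreal_mult''[symmetric]) (use c0 in \<open>simp_all add: c_def\<close>)
  finally show ?thesis unfolding D_def .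
qed

text \<open>The parameter is \<open>b = (d - 1) / 2\<close> because \<open>b + 1/2 = d / 2\<close>
  is the Pochhammer base of the sphere moments. The formula also covers \<open>d = 1\<close>, where
  \<open>b = 0\<close> and all even moments are \<open>1\<close>.\<close>

lemma uniform_sphere_moment:
  fixes e :: "real ^ 'd"
  assumes e: "norm e = 1"
  shows "(LINT v|uniform_sphere. (e \<bullet> v) ^ k) = sym_beta_moment ((CARD('d) - 1) / 2) k"
proof (cases "even k")
  case True
  then obtain j where k: "k = 2 * j" by (elim evenE)
  have p: "0 \<le> pochhammer (1/2) j / pochhammer (real CARD('d) / 2) j"
    by (intro divide_nonneg_nonneg pochhammer_nonneg) auto
  have "(LINT v|uniform_sphere. (e \<bullet> v) ^ k) = enn2real (\<integral>\<^sup>+v. ennreal ((e \<bullet> v) ^ (2 * j)) \<partial>uniform_sphere)"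
    unfolding k by (intro integral_eq_nn_integral) (auto simp: power_mult)
  also have "\<dots> = pochhammer (1/2) j / pochhammer (CARD('d) / 2) j"
    unfolding nn_integral_sphere_even_moment[OF e] using p by simp
  finally show ?thesis by (simp add: k sym_beta_moment_def diff_divide_distrib)
next
  case False
  then show ?thesis
    using odd_moment_eq_0[OF sets_uniform_sphere distr_uniform_sphere_uminus False, of e]
    by (simp add: sym_beta_moment_def)
qed

section \<open>The density on the unit ball\<close>

text \<open>Isabelle's \<open>0 powr \<gamma>\<close> is \<open>0\<close> for every
  \<open>\<gamma>\<close>, including \<open>\<gamma> = 0\<close>, so the density vanishes off the
  open ball without a separate indicator.\<close>

definition ball_density :: "real \<Rightarrow> 'a::euclidean_space \<Rightarrow> real" where
  "ball_density \<gamma> x = Gamma (real DIM('a) / 2 + \<gamma> + 1) / (pi powr (real DIM('a) / 2) * Gamma (\<gamma> + 1)) *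
    max (1 - (norm x)\<^sup>2) 0 powr \<gamma>"

abbreviation ball_law :: "real \<Rightarrow> 'a::euclidean_space measure" where
  "ball_law \<gamma> \<equiv> density lborel (\<lambda>x. ennreal (ball_density \<gamma> x))"

lemma ball_density_measurable [measurable]: "ball_density \<gamma> \<in> borel_measurable borel"
  unfolding ball_density_def [abs_def] by measurable

lemma beta_density_measurable [measurable]: "beta_density a b \<in> borel_measurable borel"
  unfolding beta_density_def [abs_def] by measurable

lemma Beta_real_pos: "0 < a \<Longrightarrow> 0 < b \<Longrightarrow> 0 < Beta a (b :: real)"
  by (simp add: Beta_def Gamma_real_pos)

lemma Beta_ratio:
  assumes "0 < x" "0 < (y::real)"
  shows "Beta (x + real j) y / Beta x y = pochhammer x j / pochhammer (x + y) j"
proof -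
  have "pochhammer x j = Gamma (x + j) / Gamma x" "pochhammer (x + y) j = Gamma (x + y + j) / Gamma (x + y)"
    using assms by (auto intro!: pochhammer_Gamma dest!: nonpos_Ints_nonpos)
  moreover have "Gamma x \<noteq> 0" "Gamma (x + j) \<noteq> 0" "Gamma y \<noteq> 0" "Gamma (x + y) \<noteq> 0" "Gamma (x + y + j) \<noteq> 0"
    using assms by (auto intro!: Gamma_real_neq_0)
  ultimately show ?thesis
    by (simp add: Beta_def add_ac)
qed

lemma nn_integral_beta_density:
  assumes a: "0 < a" and b: "0 < b" and q: "0 \<le> q"
  shows "(\<integral>\<^sup>+r. ennreal (r powr q) * ennreal (beta_density a b r) \<partial>lborel) = ennreal (Beta (a + q) b / Beta a b)"
proof -
  have "ennreal (r powr q) * ennreal (beta_density a b r) = ennreal (1 / Beta a b) *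
      ennreal (indicator {0..1} r * (r powr (a + q - 1) * (1 - r) powr (b - 1)))" for r
  proof -
    have "r powr q * beta_density a b r =
        1 / Beta a b * (indicator {0..1} r * (r powr (a + q - 1) * (1 - r) powr (b - 1)))"
    proof (cases "0 < r \<and> r < 1")
      case True
      then show ?thesis
        by (simp add: beta_density_def powr_add powr_diff mult_ac)
    next
      case False
      then show ?thesis by (auto simp: beta_density_def split: split_indicator)
    qed
    then show ?thesis
      using Beta_real_pos[OF a b] by (subst (1 2) ennreal_mult'[symmetric]) simp_all
  qed
  then have "(\<integral>\<^sup>+r. ennreal (r powr q) * ennreal (beta_density a b r) \<partial>lborel) =
      ennreal (1 / Beta a b) * ennreal (Beta (a + q) b)"
    using nn_integral_Beta[of "a + q" b] a b q by (simp add: nn_integral_cmult)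
  also have "\<dots> = ennreal (Beta (a + q) b / Beta a b)"
    using Beta_real_pos[OF a b] by (subst ennreal_mult'[symmetric]) simp_all
  finally show ?thesis .
qed

text \<open>At the points \<open>0\<close> and \<open>1\<close> both densities vanish, since \<open>0 powr a = 0\<close>
  for every \<open>a\<close>.\<close>

lemma distr_ball_density_norm_sq:
  assumes g: "0 < \<gamma> + 1"
  shows "distr (ball_law \<gamma> :: 'a::euclidean_space measure) borel (\<lambda>x. (norm x)\<^sup>2) =
    density lborel (\<lambda>r. ennreal (beta_density (DIM('a) / 2) (\<gamma> + 1) r))"
proof -
  define D where "D = real DIM('a)"
  have D: "0 < D" by (simp add: D_def)
  define C where "C = Gamma (D / 2 + \<gamma> + 1) / (pi powr (D / 2) * Gamma (\<gamma> + 1))"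
  have C: "0 \<le> C"
    unfolding C_def using D g by (intro divide_nonneg_nonneg mult_nonneg_nonneg Gamma_real_nonneg) auto
  have const: "unit_ball_vol D * (D / 2) * C = 1 / Beta (D / 2) (\<gamma> + 1)"
    unfolding radial_const[OF D] C_def Beta_def by (simp add: add.assoc)
  have pt: "ennreal (unit_ball_vol D) * (ennreal (C * max (1 - r) 0 powr \<gamma>) *
      ennreal (indicator {0..} r * (D / 2 * r powr (D / 2 - 1)))) =
      ennreal (beta_density (D / 2) (\<gamma> + 1) r)" for r
  proof -
    have "unit_ball_vol D * (C * max (1 - r) 0 powr \<gamma> * (indicator {0..} r * (D / 2 * r powr (D / 2 - 1)))) =
        (unit_ball_vol D * (D / 2) * C) * (max (1 - r) 0 powr \<gamma> * (indicator {0..} r * r powr (D / 2 - 1)))"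
      by (simp only: mult_ac)
    also have "\<dots> = beta_density (D / 2) (\<gamma> + 1) r"
      unfolding const beta_density_def by (cases "0 < r \<and> r < 1") (auto simp: max_def split: split_indicator)
    finally show ?thesis
      using C D by (subst ennreal_mult'[symmetric], simp, subst ennreal_mult'[symmetric]) simp_all
  qed
  have "distr (density lborel (\<lambda>x::'a. ennreal (C * max (1 - norm x powr 2) 0 powr \<gamma>))) borel (\<lambda>x. norm x powr 2) =
    density lborel (\<lambda>r. ennreal (unit_ball_vol D) * (ennreal (C * max (1 - r) 0 powr \<gamma>) *
      ennreal (indicator {0..} r * (D / 2 * r powr (D / 2 - 1)))))"
    unfolding D_def
    by (rule distr_norm_powr_radial_density[where g = "\<lambda>r. ennreal (C * max (1 - r) 0 powr \<gamma>)"]) auto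
  then show ?thesis
    unfolding pt by (simp add: ball_density_def C_def D_def)
qed

lemma nn_integral_ball_density_norm:
  assumes g: "0 < \<gamma> + 1" and q: "0 \<le> q"
  shows "(\<integral>\<^sup>+x. ennreal (norm x powr q) * ennreal (ball_density \<gamma> (x :: 'a::euclidean_space)) \<partial>lborel) =
    ennreal (Beta ((real DIM('a) + q) / 2) (\<gamma> + 1) / Beta (DIM('a) / 2) (\<gamma> + 1))"
proof -
  let ?M = "ball_law \<gamma> :: 'a measure"
  have eq: "((norm x)\<^sup>2) powr (q / 2) = norm x powr q" for x :: 'a
    by (cases "x = 0") (simp_all add: powr_powr flip: powr_numeral)
  have "(\<integral>\<^sup>+x. ennreal (norm (x::'a) powr q) * ennreal (ball_density \<gamma> x) \<partial>lborel) =
      (\<integral>\<^sup>+x. ennreal (((norm x)\<^sup>2) powr (q / 2)) \<partial>?M)"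
    unfolding eq by (simp add: nn_integral_density mult.commute)
  also have "\<dots> = (\<integral>\<^sup>+r. ennreal (r powr (q / 2)) \<partial>distr ?M borel (\<lambda>x. (norm x)\<^sup>2))"
    by (simp add: nn_integral_distr)
  also have "\<dots> = (\<integral>\<^sup>+r. ennreal (r powr (q / 2)) * ennreal (beta_density (DIM('a) / 2) (\<gamma> + 1) r) \<partial>lborel)"
    unfolding distr_ball_density_norm_sq[OF g] by (simp add: nn_integral_density mult.commute)
  also have "\<dots> = ennreal (Beta (DIM('a) / 2 + q / 2) (\<gamma> + 1) / Beta (DIM('a) / 2) (\<gamma> + 1))"
    using g q by (intro nn_integral_beta_density) auto
  finally show ?thesis by (simp add: add_divide_distrib)
qed

lemma prob_space_ball_density:
  assumes g: "0 < \<gamma> + 1"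
  shows "prob_space (ball_law \<gamma> :: 'a::euclidean_space measure)"
proof
  let ?M = "ball_law \<gamma> :: 'a measure"
  have "emeasure ?M (space ?M) = (\<integral>\<^sup>+x. ennreal (ball_density \<gamma> (x::'a)) \<partial>lborel)"
    by (simp add: emeasure_density)
  \<comment> \<open>\<open>norm x powr 0\<close> is \<open>1\<close> except at the origin, where it
    is \<open>0\<close>.\<close>
  also have "\<dots> = (\<integral>\<^sup>+x. ennreal (norm x powr 0) * ennreal (ball_density \<gamma> (x::'a)) \<partial>lborel)"
    by (rule nn_integral_cong_AE, rule AE_mp[OF AE_lborel_singleton[of 0]], rule AE_I2) simp
  also have "\<dots> = ennreal (Beta ((real DIM('a) + 0) / 2) (\<gamma> + 1) / Beta (DIM('a) / 2) (\<gamma> + 1))"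
    using nn_integral_ball_density_norm[OF g order_refl, where 'a = 'a] by (simp only:)
  also have "\<dots> = 1"
    using less_imp_neq[OF Beta_real_pos[of "DIM('a) / 2" "\<gamma> + 1"]] g by simp
  finally show "emeasure ?M (space ?M) = 1" .
qed

lemma AE_ball_density: "AE x in (ball_law \<gamma> :: 'a::euclidean_space measure). norm x \<le> 1"
proof -
  have "AE x::'a in lborel. 0 < ennreal (ball_density \<gamma> x) \<longrightarrow> norm x \<le> 1"
  proof (rule AE_I2, rule impI)
    fix x :: 'a assume "0 < ennreal (ball_density \<gamma> x)"
    then have "max (1 - (norm x)\<^sup>2) 0 \<noteq> 0" by (auto simp: ball_density_def)
    then have "(norm x)\<^sup>2 \<le> 1" by (auto simp: max_def split: if_splits)
    then show "norm x \<le> 1" using abs_square_le_1[of "norm x"] by simp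
  qed
  then show ?thesis by (subst AE_density) auto
qed

text \<open>The projection moment is that of a uniform direction,
  \<open>pochhammer (1/2) j / pochhammer (d / 2) j\<close>, times the radial moment, a ratio of Beta
  values equal to \<open>pochhammer (d / 2) j / pochhammer (d / 2 + \<gamma> + 1) j\<close>. The
  cancellation of \<open>pochhammer (d / 2) j\<close> leaves the symmetric Beta parameter
  \<open>d / 2 + \<gamma> + 1/2\<close>.\<close>

lemma ball_density_moment:
  fixes e :: "real ^ 'd"
  assumes g: "0 < \<gamma> + 1" and e: "norm e = 1"
  shows "(LINT x|ball_law \<gamma>. (e \<bullet> x) ^ k) =
    sym_beta_moment (CARD('d) / 2 + \<gamma> + 1/2) k"
proof (cases "even k")
  case True
  then obtain j where k: "k = 2 * j" by (elim evenE)
  define D where "D = real CARD('d)"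
  have D: "0 < D" by (simp add: D_def)
  let ?M = "ball_law \<gamma> :: (real ^ 'd) measure"
  define C where "C = Gamma (D / 2 + \<gamma> + 1) / (pi powr (D / 2) * Gamma (\<gamma> + 1))"
  define g where "g r = ennreal (r ^ j) * ennreal (C * max (1 - r) 0 powr \<gamma>)" for r
  have [measurable]: "g \<in> borel_measurable borel" unfolding g_def by measurable
  have w: "g (norm x powr 2) = ennreal (((norm x)\<^sup>2) ^ j) * ennreal (ball_density \<gamma> x)" for x :: "real ^ 'd"
    by (simp add: g_def ball_density_def C_def D_def)
  have wq: "g (norm x powr 2) = ennreal (norm x powr (2 * j)) * ennreal (ball_density \<gamma> x)"
    if "x \<noteq> 0" for x :: "real ^ 'd"
  proof -
    have "norm x powr (2 * j) = norm x ^ (2 * j)" using that by (simp flip: powr_realpow)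
    then show ?thesis unfolding w by (simp add: power_mult)
  qed
  have pt: "(e \<bullet> sgn x) ^ (2 * j) * ((norm x)\<^sup>2) ^ j = (e \<bullet> x) ^ (2 * j)" for x
    by (cases "x = 0"; cases "j = 0")
       (simp_all add: sgn_div_norm power_mult_distrib power_mult[symmetric] power_inverse)
  have "(\<integral>\<^sup>+x. g (norm (x :: real ^ 'd) powr 2) \<partial>lborel) =
      (\<integral>\<^sup>+x. ennreal (norm (x :: real ^ 'd) powr (2 * j)) * ennreal (ball_density \<gamma> x) \<partial>lborel)"
    by (rule nn_integral_cong_AE, rule AE_mp[OF AE_lborel_singleton[of 0]], rule AE_I2, rule impI, rule wq)
  also have "\<dots> = ennreal (Beta ((real DIM(real ^ 'd) + 2 * j) / 2) (\<gamma> + 1) / Beta (DIM(real ^ 'd) / 2) (\<gamma> + 1))"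
    by (rule nn_integral_ball_density_norm[OF assms(1)]) simp
  also have "\<dots> = ennreal (Beta (D / 2 + j) (\<gamma> + 1) / Beta (D / 2) (\<gamma> + 1))"
    by (simp add: D_def add_divide_distrib)
  finally have I: "(\<integral>\<^sup>+x. g (norm (x :: real ^ 'd) powr 2) \<partial>lborel) = \<dots>" .
  have "(\<integral>\<^sup>+x. ennreal ((e \<bullet> x) ^ (2 * j)) \<partial>?M) =
      (\<integral>\<^sup>+x. ennreal (ball_density \<gamma> x) * ennreal ((e \<bullet> x) ^ (2 * j)) \<partial>lborel)"
    by (rule nn_integral_density) measurable
  also have "\<dots> = (\<integral>\<^sup>+x. ennreal ((e \<bullet> sgn x) ^ (2 * j)) * g (norm x powr 2) \<partial>lborel)"
  proof (rule nn_integral_cong)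
    fix x :: "real ^ 'd"
    have "ennreal ((e \<bullet> x) ^ (2 * j)) = ennreal ((e \<bullet> sgn x) ^ (2 * j)) * ennreal (((norm x)\<^sup>2) ^ j)"
      by (rule trans[OF arg_cong[OF pt[symmetric], of ennreal] ennreal_mult']) (simp add: zero_le_even_power)
    then show "ennreal (ball_density \<gamma> x) * ennreal ((e \<bullet> x) ^ (2 * j)) =
        ennreal ((e \<bullet> sgn x) ^ (2 * j)) * g (norm x powr 2)"
      unfolding w by (simp only: mult_ac)
  qed
  also have "\<dots> = ennreal (pochhammer (1/2) j / pochhammer (D / 2) j) *
      ennreal (Beta (D / 2 + j) (\<gamma> + 1) / Beta (D / 2) (\<gamma> + 1))"
    unfolding I[symmetric] nn_integral_sphere_even_moment[OF e, folded D_def, symmetric] by (rule nn_integral_polar_radial) auto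
  also have "\<dots> = ennreal (pochhammer (1/2) j / pochhammer (D / 2) j * (Beta (D / 2 + j) (\<gamma> + 1) / Beta (D / 2) (\<gamma> + 1)))"
    using D by (intro ennreal_mult'[symmetric] divide_nonneg_nonneg pochhammer_nonneg) auto
  also have "pochhammer (1/2) j / pochhammer (D / 2) j * (Beta (D / 2 + j) (\<gamma> + 1) / Beta (D / 2) (\<gamma> + 1)) =
      pochhammer (1/2) j / pochhammer (D / 2 + \<gamma> + 1) j"
  proof -
    have "pochhammer (D / 2) j \<noteq> 0" using pochhammer_pos[of "D / 2" j] D by simp
    then show ?thesis using D assms(1) by (simp add: Beta_ratio add.assoc)
  qed
  finally have "(\<integral>\<^sup>+x. ennreal ((e \<bullet> x) ^ (2 * j)) \<partial>?M) = ennreal (pochhammer (1/2) j / pochhammer (D / 2 + \<gamma> + 1) j)" .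
  then have "(LINT x|?M. (e \<bullet> x) ^ k) = enn2real (ennreal (pochhammer (1/2) j / pochhammer (D / 2 + \<gamma> + 1) j))"
    unfolding k by (subst integral_eq_nn_integral) (auto simp: power_mult)
  also have "\<dots> = pochhammer (1/2) j / pochhammer (D / 2 + \<gamma> + 1) j"
    using D assms(1) by (intro enn2real_ennreal divide_nonneg_nonneg pochhammer_nonneg) auto
  finally show ?thesis by (simp add: k sym_beta_moment_def D_def add.assoc)
next
  case False
  have "distr (ball_law \<gamma> :: (real ^ 'd) measure) borel uminus =
      ball_law \<gamma>"
    by (rule distr_density_uminus) (auto simp: ball_density_def)
  from odd_moment_eq_0[OF _ this False, of e] False show ?thesis
    by (simp add: sym_beta_moment_def)
qed

text \<open>This law on \<open>real\<close> is auxiliary: it represents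
  \<open>sym_beta_moment\<close> by an actual one-dimensional density, on which a substitution of
  variables can be carried out. In one dimension the even moments are simply moments of the
  norm.\<close>

lemma ball_density_real_moment:
  assumes g: "0 < \<gamma> + 1"
  shows "(LINT x|(ball_law \<gamma> :: real measure). x ^ k) = sym_beta_moment (\<gamma> + 1) k"
proof (cases "even k")
  case True
  then obtain j where k: "k = 2 * j" by (elim evenE)
  let ?M = "ball_law \<gamma> :: real measure"
  have "(\<integral>\<^sup>+x. ennreal (x ^ (2 * j)) \<partial>?M) = (\<integral>\<^sup>+x. ennreal (ball_density \<gamma> x) * ennreal (x ^ (2 * j)) \<partial>lborel)"
    by (rule nn_integral_density) measurable
  also have "\<dots> = (\<integral>\<^sup>+x. ennreal (norm (x::real) powr (2 * j)) * ennreal (ball_density \<gamma> x) \<partial>lborel)"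
  proof (rule nn_integral_cong_AE, rule AE_mp[OF AE_lborel_singleton[of 0]], rule AE_I2, rule impI)
    fix x :: real assume "x \<noteq> 0"
    then have "norm x powr real (2 * j) = \<bar>x\<bar> ^ (2 * j)" by (simp flip: powr_realpow)
    also have "\<bar>x\<bar> ^ (2 * j) = x ^ (2 * j)" by (rule power_even_abs) simp
    finally show "ennreal (ball_density \<gamma> x) * ennreal (x ^ (2 * j)) =
        ennreal (norm x powr (2 * j)) * ennreal (ball_density \<gamma> x)"
      by (simp only: mult.commute)
  qed
  also have "\<dots> = ennreal (Beta ((real DIM(real) + 2 * j) / 2) (\<gamma> + 1) / Beta (DIM(real) / 2) (\<gamma> + 1))"
    by (rule nn_integral_ball_density_norm[OF g]) simp
  also have "\<dots> = ennreal (Beta (1 / 2 + real j) (\<gamma> + 1) / Beta (1 / 2) (\<gamma> + 1))"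
    by (simp add: add_divide_distrib)
  also have "\<dots> = ennreal (pochhammer (1/2) j / pochhammer (1/2 + (\<gamma> + 1)) j)"
    using g by (simp only: Beta_ratio zero_less_divide_1_iff zero_less_numeral)
  finally have "(LINT x|?M. x ^ k) = enn2real (ennreal (pochhammer (1/2) j / pochhammer (1/2 + (\<gamma> + 1)) j))"
    unfolding k by (subst integral_eq_nn_integral) (auto simp: power_mult)
  also have "\<dots> = pochhammer (1/2) j / pochhammer (1/2 + (\<gamma> + 1)) j"
    using g by (intro enn2real_ennreal divide_nonneg_nonneg pochhammer_nonneg) auto
  finally show ?thesis by (simp add: k sym_beta_moment_def add_ac)
next
  case False
  have "distr (ball_law \<gamma> :: real measure) borel uminus =
      ball_law \<gamma>"
    by (rule distr_density_uminus) (auto simp: ball_density_def)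
  from odd_moment_eq_0[OF _ this False, of 1] False show ?thesis
    by (simp add: sym_beta_moment_def)
qed

text \<open>With \<open>u = cos \<theta>\<close> and \<open>v = cos \<phi>\<close>, the substitution below describes the triangle with
  sides \<open>1\<close>, \<open>q\<close> and \<open>sqrt (1 - 2 * q * u + q\<^sup>2)\<close>: \<open>\<theta>\<close> is its angle between the first two sides
  and \<open>\<pi> - \<phi>\<close> its angle between the last two.\<close>

lemma nn_integral_ball_density_gegenbauer:
  fixes a q :: real
  assumes a: "0 < a" and q: "\<bar>q\<bar> < 1"
  shows "(\<integral>\<^sup>+u. ennreal (ball_density (a - 1/2) u * (1 - 2 * q * u + q\<^sup>2) powr (- a)) \<partial>lborel) = 1"
proof -
  define \<gamma> where "\<gamma> = a - 1/2"
  define C where "C = Gamma (1 / 2 + \<gamma> + 1) / (pi powr (1 / 2) * Gamma (\<gamma> + 1))"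
  have C: "0 \<le> C" unfolding C_def \<gamma>_def
    using a by (intro divide_nonneg_nonneg mult_nonneg_nonneg Gamma_real_nonneg) auto
  have bd: "ball_density \<gamma> u = C * (1 - u\<^sup>2) powr \<gamma> * indicator {-1..1} u" for u :: real
  proof -
    have "u \<in> {-1..1} \<longleftrightarrow> u\<^sup>2 \<le> 1" by (auto simp: abs_square_le_1 abs_le_iff)
    then show ?thesis
      by (auto simp: ball_density_def C_def max_def split: split_indicator)
  qed
  have q2: "q\<^sup>2 < 1" using q by (simp add: abs_square_less_1)
  define R where "R v = sqrt (1 - q\<^sup>2 * (1 - v\<^sup>2))" for v
  have R2: "0 < 1 - q\<^sup>2 * (1 - v\<^sup>2)" for v
  proof -
    have "q\<^sup>2 * (1 - v\<^sup>2) \<le> q\<^sup>2 * 1" by (intro mult_left_mono) auto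
    then show ?thesis using q2 by simp
  qed
  have R: "0 < R v" "(R v)\<^sup>2 = 1 - q\<^sup>2 * (1 - v\<^sup>2)" for v
    using R2[of v] by (simp_all add: R_def less_imp_le)
  define h where "h v = q * v / R v" for v
  have lt: "\<bar>q * v\<bar> < R v" for v
  proof (rule power2_less_imp_less)
    show "\<bar>q * v\<bar>\<^sup>2 < (R v)\<^sup>2" using q2 by (simp add: R(2) power_mult_distrib algebra_simps)
  qed (use R(1)[of v] in simp)
  \<comment> \<open>By the law of cosines \<open>R v - q * v\<close> is the third side of the
    triangle; solving \<open>1 - 2 * q * u + q\<^sup>2 = (R v - q * v)\<^sup>2\<close> for
    \<open>u\<close> gives \<open>g v\<close>.\<close>
  define g where "g v = q * (1 - v\<^sup>2) + v * R v" for v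
  define g' where "g' v = (R v - q * v)\<^sup>2 / R v" for v
  define f where "f u = C * (1 - u\<^sup>2) powr \<gamma> * (1 - 2 * q * u + q\<^sup>2) powr (- a)" for u
  have D: "1 - 2 * q * g v + q\<^sup>2 = (R v - q * v)\<^sup>2" for v
    using R(2)[of v] by (simp add: g_def power2_eq_square algebra_simps)
  have S: "1 - (g v)\<^sup>2 = (1 - v\<^sup>2) * (R v - q * v)\<^sup>2" for v
  proof -
    have "1 - (g v)\<^sup>2 - (1 - v\<^sup>2) * (R v - q * v)\<^sup>2 = (1 - (R v)\<^sup>2 - q\<^sup>2 * (1 - v\<^sup>2))"
      by (simp add: g_def power2_eq_square algebra_simps)
    then show ?thesis by (simp add: R(2))
  qed
  have deriv: "(g has_real_derivative g' v) (at v)" for v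
  proof -
    have "(g has_real_derivative q * (- (2 * v)) + (R v + v * ((2 * v * q\<^sup>2) * (inverse (R v) / 2)))) (at v)"
      unfolding g_def [abs_def] R_def using R2[of v]
      by (auto intro!: derivative_eq_intros simp: field_simps)
    also have "q * (- (2 * v)) + (R v + v * ((2 * v * q\<^sup>2) * (inverse (R v) / 2))) = g' v"
      using R(1)[of v] by (simp add: g'_def field_simps power2_eq_square)
    finally show ?thesis .
  qed
  have contR: "continuous_on S R" for S
    unfolding R_def [abs_def] by (intro continuous_intros)
  have [measurable]: "R \<in> borel_measurable borel" by (rule borel_measurable_continuous_onI[OF contR])
  have contg': "continuous_on {-1..1} g'"
    unfolding g'_def [abs_def] using less_imp_neq[OF R(1)] by (intro continuous_intros contR) auto
  have gR: "R 1 = 1" "R (-1) = 1" by (simp_all add: R_def)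
  \<comment> \<open>The exponents of \<open>r = R v - q * v\<close> add up to
    \<open>2 * \<gamma> - 2 * a + 2 = 1\<close>. This is where \<open>\<gamma> = a - 1/2\<close>
    enters: the substitution reproduces the density up to the factor
    \<open>r / R v = 1 - h v\<close>.\<close>
  have pt: "f (g v) * g' v * indicator {-1..1} v = ball_density \<gamma> v * (1 - h v)" for v
  proof (cases "v \<in> {-1..1}")
    case True
    then have "v\<^sup>2 \<le> 1" by (auto simp: abs_square_le_1 abs_le_iff)
    then have w: "0 \<le> 1 - v\<^sup>2" by simp
    define r where "r = R v - q * v"
    have r: "0 < r" using lt[of v] by (simp add: r_def)
    have "(r\<^sup>2) powr \<gamma> * (r\<^sup>2) powr (- a) * r\<^sup>2 = r"
    proof -
      have "(r\<^sup>2) powr \<gamma> * (r\<^sup>2) powr (- a) * r\<^sup>2 = r powr (2 * \<gamma>) * r powr (- 2 * a) * r powr 2"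
        using r by (simp add: powr_powr flip: powr_numeral)
      also have "\<dots> = r powr 1"
        unfolding powr_add[symmetric] by (simp add: \<gamma>_def algebra_simps)
      finally show ?thesis using r by simp
    qed
    moreover have "f (g v) * g' v = C * (1 - v\<^sup>2) powr \<gamma> * ((r\<^sup>2) powr \<gamma> * (r\<^sup>2) powr (- a) * r\<^sup>2) / R v"
      unfolding f_def g'_def D S r_def[symmetric] using w by (simp add: powr_mult)
    moreover have "1 - h v = r / R v"
      using R(1)[of v] by (simp add: h_def r_def field_simps)
    ultimately show ?thesis using True by (simp add: bd)
  qed (simp add: bd)
  have "(\<integral>\<^sup>+u. ennreal (f u * indicator {g (-1)..g 1} u) \<partial>lborel) =
      (\<integral>\<^sup>+v. ennreal (f (g v) * g' v * indicator {-1..1} v) \<partial>lborel)"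
  proof (rule nn_integral_substitution)
    show "set_borel_measurable borel {g (-1)..g 1} f"
      unfolding set_borel_measurable_def f_def by measurable
  qed (use deriv contg' R(1) in \<open>auto simp: g'_def less_imp_le\<close>)
  also have "(\<lambda>u. ennreal (f u * indicator {g (-1)..g 1} u)) =
      (\<lambda>u. ennreal (ball_density \<gamma> u * (1 - 2 * q * u + q\<^sup>2) powr (- a)))"
    unfolding bd by (simp add: f_def g_def gR mult_ac)
  also have "(\<integral>\<^sup>+v. ennreal (f (g v) * g' v * indicator {-1..1} v) \<partial>lborel) =
      (\<integral>\<^sup>+v. ennreal (ball_density \<gamma> v * (1 - h v)) \<partial>lborel)"
    unfolding pt ..
  finally have J: "(\<integral>\<^sup>+u. ennreal (ball_density \<gamma> u * (1 - 2 * q * u + q\<^sup>2) powr (- a)) \<partial>lborel) =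
      (\<integral>\<^sup>+v. ennreal (ball_density \<gamma> v * (1 - h v)) \<partial>lborel)" (is "?J = _") .
  have [measurable]: "h \<in> borel_measurable borel" unfolding h_def [abs_def] by measurable
  have bd0: "0 \<le> ball_density \<gamma> v" for v :: real unfolding bd using C by simp
  have h1: "\<bar>h v\<bar> \<le> 1" for v using lt[of v] R(1)[of v] by (simp add: h_def)
  have "(\<integral>\<^sup>+v. ennreal (ball_density \<gamma> v * (1 - h v)) \<partial>lborel) =
      (\<integral>\<^sup>+v. ennreal (ball_density \<gamma> (0 + -1 * v :: real) * (1 - h (0 + -1 * v))) \<partial>lborel)"
    by (subst nn_integral_real_affine[where c = "-1" and t = 0]) auto
  also have "\<dots> = (\<integral>\<^sup>+v. ennreal (ball_density \<gamma> v * (1 + h v)) \<partial>lborel)"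
    by (simp add: bd h_def R_def indicator_def conj_commute)
  finally have J': "?J = \<dots>" unfolding J .
  \<comment> \<open>\<open>h\<close> is odd and the density even, so adding the reflected integral
    cancels \<open>h\<close>. Adding the two forms of \<open>?J\<close> avoids subtraction in
    \<open>ennreal\<close>.\<close>
  have "?J + ?J = (\<integral>\<^sup>+v. ennreal (ball_density \<gamma> v * (1 - h v)) + ennreal (ball_density \<gamma> v * (1 + h v)) \<partial>lborel)"
    by (subst nn_integral_add) (simp_all add: J[symmetric] J'[symmetric])
  also have "\<dots> = (\<integral>\<^sup>+v. 2 * ennreal (ball_density \<gamma> (v::real)) \<partial>lborel)"
  proof (rule nn_integral_cong)
    fix v :: real
    have "ennreal (ball_density \<gamma> v * (1 - h v)) + ennreal (ball_density \<gamma> v * (1 + h v)) =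
        ennreal (ball_density \<gamma> v * (1 - h v) + ball_density \<gamma> v * (1 + h v))"
      using bd0[of v] h1[of v] by (intro ennreal_plus[symmetric] mult_nonneg_nonneg) auto
    also have "ball_density \<gamma> v * (1 - h v) + ball_density \<gamma> v * (1 + h v) = 2 * ball_density \<gamma> v"
      by (simp add: algebra_simps)
    also have "ennreal \<dots> = 2 * ennreal (ball_density \<gamma> v)" using ennreal_mult'[of 2] by simp
    finally show "ennreal (ball_density \<gamma> v * (1 - h v)) + ennreal (ball_density \<gamma> v * (1 + h v)) = \<dots>" .
  qed
  also have "\<dots> = 2 * (\<integral>\<^sup>+v. ennreal (ball_density \<gamma> (v::real)) \<partial>lborel)"
    by (rule nn_integral_cmult) measurable
  also have "(\<integral>\<^sup>+v. ennreal (ball_density \<gamma> (v::real)) \<partial>lborel) = 1"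
    using prob_space.emeasure_space_1[OF prob_space_ball_density[of \<gamma>, where 'a = real]] a
    by (simp add: emeasure_density \<gamma>_def)
  finally have two: "?J + ?J = 2" by simp
  have "?J \<noteq> \<top>" using two by auto
  then obtain r where r: "?J = ennreal r" "0 \<le> r" by (cases ?J) auto
  have "ennreal (r + r) = ennreal 2"
    using two unfolding r(1) by (simp only: ennreal_plus[OF r(2) r(2)] ennreal_numeral)
  then have "r = 1" using r(2) by (subst (asm) ennreal_inj) auto
  then show ?thesis using r(1) by (simp add: \<gamma>_def)
qed

text \<open>The powers \<open>(1 - 2 * q * x + q\<^sup>2) powr (- a)\<close> generate the Gegenbauer
  polynomials, which are orthogonal for the weight \<open>(1 - x\<^sup>2) powr (a - 1/2)\<close>;
  only the constant one survives integration, so the integral is \<open>1\<close> for every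
  \<open>q\<close>. A suitable \<open>q\<close> turns this base into a multiple of
  \<open>1 - s * x\<close>.\<close>

lemma sym_beta_generating_half:
  assumes s: "\<bar>s\<bar> < 1" and a: "0 < a"
  shows "(\<lambda>k. pochhammer a k / fact k * s ^ k * sym_beta_moment (a + 1/2) k) sums
    (2 / (1 + sqrt (1 - s\<^sup>2))) powr a"
proof -
  define t where "t = sqrt (1 - s\<^sup>2)"
  have s2: "s\<^sup>2 < 1" using s by (simp add: abs_square_less_1)
  have t: "0 < t" "t\<^sup>2 = 1 - s\<^sup>2" using s2 by (simp_all add: t_def)
  \<comment> \<open>The root in \<open>(-1, 1)\<close> of
    \<open>s = 2 * q / (1 + q\<^sup>2)\<close>, so that
    \<open>1 - 2 * q * x + q\<^sup>2 = (1 + q\<^sup>2) * (1 - s * x)\<close>. The factor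
    \<open>1 + q\<^sup>2 = 2 / (1 + t)\<close> is the base in the claim.\<close>
  define q where "q = s / (1 + t)"
  have q2: "1 + q\<^sup>2 = 2 / (1 + t)"
  proof -
    have "(1 + t)\<^sup>2 + s\<^sup>2 = 2 * (1 + t)" using t(2) by (simp add: power2_eq_square algebra_simps)
    then have "1 + q\<^sup>2 = 2 * (1 + t) / (1 + t)\<^sup>2" using t(1) by (simp add: q_def power_divide field_simps)
    also have "\<dots> = 2 / (1 + t)"
      unfolding power2_eq_square by (rule nonzero_mult_divide_mult_cancel_right) (use t in simp)
    finally show ?thesis .
  qed
  have q: "\<bar>q\<bar> < 1" using s t(1) by (simp add: q_def)
  let ?N = "ball_law (a - 1/2) :: real measure"
  interpret N: prob_space ?N by (rule prob_space_ball_density) (use a in simp)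
  have D: "1 - 2 * q * x + q\<^sup>2 = (1 + q\<^sup>2) * (1 - s * x)" for x
    unfolding q2 using q2 t(1) by (simp add: q_def field_simps)
  have pos: "0 < 1 + q\<^sup>2" by (simp add: add_pos_nonneg)
  have ae: "AE x in ?N. \<bar>x\<bar> \<le> 1" using AE_ball_density[of "a - 1/2", where 'a = real] by simp
  have "(\<integral>\<^sup>+x. ennreal ((1 - s * x) powr (- a)) \<partial>?N) =
      (\<integral>\<^sup>+x. ennreal (ball_density (a - 1/2) x) * ennreal ((1 - s * x) powr (- a)) \<partial>lborel)"
    by (rule nn_integral_density) measurable
  also have "\<dots> = (\<integral>\<^sup>+x. ennreal ((1 + q\<^sup>2) powr a) *
      ennreal (ball_density (a - 1/2) x * (1 - 2 * q * x + q\<^sup>2) powr (- a)) \<partial>lborel)"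
  proof (rule nn_integral_cong)
    fix x :: real
    show "ennreal (ball_density (a - 1/2) x) * ennreal ((1 - s * x) powr (- a)) = ennreal ((1 + q\<^sup>2) powr a) *
      ennreal (ball_density (a - 1/2) x * (1 - 2 * q * x + q\<^sup>2) powr (- a))"
    proof (cases "\<bar>x\<bar> \<le> 1")
      case True
      have "\<bar>s * x\<bar> < 1" using s True mult_left_le[of "\<bar>x\<bar>" "\<bar>s\<bar>"] by (simp add: abs_mult)
      then have "0 < 1 - s * x" by simp
      then have "(1 + q\<^sup>2) powr a * (1 - 2 * q * x + q\<^sup>2) powr (- a) = (1 - s * x) powr (- a)"
        unfolding D using pos by (simp add: powr_mult powr_minus)
      then have e: "(1 + q\<^sup>2) powr a * (ball_density (a - 1/2) x * (1 - 2 * q * x + q\<^sup>2) powr (- a)) =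
          ball_density (a - 1/2) x * (1 - s * x) powr (- a)"
        by (simp add: mult.left_commute)
      show ?thesis
        by (subst ennreal_mult''[symmetric], simp, subst ennreal_mult'[symmetric], simp,
            rule arg_cong[OF e[symmetric]])
    next
      case False
      then have "ball_density (a - 1/2) x = 0"
        using abs_square_le_1[of x] by (simp add: ball_density_def)
      then show ?thesis by simp
    qed
  qed
  also have "\<dots> = ennreal ((1 + q\<^sup>2) powr a) *
      (\<integral>\<^sup>+x. ennreal (ball_density (a - 1/2) x * (1 - 2 * q * x + q\<^sup>2) powr (- a)) \<partial>lborel)"
    by (rule nn_integral_cmult) measurable
  also have "\<dots> = ennreal ((1 + q\<^sup>2) powr a)"
    unfolding nn_integral_ball_density_gegenbauer[OF a q] by simp
  finally have "(LINT x|?N. (1 - s * x) powr (- a)) = (1 + q\<^sup>2) powr a"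
    by (subst integral_eq_nn_integral) auto
  then have "(\<lambda>k. pochhammer a k / fact k * s ^ k * (LINT x|?N. x ^ k)) sums ((1 + q\<^sup>2) powr a)"
    using sums_expectation_powr(2)[of ?N "\<lambda>x. x" s a] N.finite_measure ae s by simp
  moreover have "(LINT x|?N. x ^ k) = sym_beta_moment (a + 1/2) k" for k
    using ball_density_real_moment[of "a - 1/2" k] a by (simp add: add.commute)
  ultimately show ?thesis unfolding q2 t_def by simp
qed

section \<open>The law of the random flight\<close>

declare One_nat_def [simp del]

lemma distr_Pair_independent_rvs:
  assumes "prob_space M" and ind: "independent_rvs M S X N Y"
  shows "distr M (S \<Otimes>\<^sub>M N) (\<lambda>w. (X w, Y w)) = distr M S X \<Otimes>\<^sub>M distr M N Y"
proof -
  interpret prob_space M by fact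
  have [measurable]: "X \<in> measurable M S" "Y \<in> measurable M N"
    and I: "indep_set {X -` A \<inter> space M | A. A \<in> sets S} {Y -` B \<inter> space M | B. B \<in> sets N}"
    using ind by (auto simp: independent_rvs_def)
  interpret X: prob_space "distr M S X" by (rule prob_space_distr) measurable
  interpret Y: prob_space "distr M N Y" by (rule prob_space_distr) measurable
  have "distr M S X \<Otimes>\<^sub>M distr M N Y = distr M (S \<Otimes>\<^sub>M N) (\<lambda>w. (X w, Y w))"
  proof (rule pair_measure_eqI)
    fix A B assume "A \<in> sets (distr M S X)" "B \<in> sets (distr M N Y)"
    then have [measurable]: "A \<in> sets S" "B \<in> sets N" by simp_all
    have "prob ((X -` A \<inter> space M) \<inter> (Y -` B \<inter> space M)) = prob (X -` A \<inter> space M) * prob (Y -` B \<inter> space M)"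
      by (rule indep_setD[OF I]) auto
    moreover have "(\<lambda>w. (X w, Y w)) -` (A \<times> B) \<inter> space M = (X -` A \<inter> space M) \<inter> (Y -` B \<inter> space M)"
      by auto
    ultimately show "emeasure (distr M S X) A * emeasure (distr M N Y) B =
        emeasure (distr M (S \<Otimes>\<^sub>M N) (\<lambda>w. (X w, Y w))) (A \<times> B)"
      by (simp add: emeasure_distr emeasure_eq_measure ennreal_mult')
  qed (auto intro: X.sigma_finite_measure_axioms Y.sigma_finite_measure_axioms)
  then show ?thesis by (rule sym)
qed

lemma nn_integral_independent_rvs:
  assumes M: "prob_space M" and ind: "independent_rvs M S X N Y"
    and [measurable]: "case_prod G \<in> borel_measurable (S \<Otimes>\<^sub>M N)"
  shows "(\<integral>\<^sup>+w. G (X w) (Y w) \<partial>M) = (\<integral>\<^sup>+w. \<integral>\<^sup>+w'. G (X w) (Y w') \<partial>M \<partial>M)"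
proof -
  interpret prob_space M by fact
  have [measurable]: "X \<in> measurable M S" "Y \<in> measurable M N"
    using ind by (auto simp: independent_rvs_def)
  interpret X: prob_space "distr M S X" by (rule prob_space_distr) measurable
  interpret Y: prob_space "distr M N Y" by (rule prob_space_distr) measurable
  have G': "case_prod G \<in> borel_measurable (distr M S X \<Otimes>\<^sub>M distr M N Y)"
    by (subst measurable_cong_sets[OF sets_pair_measure_cong[OF sets_distr sets_distr] refl]) fact
  have "(\<integral>\<^sup>+w. G (X w) (Y w) \<partial>M) = (\<integral>\<^sup>+p. case_prod G p \<partial>distr M (S \<Otimes>\<^sub>M N) (\<lambda>w. (X w, Y w)))"
    by (subst nn_integral_distr) auto
  also have "\<dots> = (\<integral>\<^sup>+x. \<integral>\<^sup>+y. G x y \<partial>distr M N Y \<partial>distr M S X)"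
    unfolding distr_Pair_independent_rvs[OF M ind]
    using Y.nn_integral_fst[OF G'] by simp
  also have "\<dots> = (\<integral>\<^sup>+x. \<integral>\<^sup>+w'. G x (Y w') \<partial>M \<partial>distr M S X)"
    by (intro nn_integral_cong nn_integral_distr) (auto intro: measurable_compose[OF measurable_Pair1'])
  also have "\<dots> = (\<integral>\<^sup>+w. \<integral>\<^sup>+w'. G (X w) (Y w') \<partial>M \<partial>M)"
    by (rule nn_integral_distr) measurable
  finally show ?thesis .
qed

section \<open>The flight at one fixed observation time\<close>

text \<open>The index of the current direction takes countably many values, so the direction is
  jointly measurable in sample point and time, and its time integral is measurable.\<close>

lemma random_flight_measurable:
  assumes V: "\<And>k. V k \<in> borel_measurable M" and T: "\<And>k. T t k \<in> borel_measurable M"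
  shows "random_flight c n T V t \<in> borel_measurable M"
proof -
  note [measurable] = V T
  have N: "(\<lambda>p. Max {k. k \<le> n \<and> T t k (fst p) \<le> snd p}) \<in> measurable (M \<Otimes>\<^sub>M lborel) (count_space UNIV)"
    by measurable
  have "(\<lambda>p. V (Max {k. k \<le> n \<and> T t k (fst p) \<le> snd p}) (fst p)) \<in> borel_measurable (M \<Otimes>\<^sub>M lborel)"
    by (rule measurable_compose_countable[OF _ N]) measurable
  then have [measurable]: "(\<lambda>(w, u). direction_at n (\<lambda>k. T t k w) (\<lambda>k. V k w) u) \<in> borel_measurable (M \<Otimes>\<^sub>M lborel)"
    by (simp add: direction_at_def split_beta')
  show ?thesis
    unfolding random_flight_def [abs_def] set_lebesgue_integral_def by measurable
qed

text \<open>The common form of the three renewal laws: \<open>f1\<close>, \<open>f2\<close> and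
  \<open>f3\<close> are the cases \<open>a = 1\<close>, \<open>a = d - 1\<close> and
  \<open>a = d / 2 - 1\<close>.\<close>

definition dirichlet_density :: "nat \<Rightarrow> real \<Rightarrow> real \<Rightarrow> (nat \<Rightarrow> real) \<Rightarrow> real" where
  "dirichlet_density n a t \<tau> = Gamma ((real n + 1) * a) / Gamma a ^ (n + 1) *
     (1 / t powr ((real n + 1) * a - 1)) * gap_product n t (a - 1) \<tau> * indicator (renewal_simplex n t) \<tau>"

abbreviation gaps :: "nat \<Rightarrow> (nat \<Rightarrow> real) \<Rightarrow> nat \<Rightarrow> real" where
  "gaps n T \<equiv> \<lambda>j\<in>{1..n}. T j - T (j - 1)"

lemma sum_gaps: "(\<Sum>j=1..n. gaps n T j) = T n - T 0"
proof -
  have "(\<Sum>j=1..n. gaps n T j) = (\<Sum>j=1..n. T j - T (j - 1))" by (intro sum.cong) auto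
  also have "\<dots> = T n - T 0" by (induction n) auto
  finally show ?thesis .
qed

lemma gap_sum_gaps:
  "gap_sum n t y z (gaps n T) = (\<Sum>j=1..n. (T j - T (j - 1)) * y j) + (t - (T n - T 0)) * z"
proof -
  have "(\<Sum>j=1..n. gaps n T j * y j) = (\<Sum>j=1..n. (T j - T (j - 1)) * y j)" by (intro sum.cong) auto
  then show ?thesis using sum_gaps[where n = n and T = T] by (simp only: gap_sum_def)
qed

abbreviation directions_prod :: "nat \<Rightarrow> real \<Rightarrow> real \<Rightarrow> 'a::real_inner \<Rightarrow> (nat \<Rightarrow> 'w \<Rightarrow> 'a) \<Rightarrow> 'w \<Rightarrow> real" where
  "directions_prod n a s e V w \<equiv> \<Prod>k\<le>n. (1 - s * (e \<bullet> V k w)) powr (- a)"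

text \<open>The time \<open>t\<close> is fixed because each observation time has its own epochs. The
  directions are constrained here only by a norm bound and by independence of the epochs, so that
  alternating and uniform directions share everything up to the expectation of
  \<open>directions_prod\<close>.\<close>

locale dirichlet_flight = prob_space M for M :: "'w measure" +
  fixes V :: "nat \<Rightarrow> 'w \<Rightarrow> real ^ 'd" and T :: "real \<Rightarrow> nat \<Rightarrow> 'w \<Rightarrow> real"
    and n :: nat and t a :: real
  assumes epochs: "arrival_epochs M V T"
    and n: "1 \<le> n" and t: "0 < t" and a: "0 < a"
    and law: "distributed M (lborel_gaps n) (\<lambda>w. gaps n (\<lambda>j. T t j w))
      (\<lambda>\<tau>. ennreal (dirichlet_density n a t \<tau>))"
    and V1: "\<And>k. AE w in M. norm (V k w) \<le> 1"
begin

lemma T0: "w \<in> space M \<Longrightarrow> T t 0 w = 0"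
  using epochs t by (auto simp: arrival_epochs_def)

lemma independent: "independent_rvs M (PiM UNIV (\<lambda>_. borel)) (\<lambda>w k. V k w) (PiM UNIV (\<lambda>_. borel)) (\<lambda>w k. T t k w)"
  using epochs t by (auto simp: arrival_epochs_def)

lemma V_measurable [measurable]: "V k \<in> borel_measurable M"
proof -
  have "(\<lambda>w k. V k w) \<in> measurable M (PiM UNIV (\<lambda>_. borel))"
    using independent by (simp add: independent_rvs_def)
  from measurable_compose[OF this measurable_component_singleton[of k]] show ?thesis by simp
qed

lemma T_measurable [measurable]: "T t k \<in> borel_measurable M"
proof -
  have "(\<lambda>w k. T t k w) \<in> measurable M (PiM UNIV (\<lambda>_. borel))"
    using independent by (simp add: independent_rvs_def)
  from measurable_compose[OF this measurable_component_singleton[of k]] show ?thesis by simp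
qed

lemma AE_gaps_simplex: "AE w in M. gaps n (\<lambda>j. T t j w) \<in> renewal_simplex n t"
proof -
  let ?P = "lborel_gaps n"
  have X: "(\<lambda>w. gaps n (\<lambda>j. T t j w)) \<in> measurable M ?P"
    using law by (rule distributed_measurable)
  have f: "(\<lambda>\<tau>. ennreal (dirichlet_density n a t \<tau>)) \<in> borel_measurable ?P"
    using law by (rule distributed_borel_measurable)
  have "AE \<tau> in density ?P (\<lambda>\<tau>. ennreal (dirichlet_density n a t \<tau>)). \<tau> \<in> renewal_simplex n t"
    by (subst AE_density[OF f]) (auto simp: dirichlet_density_def split: split_indicator)
  then have "AE \<tau> in distr M ?P (\<lambda>w. gaps n (\<lambda>j. T t j w)). \<tau> \<in> renewal_simplex n t"
    unfolding distributed_distr_eq_density[OF law] .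
  then show ?thesis
    using pred_renewal_simplex[OF n, of t] by (subst (asm) AE_distr_iff[OF X]) (auto simp: pred_def)
qed

definition scaled_sum :: "'w \<Rightarrow> real ^ 'd" where
  "scaled_sum w = (1 / t) *\<^sub>R ((\<Sum>k<n. (T t (k + 1) w - T t k w) *\<^sub>R V k w) + (t - T t n w) *\<^sub>R V n w)"

lemma AE_random_flight:
  assumes c: "0 < c"
  shows "AE w in M. random_flight c n T V t w /\<^sub>R (c * t) = scaled_sum w"
  using AE_gaps_simplex AE_space
proof eventually_elim
  case (elim w)
  note S = renewal_simplexD[OF elim(1) n]
  have le: "T t n w \<le> t" using S(1) T0[OF elim(2)] sum_gaps[where n = n and T = "\<lambda>j. T t j w"] by simp
  have step: "T t k w \<le> T t (Suc k) w" if "Suc k \<le> n" for k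
    using S(2)[of "Suc k"] that by (simp add: One_nat_def)
  have mono: "T t i w \<le> T t j w" if "i \<le> j" "j \<le> n" for i j
    using that by (induction j rule: dec_induct) (auto intro: order_trans[OF _ step])
  have "random_flight c n T V t w =
      c *\<^sub>R (\<Sum>k<n. (T t (k + 1) w - T t k w) *\<^sub>R V k w) + (c * (t - T t n w)) *\<^sub>R V n w"
    by (rule random_flight_eq_sum) (use T0[OF elim(2)] mono le in auto)
  moreover have "inverse (c * t) * c = 1 / t" "inverse (c * t) * (c * x) = 1 / t * x" for x
    using c by (simp_all add: divide_inverse)
  ultimately show ?case
    by (simp only: scaled_sum_def scaleR_add_right scaleR_scaleR)
qed

lemma scaled_sum_measurable [measurable]: "scaled_sum \<in> borel_measurable M"
  unfolding scaled_sum_def [abs_def] by measurable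

text \<open>All gaps together sum to \<open>t\<close>, so the constant \<open>1\<close> in the
  coefficients contributes \<open>t\<close>. The shift \<open>j - 1\<close> appears since gap
  \<open>j\<close> is traversed in direction \<open>V (j - 1)\<close>; the last gap belongs to
  \<open>V n\<close>.\<close>

lemma gap_sum_eq_inner:
  assumes w: "w \<in> space M"
  shows "gap_sum n t (\<lambda>j. 1 - s * (e \<bullet> V (j - 1) w)) (1 - s * (e \<bullet> V n w)) (gaps n (\<lambda>j. T t j w)) =
    t * (1 - s * (e \<bullet> scaled_sum w))"
proof -
  let ?T = "\<lambda>j. T t j w"
  define B where "B = (\<Sum>k<n. (?T (k + 1) - ?T k) * (e \<bullet> V k w))"
  have "(\<Sum>j=1..n. (?T j - ?T (j - 1)) * (1 - s * (e \<bullet> V (j - 1) w))) =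
      (\<Sum>k<n. (?T (k + 1) - ?T k) * (1 - s * (e \<bullet> V k w)))"
    by (rule sum.reindex_bij_witness[of _ Suc "\<lambda>j. j - 1"]) auto
  also have "\<dots> = (\<Sum>k<n. ?T (k + 1) - ?T k) - s * B"
    unfolding B_def sum_distrib_left sum_subtractf[symmetric] by (intro sum.cong) (auto simp: algebra_simps)
  also have "(\<Sum>k<n. ?T (k + 1) - ?T k) = ?T n"
    using sum_lessThan_telescope[of ?T n] T0[OF w] by (simp add: Suc_eq_plus1)
  finally have "gap_sum n t (\<lambda>j. 1 - s * (e \<bullet> V (j - 1) w)) (1 - s * (e \<bullet> V n w)) (gaps n ?T) =
      ?T n - s * B + (t - ?T n) * (1 - s * (e \<bullet> V n w))"
    unfolding gap_sum_gaps[where T = ?T] T0[OF w] by (simp only: diff_zero)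
  moreover have "t * (e \<bullet> scaled_sum w) = B + (t - ?T n) * (e \<bullet> V n w)"
    using t by (simp add: scaled_sum_def B_def inner_add_right inner_sum_right)
  ultimately show ?thesis
    by (simp add: right_diff_distrib mult.left_commute[of t s]) (simp add: algebra_simps)
qed

lemma nn_integral_scaled_sum_powr:
  assumes e: "norm e = 1" and s: "\<bar>s\<bar> < 1"
  shows "(\<integral>\<^sup>+w. ennreal ((1 - s * (e \<bullet> scaled_sum w)) powr (- ((real n + 1) * a))) \<partial>M) =
    (\<integral>\<^sup>+w. ennreal (directions_prod n a s e V w) \<partial>M)"
proof -
  define A where "A = (real n + 1) * a"
  have A: "0 < A" using a by (simp add: A_def add_pos_nonneg)
  let ?P = "lborel_gaps n"
  define y where "y x j = 1 - s * (e \<bullet> x (j - 1))" for x :: "nat \<Rightarrow> real ^ 'd" and j :: nat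
  define z where "z x = 1 - s * (e \<bullet> x n)" for x :: "nat \<Rightarrow> real ^ 'd"
  define G where "G x T = ennreal (gap_sum n t (y x) (z x) (gaps n T) powr (- A))" for x T
  have G_meas: "case_prod G \<in> borel_measurable (PiM UNIV (\<lambda>_. borel) \<Otimes>\<^sub>M PiM UNIV (\<lambda>_. borel))"
  proof -
    let ?Q = "PiM UNIV (\<lambda>_::nat. borel :: (real ^ 'd) measure) \<Otimes>\<^sub>M PiM UNIV (\<lambda>_::nat. borel :: real measure)"
    have [measurable]: "(\<lambda>p. fst p k) \<in> borel_measurable ?Q" for k
      by (rule measurable_compose[OF measurable_fst measurable_component_singleton]) simp
    have [measurable]: "(\<lambda>p. snd p k) \<in> borel_measurable ?Q" for k
      by (rule measurable_compose[OF measurable_snd measurable_component_singleton]) simp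
    show ?thesis unfolding G_def gap_sum_gaps y_def z_def split_beta' by measurable
  qed
  have X: "(\<lambda>w. gaps n (\<lambda>j. T t j w)) \<in> measurable M ?P"
    using law by (rule distributed_measurable)
  have f: "(\<lambda>\<tau>. ennreal (dirichlet_density n a t \<tau>)) \<in> borel_measurable ?P"
    using law by (rule distributed_borel_measurable)
  \<comment> \<open>With the directions frozen at \<open>w\<close>, only the epochs are averaged
    over \<open>w'\<close>. The bound on the directions and \<open>\<bar>s\<bar> < 1\<close> make
    all coefficients positive, as the identity on the simplex demands.\<close>
  have inner: "AE w in M. (\<integral>\<^sup>+w'. G (\<lambda>k. V k w) (\<lambda>k. T t k w') \<partial>M) =
      ennreal (t powr (- A)) * ennreal (directions_prod n a s e V w)"
  proof -
    have "AE w in M. \<forall>k. norm (V k w) \<le> 1" using V1 by (subst AE_all_countable) auto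
    then show ?thesis
    proof eventually_elim
      case (elim w)
      let ?y = "y (\<lambda>k. V k w)" and ?z = "z (\<lambda>k. V k w)"
      have pos: "0 < 1 - s * (e \<bullet> V k w)" for k
      proof -
        have "\<bar>e \<bullet> V k w\<bar> \<le> 1" using Cauchy_Schwarz_ineq2[of e "V k w"] elim e by (auto intro: order_trans)
        then have "\<bar>s * (e \<bullet> V k w)\<bar> < 1"
          using s mult_left_le[of "\<bar>e \<bullet> V k w\<bar>" "\<bar>s\<bar>"] by (simp add: abs_mult)
        then show ?thesis by simp
      qed
      have g_meas: "(\<lambda>\<tau>. ennreal (gap_sum n t ?y ?z \<tau> powr (- A))) \<in> borel_measurable ?P"
        using gap_sum_measurable[OF n, of t ?y ?z] by measurable
      define K where "K = Gamma A / Gamma a ^ (n + 1) * (1 / t powr (A - 1))"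
      have K: "0 \<le> K" using a A t by (simp add: K_def Gamma_real_nonneg)
      have "(\<integral>\<^sup>+w'. G (\<lambda>k. V k w) (\<lambda>k. T t k w') \<partial>M) =
          (\<integral>\<^sup>+\<tau>. ennreal (gap_sum n t ?y ?z \<tau> powr (- A)) \<partial>distr M ?P (\<lambda>w. gaps n (\<lambda>j. T t j w)))"
        unfolding G_def by (rule nn_integral_distr[symmetric, OF X]) (use g_meas in simp)
      also have "\<dots> = (\<integral>\<^sup>+\<tau>. ennreal (dirichlet_density n a t \<tau>) * ennreal (gap_sum n t ?y ?z \<tau> powr (- A)) \<partial>?P)"
        unfolding distributed_distr_eq_density[OF law] by (rule nn_integral_density[OF f g_meas])
      also have "\<dots> = (\<integral>\<^sup>+\<tau>. ennreal K * (ennreal (gap_weight n t a \<tau>) *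
          ennreal (gap_sum n t ?y ?z \<tau> powr (- A))) \<partial>?P)"
      proof (rule nn_integral_cong)
        fix \<tau>
        have "dirichlet_density n a t \<tau> = K * (gap_weight n t a \<tau>)"
          by (simp add: dirichlet_density_def K_def A_def)
        then show "ennreal (dirichlet_density n a t \<tau>) * ennreal (gap_sum n t ?y ?z \<tau> powr (- A)) =
          ennreal K * (ennreal (gap_weight n t a \<tau>) *
          ennreal (gap_sum n t ?y ?z \<tau> powr (- A)))"
          by (simp only: ennreal_mult'[OF K] mult.assoc)
      qed
      also have "\<dots> = ennreal K * (\<integral>\<^sup>+\<tau>. ennreal (gap_weight n t a \<tau>) *
          ennreal (gap_sum n t ?y ?z \<tau> powr (- A)) \<partial>?P)"
        by (rule nn_integral_cmult[OF borel_measurable_times_ennreal[OF measurable_compose[OF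
            borel_measurable_times[OF gap_product_measurable[OF n] indicator_renewal_simplex_measurable[OF n]]
            measurable_ennreal] g_meas]])
      also have "\<dots> = ennreal K * ennreal (Gamma a ^ (n + 1) / Gamma A / t *
          (?z powr (- a) * (\<Prod>j=1..n. ?y j powr (- a))))"
        unfolding A_def by (subst nn_integral_renewal_simplex_powr[OF n a t]) (use pos in \<open>simp_all add: y_def z_def\<close>)
      also have "\<dots> = ennreal (K * (Gamma a ^ (n + 1) / Gamma A / t) * (?z powr (- a) * (\<Prod>j=1..n. ?y j powr (- a))))"
        by (simp only: ennreal_mult'[OF K, symmetric] mult.assoc)
      \<comment> \<open>The normalising constant of the Dirichlet density cancels the Gamma factors
        of the identity, and only a power of \<open>t\<close> is left.\<close>
      also have "K * (Gamma a ^ (n + 1) / Gamma A / t) = t powr (- A)"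
      proof -
        have "Gamma a \<noteq> 0" "Gamma A \<noteq> 0" using a A by (auto intro!: Gamma_real_neq_0)
        then have "K * (Gamma a ^ (n + 1) / Gamma A / t) = 1 / (t powr (A - 1) * t)"
          by (simp add: K_def)
        also have "t powr (A - 1) * t = t powr A" using t by (simp add: powr_diff)
        finally show ?thesis by (simp add: powr_minus_divide)
      qed
      also have "?z powr (- a) * (\<Prod>j=1..n. ?y j powr (- a)) = directions_prod n a s e V w"
      proof -
        have "(\<Prod>j=1..n. ?y j powr (- a)) = (\<Prod>k<n. (1 - s * (e \<bullet> V k w)) powr (- a))"
          unfolding y_def by (rule prod.reindex_bij_witness[of _ Suc "\<lambda>j. j - 1"]) auto
        then show ?thesis by (simp add: z_def lessThan_Suc_atMost[symmetric] mult.commute)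
      qed
      finally show ?case by (simp only: ennreal_mult'[OF powr_ge_zero])
    qed
  qed
  have "(\<integral>\<^sup>+w. ennreal ((1 - s * (e \<bullet> scaled_sum w)) powr (- A)) \<partial>M) =
      (\<integral>\<^sup>+w. ennreal (t powr A) * G (\<lambda>k. V k w) (\<lambda>k. T t k w) \<partial>M)"
  proof (rule nn_integral_cong)
    fix w assume w: "w \<in> space M"
    have g: "gap_sum n t (y (\<lambda>k. V k w)) (z (\<lambda>k. V k w)) (gaps n (\<lambda>j. T t j w)) =
        t * (1 - s * (e \<bullet> scaled_sum w))"
      using gap_sum_eq_inner[OF w, of s e] by (simp add: y_def [abs_def] z_def)
    have "t powr A * (t * (1 - s * (e \<bullet> scaled_sum w))) powr (- A) = (1 - s * (e \<bullet> scaled_sum w)) powr (- A)"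
      using t by (simp add: powr_mult powr_minus)
    then show "ennreal ((1 - s * (e \<bullet> scaled_sum w)) powr (- A)) =
        ennreal (t powr A) * G (\<lambda>k. V k w) (\<lambda>k. T t k w)"
      unfolding G_def g by (subst ennreal_mult'[symmetric]) simp_all
  qed
  also have "\<dots> = ennreal (t powr A) * (\<integral>\<^sup>+w. G (\<lambda>k. V k w) (\<lambda>k. T t k w) \<partial>M)"
  proof (rule nn_integral_cmult)
    have "(\<lambda>w. (\<lambda>k. V k w, \<lambda>k. T t k w)) \<in> M \<rightarrow>\<^sub>M PiM UNIV (\<lambda>_. borel) \<Otimes>\<^sub>M PiM UNIV (\<lambda>_. borel)"
      using independent unfolding independent_rvs_def by (elim conjE) (rule measurable_Pair)
    from measurable_compose[OF this G_meas]
    show "(\<lambda>w. G (\<lambda>k. V k w) (\<lambda>k. T t k w)) \<in> borel_measurable M" by simp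
  qed
  also have "(\<integral>\<^sup>+w. G (\<lambda>k. V k w) (\<lambda>k. T t k w) \<partial>M) =
      (\<integral>\<^sup>+w. \<integral>\<^sup>+w'. G (\<lambda>k. V k w) (\<lambda>k. T t k w') \<partial>M \<partial>M)"
    by (rule nn_integral_independent_rvs[OF prob_space_axioms independent G_meas])
  also have "\<dots> = (\<integral>\<^sup>+w. ennreal (t powr (- A)) * ennreal (directions_prod n a s e V w) \<partial>M)"
    by (rule nn_integral_cong_AE[OF inner])
  also have "\<dots> = ennreal (t powr (- A)) * (\<integral>\<^sup>+w. ennreal (directions_prod n a s e V w) \<partial>M)"
    by (rule nn_integral_cmult) measurable
  also have "ennreal (t powr A) * \<dots> = (\<integral>\<^sup>+w. ennreal (directions_prod n a s e V w) \<partial>M)"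
  proof -
    have "ennreal (t powr A) * ennreal (t powr (- A)) = 1"
      using t by (subst ennreal_mult'[symmetric]) (simp_all flip: powr_add)
    then show ?thesis by (simp add: mult.assoc[symmetric])
  qed
  finally show ?thesis unfolding A_def .
qed

text \<open>The gaps divided by \<open>t\<close> are nonnegative and sum to \<open>1\<close>, so the
  rescaled position is a convex combination of directions.\<close>

lemma AE_norm_scaled_sum: "AE w in M. norm (scaled_sum w) \<le> 1"
proof -
  have "AE w in M. \<forall>k. norm (V k w) \<le> 1" using V1 by (subst AE_all_countable) auto
  then show ?thesis
    using AE_gaps_simplex AE_space
  proof eventually_elim
    case (elim w)
    note S = renewal_simplexD[OF elim(2) n]
    have T0: "T t 0 w = 0" by (rule T0[OF elim(3)])
    have step: "0 \<le> T t (k + 1) w - T t k w" if "k < n" for k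
      using S(2)[of "Suc k"] that by (simp add: One_nat_def)
    have "norm ((\<Sum>k<n. (T t (k + 1) w - T t k w) *\<^sub>R V k w) + (t - T t n w) *\<^sub>R V n w) \<le>
        (\<Sum>k<n. (T t (k + 1) w - T t k w)) + (t - T t n w)"
    proof (rule norm_triangle_le[OF add_mono])
      show "norm (\<Sum>k<n. (T t (k + 1) w - T t k w) *\<^sub>R V k w) \<le> (\<Sum>k<n. (T t (k + 1) w - T t k w))"
        using step elim(1) by (intro order_trans[OF norm_sum] sum_mono) (auto intro!: mult_left_le)
      show "norm ((t - T t n w) *\<^sub>R V n w) \<le> t - T t n w"
        using S(1) T0 sum_gaps[where n = n and T = "\<lambda>j. T t j w"] elim(1) by (auto intro!: mult_left_le)
    qed
    also have "(\<Sum>k<n. (T t (k + 1) w - T t k w)) = T t n w"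
      using sum_lessThan_telescope[of "\<lambda>k. T t k w" n] T0 by (simp add: Suc_eq_plus1)
    finally show ?case using t by (simp add: scaled_sum_def)
  qed
qed

text \<open>The two things that depend on the case are isolated as hypotheses: a closed form
  \<open>F\<close> for the expected product over the directions, and its expansion with the moments
  of the target law. Comparing coefficients then identifies all projection moments.\<close>

lemma distr_random_flight:
  assumes c: "0 < c" and g: "0 < \<gamma> + 1"
    and F0: "\<And>s. \<bar>s\<bar> < 1 \<Longrightarrow> 0 \<le> F s"
    and F: "\<And>e s. norm e = 1 \<Longrightarrow> \<bar>s\<bar> < 1 \<Longrightarrow>
      (\<integral>\<^sup>+w. ennreal (directions_prod n a s e V w) \<partial>M) = ennreal (F s)"
    and sums: "\<And>s. \<bar>s\<bar> < 1 \<Longrightarrow> (\<lambda>k. pochhammer ((real n + 1) * a) k / fact k * s ^ k *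
      sym_beta_moment (CARD('d) / 2 + \<gamma> + 1/2) k) sums F s"
  shows "distr M borel (\<lambda>w. random_flight c n T V t w /\<^sub>R (c * t)) =
    ball_law \<gamma>"
proof -
  have [measurable]: "random_flight c n T V t \<in> borel_measurable M"
    by (rule random_flight_measurable) measurable
  have "distr M borel (\<lambda>w. random_flight c n T V t w /\<^sub>R (c * t)) = distr M borel scaled_sum"
    by (rule distr_cong_AE[OF refl refl AE_random_flight[OF c]]) auto
  also have "\<dots> = ball_law \<gamma>"
  proof (rule measure_eqI_moments)
    show "finite_measure (distr M borel scaled_sum)"
      by (intro prob_space.finite_measure prob_space_distr) measurable
    show "finite_measure (ball_law \<gamma> :: (real ^ 'd) measure)"
      by (intro prob_space.finite_measure prob_space_ball_density g)
    show "AE x in distr M borel scaled_sum. norm x \<le> 1"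
      using AE_norm_scaled_sum by (subst AE_distr_iff) auto
    show "AE x in (ball_law \<gamma> :: (real ^ 'd) measure). norm x \<le> 1"
      by (rule AE_ball_density)
    fix e :: "real ^ 'd" and k assume e: "norm e = 1"
    have A: "0 < (real n + 1) * a" using a by (simp add: add_pos_nonneg)
    have bd: "AE w in M. \<bar>e \<bullet> scaled_sum w\<bar> \<le> 1"
      using AE_norm_scaled_sum
    proof eventually_elim
      case (elim w)
      then show ?case using Cauchy_Schwarz_ineq2[of e "scaled_sum w"] e by simp
    qed
    have "(LINT x|distr M borel scaled_sum. (e \<bullet> x) ^ k) = (LINT w|M. (e \<bullet> scaled_sum w) ^ k)"
      by (rule integral_distr) measurable
    also have "\<dots> = sym_beta_moment (CARD('d) / 2 + \<gamma> + 1/2) k"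
    proof (rule moments_eqI[OF finite_measure_axioms _ bd A _ sums])
      show "(LINT w|M. (1 - s * (e \<bullet> scaled_sum w)) powr (- ((real n + 1) * a))) = F s" if s: "\<bar>s\<bar> < 1" for s
        using F0[OF s] nn_integral_scaled_sum_powr[OF e s] F[OF e s]
        by (subst integral_eq_nn_integral) auto
    qed measurable
    also have "\<dots> = (LINT x|ball_law \<gamma>. (e \<bullet> x) ^ k)"
      by (rule ball_density_moment[OF g e, symmetric])
    finally show "(LINT x|distr M borel scaled_sum. (e \<bullet> x) ^ k) = \<dots>" .
  qed simp_all
  finally show ?thesis .
qed

end

declare One_nat_def [simp]

section \<open>The three renewal laws and the expected product over the directions\<close>

lemma dirichlet_density_f1:
  assumes n: "1 \<le> n" and t: "0 < t"
  shows "f1 n t = dirichlet_density n 1 t"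
proof
  fix \<tau>
  show "f1 n t \<tau> = dirichlet_density n 1 t \<tau>"
  proof (cases "\<tau> \<in> renewal_simplex n t")
    case True
    \<comment> \<open>\<open>x powr 0 = 1\<close> fails at \<open>x = 0\<close>, so the positivity
      of the gaps on the simplex is used.\<close>
    have "(\<Prod>j=1..n. \<tau> j powr 0) = 1"
    proof (intro prod.neutral ballI)
      fix j assume "j \<in> {1..n}"
      from renewal_simplexD(2)[OF True n this] show "\<tau> j powr 0 = 1" by simp
    qed
    then have "gap_product n t 0 \<tau> = 1"
      using renewal_simplexD(1)[OF True n] by (simp add: gap_product_def)
    moreover have "Gamma (real n + 1) = fact n" using Gamma_fact[of n, where 'a = real] by (simp add: add.commute)
    ultimately show ?thesis
      using t by (simp add: f1_def dirichlet_density_def powr_realpow)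
  qed (simp add: f1_def dirichlet_density_def)
qed

lemma dirichlet_density_f2: "f2 d n t = dirichlet_density n (real d - 1) t"
  by (simp add: fun_eq_iff f2_def dirichlet_density_def)

lemma dirichlet_density_f3: "f3 d n t = dirichlet_density n (real d / 2 - 1) t"
  by (simp add: fun_eq_iff f3_def dirichlet_density_def)

lemma nn_integral_sphere_powr:
  fixes e :: "real ^ 'd"
  assumes e: "norm e = 1" and s: "\<bar>s\<bar> < 1"
    and H: "(\<lambda>k. pochhammer a k / fact k * s ^ k * sym_beta_moment ((CARD('d) - 1) / 2) k) sums H"
  shows "(\<integral>\<^sup>+v. ennreal ((1 - s * (e \<bullet> v)) powr (- a)) \<partial>uniform_sphere) = ennreal H"
proof -
  interpret prob_space "uniform_sphere :: (real ^ 'd) measure" by (rule prob_space_uniform_sphere)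
  have bd: "AE v in uniform_sphere. \<bar>e \<bullet> v\<bar> \<le> 1"
    using AE_uniform_sphere
  proof eventually_elim
    case (elim v)
    then show ?case using Cauchy_Schwarz_ineq2[of e v] e by simp
  qed
  have meas: "(\<lambda>v. e \<bullet> v) \<in> borel_measurable uniform_sphere" by measurable
  note S = sums_expectation_powr[OF finite_measure_axioms meas bd s, of a]
  have "(LINT v|uniform_sphere. (1 - s * (e \<bullet> v)) powr (- a)) = H"
    using S(2) H unfolding uniform_sphere_moment[OF e] by (rule sums_unique2)
  then show ?thesis
    using nn_integral_eq_integral[OF S(1)] by simp
qed

lemma nn_integral_prod_uniform_directions:
  fixes V :: "nat \<Rightarrow> 'w \<Rightarrow> real ^ 'd"
  assumes M: "prob_space M" and V: "flight_directions M V" "CARD('d) \<noteq> 1"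
    and e: "norm e = 1" and s: "\<bar>s\<bar> < 1" and H0: "0 \<le> H"
    and H: "(\<lambda>k. pochhammer a k / fact k * s ^ k * sym_beta_moment ((CARD('d) - 1) / 2) k) sums H"
  shows "(\<integral>\<^sup>+w. ennreal (directions_prod n a s e V w) \<partial>M) = ennreal (H ^ (n + 1))"
proof -
  interpret prob_space M by (rule M)
  have ind: "indep_vars (\<lambda>_. borel) V UNIV" and law: "distr M borel (V k) = uniform_sphere" for k
    using V by (auto simp: flight_directions_def)
  have [measurable]: "V k \<in> borel_measurable M" for k
    using ind by (auto simp: indep_vars_def)
  define g where "g v = ennreal ((1 - s * (e \<bullet> v)) powr (- a))" for v
  have [measurable]: "g \<in> borel_measurable borel" unfolding g_def by measurable
  have "(\<integral>\<^sup>+w. ennreal (directions_prod n a s e V w) \<partial>M) = (\<integral>\<^sup>+w. (\<Prod>k\<le>n. g (V k w)) \<partial>M)"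
    unfolding g_def by (subst prod_ennreal) auto
  also have "\<dots> = (\<Prod>k\<le>n. \<integral>\<^sup>+w. g (V k w) \<partial>M)"
  proof (rule indep_vars_nn_integral)
    show "indep_vars (\<lambda>_. borel) (\<lambda>k w. g (V k w)) {..n}"
      by (rule indep_vars_compose2[OF indep_vars_subset[OF ind]]) auto
  qed auto
  also have "\<dots> = (\<Prod>k\<le>n. ennreal H)"
  proof (rule prod.cong[OF refl])
    fix k
    have "(\<integral>\<^sup>+w. g (V k w) \<partial>M) = (\<integral>\<^sup>+v. g v \<partial>distr M borel (V k))"
      by (simp add: nn_integral_distr)
    also have "\<dots> = ennreal H"
      unfolding law g_def by (rule nn_integral_sphere_powr[OF e s H])
    finally show "(\<integral>\<^sup>+w. g (V k w) \<partial>M) = ennreal H" .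
  qed
  also have "\<dots> = ennreal (H ^ (n + 1))"
    by (simp only: prod_constant card_atMost ennreal_power[OF H0] Suc_eq_plus1)
  finally show ?thesis .
qed

lemma flight_directions_one_dimD:
  fixes V :: "nat \<Rightarrow> 'w \<Rightarrow> real ^ 'd"
  assumes V: "flight_directions M V" and d: "CARD('d) = 1"
  shows "V 0 \<in> borel_measurable M"
    and "measure M {w \<in> space M. V 0 w = 1} = 1/2"
    and "measure M {w \<in> space M. V 0 w = -1} = 1/2"
    and "\<And>w. w \<in> space M \<Longrightarrow> V k w = (-1) ^ k *\<^sub>R V 0 w"
  using V unfolding flight_directions_def if_P[OF d] by blast+

lemma AE_one_dim_directions:
  fixes V :: "nat \<Rightarrow> 'w \<Rightarrow> real ^ 'd"
  assumes M: "prob_space M" and V: "flight_directions M V" "CARD('d) = 1"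
  shows "AE w in M. V 0 w = 1 \<or> V 0 w = -1"
proof -
  interpret prob_space M by (rule M)
  have [measurable]: "V 0 \<in> borel_measurable M"
    and h: "prob {w \<in> space M. V 0 w = 1} = 1/2" "prob {w \<in> space M. V 0 w = -1} = 1/2"
    using flight_directions_one_dimD[OF V] by blast+
  have "(1 :: real ^ 'd) \<noteq> - 1" by (simp add: vec_eq_iff)
  then have "prob ({w \<in> space M. V 0 w = 1} \<union> {w \<in> space M. V 0 w = -1}) =
      prob {w \<in> space M. V 0 w = 1} + prob {w \<in> space M. V 0 w = -1}"
    by (intro finite_measure_Union) auto
  then have "prob ({w \<in> space M. V 0 w = 1} \<union> {w \<in> space M. V 0 w = -1}) = 1"
    using h by simp
  from AE_prob_1[OF this] show ?thesis by eventually_elim auto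
qed

lemma AE_norm_directions:
  fixes V :: "nat \<Rightarrow> 'w \<Rightarrow> real ^ 'd"
  assumes M: "prob_space M" and V: "flight_directions M V"
  shows "AE w in M. norm (V k w) \<le> 1"
proof (cases "CARD('d) = 1")
  case True
  have n1: "norm (1 :: real ^ 'd) = 1" using True by (simp add: norm_vec_def L2_set_def)
  note k = flight_directions_one_dimD(4)[OF V True]
  show ?thesis
    using AE_one_dim_directions[OF M V True] AE_space
  proof eventually_elim
    case (elim w)
    have "norm (V k w) = norm (V 0 w)" by (subst k[OF elim(2)]) (simp add: power_abs)
    also have "\<dots> = 1" using elim(1) n1 by (metis norm_minus_cancel)
    finally show ?case by simp
  qed
next
  case False
  interpret prob_space M by (rule M)
  have "indep_vars (\<lambda>_. borel) V UNIV" and law: "distr M borel (V k) = uniform_sphere"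
    using V False by (auto simp: flight_directions_def)
  then have [measurable]: "V k \<in> borel_measurable M" by (auto simp: indep_vars_def)
  have "AE v in distr M borel (V k). norm v \<le> 1"
    unfolding law using AE_uniform_sphere by eventually_elim simp
  then show ?thesis by (subst (asm) AE_distr_iff) auto
qed

lemma prod_alternating:
  fixes f :: "real \<Rightarrow> real"
  shows "(\<Prod>k\<le>Suc (2 * j). f ((-1) ^ k)) = (f 1 * f (-1)) ^ (j + 1)"
  by (induction j) (auto simp: mult_ac)

lemma inner_one_dim:
  fixes e :: "real ^ 'd"
  assumes d: "CARD('d) = 1" and e: "norm e = 1"
  shows "e \<bullet> 1 = 1 \<or> e \<bullet> 1 = - 1"
proof -
  obtain i :: 'd where i: "UNIV = {i}" using d by (auto simp: card_1_singleton_iff)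
  have "e \<bullet> 1 = e $ i" by (simp add: inner_vec_def i)
  moreover have "\<bar>e $ i\<bar> = 1" using e by (simp add: norm_vec_def L2_set_def i)
  ultimately show ?thesis by (auto simp: abs_if split: if_splits)
qed

text \<open>All directions are determined by the sign \<open>V 0\<close>, so the factors are
  dependent and the expectation is an average of two products rather than a product of
  averages.\<close>

lemma nn_integral_prod_one_dim_directions:
  fixes V :: "nat \<Rightarrow> 'w \<Rightarrow> real ^ 'd"
  assumes M: "prob_space M" and V: "flight_directions M V" and d: "CARD('d) = 1"
    and e: "norm e = 1" and s: "\<bar>s\<bar> < 1"
  shows "(\<integral>\<^sup>+w. ennreal (directions_prod n 1 s e V w) \<partial>M) =
    ennreal (((\<Prod>k\<le>n. 1 / (1 - s * (-1) ^ k)) + (\<Prod>k\<le>n. 1 / (1 + s * (-1) ^ k))) / 2)"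
proof -
  interpret prob_space M by (rule M)
  define P where "P r = (\<Prod>k\<le>n. 1 / (1 - r * (-1) ^ k))" for r :: real
  have P0: "0 \<le> P r" if "\<bar>r\<bar> < 1" for r
    unfolding P_def
  proof (intro prod_nonneg ballI)
    fix k
    have "\<bar>r * (-1) ^ k\<bar> < 1" using that by (simp add: abs_mult power_abs)
    then show "0 \<le> 1 / (1 - r * (-1) ^ k)" by simp
  qed
  have P: "(\<Prod>k\<le>n. (1 - r * (-1) ^ k) powr (- 1)) = P r" if "\<bar>r\<bar> < 1" for r
    unfolding P_def
  proof (rule prod.cong[OF refl])
    fix k
    have "\<bar>r * (-1) ^ k\<bar> < 1" using that by (simp add: abs_mult power_abs)
    then show "(1 - r * (-1) ^ k) powr (- 1) = 1 / (1 - r * (-1) ^ k)"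
      by (simp add: powr_minus_divide)
  qed
  define \<sigma> where "\<sigma> = e \<bullet> 1"
  have \<sigma>: "\<sigma> = 1 \<or> \<sigma> = -1" unfolding \<sigma>_def by (rule inner_one_dim[OF d e])
  have s\<sigma>: "\<bar>s * \<sigma>\<bar> < 1" "\<bar>- (s * \<sigma>)\<bar> < 1" using \<sigma> s by auto
  have [measurable]: "V 0 \<in> borel_measurable M"
    and h: "prob {w \<in> space M. V 0 w = 1} = 1/2" "prob {w \<in> space M. V 0 w = -1} = 1/2"
    and Vk: "\<And>k w. w \<in> space M \<Longrightarrow> V k w = (-1) ^ k *\<^sub>R V 0 w"
    using flight_directions_one_dimD[OF V d] by blast+
  let ?A = "{w \<in> space M. V 0 w = 1}" and ?B = "{w \<in> space M. V 0 w = -1}"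
  have ne: "(1 :: real ^ 'd) \<noteq> - 1" by (simp add: vec_eq_iff)
  have "(\<integral>\<^sup>+w. ennreal (directions_prod n 1 s e V w) \<partial>M) =
      (\<integral>\<^sup>+w. ennreal (P (s * \<sigma>)) * indicator ?A w + ennreal (P (- (s * \<sigma>))) * indicator ?B w \<partial>M)"
  proof (rule nn_integral_cong_AE)
    show "AE w in M. ennreal (directions_prod n 1 s e V w) =
        ennreal (P (s * \<sigma>)) * indicator ?A w + ennreal (P (- (s * \<sigma>))) * indicator ?B w"
      using AE_one_dim_directions[OF M V d] AE_space
    proof eventually_elim
      case (elim w)
      have "directions_prod n 1 s e V w = (\<Prod>k\<le>n. (1 - (s * (e \<bullet> V 0 w)) * (-1) ^ k) powr (- 1))"
      proof (rule prod.cong[OF refl])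
        fix k
        show "(1 - s * (e \<bullet> V k w)) powr (- 1) = (1 - (s * (e \<bullet> V 0 w)) * (-1) ^ k) powr (- 1)"
          by (subst Vk[OF elim(2), of k]) (simp add: mult_ac)
      qed
      then show ?case
        using elim P[OF s\<sigma>(1)] P[OF s\<sigma>(2)] ne by (auto simp: \<sigma>_def)
    qed
  qed
  also have "\<dots> = ennreal (P (s * \<sigma>)) * ennreal (1/2) + ennreal (P (- (s * \<sigma>))) * ennreal (1/2)"
    by (subst nn_integral_add) (simp_all add: nn_integral_cmult_indicator emeasure_eq_measure h)
  also have "\<dots> = ennreal ((P (s * \<sigma>) + P (- (s * \<sigma>))) / 2)"
  proof -
    have "ennreal (P (s * \<sigma>)) * ennreal (1/2) = ennreal (P (s * \<sigma>) * (1/2))"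
      "ennreal (P (- (s * \<sigma>))) * ennreal (1/2) = ennreal (P (- (s * \<sigma>)) * (1/2))"
      by (intro ennreal_mult''[symmetric]; simp)+
    moreover have "ennreal (P (s * \<sigma>) * (1/2)) + ennreal (P (- (s * \<sigma>)) * (1/2)) =
        ennreal (P (s * \<sigma>) * (1/2) + P (- (s * \<sigma>)) * (1/2))"
      using P0[OF s\<sigma>(1)] P0[OF s\<sigma>(2)] by (intro ennreal_plus[symmetric]) auto
    ultimately show ?thesis by (simp add: add_divide_distrib)
  qed
  \<comment> \<open>The sign of \<open>e\<close> merely swaps the two summands.\<close>
  also have "P (s * \<sigma>) + P (- (s * \<sigma>)) = P s + P (- s)"
    using \<sigma> by auto
  finally show ?thesis by (simp add: P_def)
qed

text \<open>For odd \<open>n\<close> the \<open>n + 1\<close> directions split into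
  \<open>j + 1\<close> opposite pairs, each contributing \<open>1 / (1 - s\<^sup>2)\<close>. For
  even \<open>n\<close> one more direction with the sign of \<open>V 0\<close> is left, and
  averaging over that sign yields one more such factor. At the same time \<open>A = n + 1\<close>
  moves from \<open>2 * b\<close> to \<open>2 * b + 1\<close>, so both cases lead to the same
  \<open>b = j + 1\<close> and the same limit density exponent \<open>j\<close>.\<close>

lemma distr_flight_one_dim:
  fixes V :: "nat \<Rightarrow> 'w \<Rightarrow> real ^ 'd"
  assumes M: "prob_space M" and V: "flight_directions M V" and T: "arrival_epochs M V T"
    and d: "CARD('d) = 1" and n: "n = 2 * j + 1 \<or> n = 2 * j + 2"
    and law: "renewal_law M n T (f1 n)" and t: "0 < t" and c: "0 < c"
  shows "distr M borel (\<lambda>w. random_flight c n T V t w /\<^sub>R (c * t)) =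
    ball_law (real j)"
proof -
  have n1: "1 \<le> n" using n by auto
  have law': "distributed M (lborel_gaps n) (\<lambda>w. gaps n (\<lambda>j. T t j w))
      (\<lambda>\<tau>. ennreal (dirichlet_density n 1 t \<tau>))"
    using law t unfolding renewal_law_def dirichlet_density_f1[OF n1 t, symmetric] by blast
  define b where "b = real j + 1"
  have b: "0 < b" by (simp add: b_def)
  have b_eq: "CARD('d) / 2 + real j + 1/2 = b" using d by (simp add: b_def)
  define B where "B = (if n = 2 * j + 1 then b else b + 1)"
  define f where "f s u = 1 / (1 - s * u)" for s u :: real
  have pow: "1 / (1 - s\<^sup>2) ^ k = (1 - s\<^sup>2) powr (- real k)" if "\<bar>s\<bar> < 1" for s :: real and k
    using that by (simp add: powr_minus_divide powr_realpow abs_square_less_1)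
  have ff: "f s 1 * f s (-1) = 1 / (1 - s\<^sup>2)" for s
    by (simp add: f_def power2_eq_square algebra_simps)
  have avg: "((\<Prod>k\<le>n. 1 / (1 - s * (-1) ^ k)) + (\<Prod>k\<le>n. 1 / (1 + s * (-1) ^ k))) / 2 = (1 - s\<^sup>2) powr (- B)"
    if s: "\<bar>s\<bar> < 1" for s :: real
  proof (cases "n = 2 * j + 1")
    case True
    then have n1: "n = Suc (2 * j)" by simp
    have "(\<Prod>k\<le>n. f r ((-1) ^ k)) = (1 - r\<^sup>2) powr (- b)" if "\<bar>r\<bar> < 1" for r
      unfolding n1 prod_alternating ff b_def using pow[OF that, of "j + 1"]
      by (simp only: power_divide power_one of_nat_add of_nat_1)
    from this[OF s] this[of "- s"] s True show ?thesis
      by (simp add: f_def B_def)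
  next
    case False
    then have n2: "n = Suc (Suc (2 * j))" using n by simp
    have s1: "1 - s \<noteq> 0" "1 + s \<noteq> 0" using s by auto
    have ev: "(-1 :: real) ^ Suc (Suc (2 * j)) = 1" by simp
    have P: "(\<Prod>k\<le>n. f r ((-1) ^ k)) = (1 - r\<^sup>2) powr (- b) * f r 1" if "\<bar>r\<bar> < 1" for r
      unfolding n2 prod.atMost_Suc[of _ "Suc (2 * j)"] prod_alternating ff b_def ev using pow[OF that, of "j + 1"]
      by (simp only: power_divide power_one of_nat_add of_nat_1)
    have "f s 1 + f (- s) 1 = 2 * (1 / (1 - s\<^sup>2) ^ 1)"
      using s1 by (simp add: f_def power2_eq_square field_simps)
    also have "\<dots> = 2 * (1 - s\<^sup>2) powr (- 1)" unfolding pow[OF s] by simp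
    finally have sum2: "f s 1 + f (- s) 1 = 2 * (1 - s\<^sup>2) powr (- 1)" .
    have "((\<Prod>k\<le>n. f s ((-1) ^ k)) + (\<Prod>k\<le>n. f (- s) ((-1) ^ k))) / 2 =
        (1 - s\<^sup>2) powr (- b) * ((f s 1 + f (- s) 1) / 2)"
      using P[OF s] P[of "- s"] s by (simp add: distrib_left)
    also have "\<dots> = (1 - s\<^sup>2) powr (- b) * (1 - s\<^sup>2) powr (- 1)" unfolding sum2 by simp
    also have "\<dots> = (1 - s\<^sup>2) powr (- B)"
      unfolding powr_add[symmetric] using False by (simp add: B_def)
    finally show ?thesis by (simp add: f_def)
  qed
  show ?thesis
  proof (rule dirichlet_flight.distr_random_flight[OF _ c, where F = "\<lambda>s. (1 - s\<^sup>2) powr (- B)"])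
    show "dirichlet_flight M V T n t 1"
      using M T n1 t law' AE_norm_directions[OF M V]
      by (intro dirichlet_flight.intro dirichlet_flight_axioms.intro) auto
    show "(\<integral>\<^sup>+w. ennreal (directions_prod n 1 s e V w) \<partial>M) = ennreal ((1 - s\<^sup>2) powr (- B))"
      if "norm e = 1" "\<bar>s\<bar> < 1" for e s
      unfolding nn_integral_prod_one_dim_directions[OF M V d that] avg[OF that(2)] ..
    show "(\<lambda>k. pochhammer ((real n + 1) * 1) k / fact k * s ^ k * sym_beta_moment (CARD('d) / 2 + real j + 1/2) k)
        sums (1 - s\<^sup>2) powr (- B)" if s: "\<bar>s\<bar> < 1" for s
    proof (cases "n = 2 * j + 1")
      case True
      then have "(real n + 1) * 1 = 2 * b" by (simp add: b_def)
      then show ?thesis unfolding b_eq using sym_beta_generating_2b[OF s b] True by (simp add: B_def)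
    next
      case False
      then have "(real n + 1) * 1 = 2 * b + 1" using n by (auto simp: b_def)
      then show ?thesis unfolding b_eq using sym_beta_generating_2b1[OF s b] False by (simp add: B_def)
    qed
  qed auto
qed

text \<open>The base \<open>h s\<close> is common to the direction law with exponent
  \<open>a\<close> and the target law with exponent \<open>A = (n + 1) * a\<close>; independence of
  the \<open>n + 1\<close> directions just multiplies the exponent.\<close>

lemma distr_flight_uniform:
  fixes V :: "nat \<Rightarrow> 'w \<Rightarrow> real ^ 'd"
  assumes M: "prob_space M" and V: "flight_directions M V" and T: "arrival_epochs M V T"
    and d: "CARD('d) \<noteq> 1" and n: "1 \<le> n" and t: "0 < t" and c: "0 < c" and a: "0 < a" and g: "0 < \<gamma> + 1"
    and law: "renewal_law M n T (dirichlet_density n a)"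
    and h: "\<And>s. \<bar>s\<bar> < 1 \<Longrightarrow> 0 < h s"
    and H: "\<And>s. \<bar>s\<bar> < 1 \<Longrightarrow>
      (\<lambda>k. pochhammer a k / fact k * s ^ k * sym_beta_moment ((CARD('d) - 1) / 2) k) sums (h s powr a)"
    and A: "\<And>s. \<bar>s\<bar> < 1 \<Longrightarrow> (\<lambda>k. pochhammer ((real n + 1) * a) k / fact k * s ^ k *
      sym_beta_moment (CARD('d) / 2 + \<gamma> + 1/2) k) sums (h s powr ((real n + 1) * a))"
  shows "distr M borel (\<lambda>w. random_flight c n T V t w /\<^sub>R (c * t)) =
    ball_law \<gamma>"
proof (rule dirichlet_flight.distr_random_flight[OF _ c g, where F = "\<lambda>s. h s powr ((real n + 1) * a)"])
  show "dirichlet_flight M V T n t a"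
  proof (intro dirichlet_flight.intro dirichlet_flight_axioms.intro)
    show "distributed M (lborel_gaps n) (\<lambda>w. gaps n (\<lambda>j. T t j w))
        (\<lambda>\<tau>. ennreal (dirichlet_density n a t \<tau>))"
      using law t unfolding renewal_law_def by blast
  qed (fact M T n t a AE_norm_directions[OF M V])+
  show "(\<integral>\<^sup>+w. ennreal (directions_prod n a s e V w) \<partial>M) = ennreal (h s powr ((real n + 1) * a))"
    if e: "norm e = 1" and s: "\<bar>s\<bar> < 1" for e s
  proof -
    have "(h s powr a) ^ (n + 1) = h s powr ((real n + 1) * a)"
      using h[OF s] by (subst powr_realpow[symmetric]) (simp_all add: powr_powr mult.commute add.commute)
    then show ?thesis
      using nn_integral_prod_uniform_directions[OF M V d e s powr_ge_zero H[OF s]] by simp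
  qed
qed (use A in auto)

section \<open>Radial law, support and Fourier transform\<close>

lemma ball_density_nonneg: "0 < \<gamma> + 1 \<Longrightarrow> 0 \<le> ball_density \<gamma> (x :: 'a::euclidean_space)"
  unfolding ball_density_def
  by (intro mult_nonneg_nonneg divide_nonneg_nonneg Gamma_real_nonneg) (auto intro: add_nonneg_nonneg)

lemma ball_density_pos:
  assumes g: "0 < \<gamma> + 1" and x: "norm (x :: 'a::euclidean_space) < 1"
  shows "0 < ball_density \<gamma> x"
proof -
  have "(norm x)\<^sup>2 < 1" using x by (simp add: abs_square_less_1)
  then show ?thesis
    unfolding ball_density_def using g
    by (intro mult_pos_pos divide_pos_pos Gamma_real_pos) (auto simp: max_def add_nonneg_pos)
qed

lemma distr_ball_density_norm:
  assumes g: "0 < \<gamma> + 1"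
  shows "distr (ball_law \<gamma> :: 'a::euclidean_space measure) borel norm =
    density lborel (\<lambda>r. ennreal (indicator {0..} r *
      (2 * Gamma (DIM('a) / 2 + \<gamma> + 1) / (Gamma (\<gamma> + 1) * Gamma (DIM('a) / 2)) * r ^ (DIM('a) - 1) *
        max (1 - r\<^sup>2) 0 powr \<gamma>)))"
proof -
  define D where "D = real DIM('a)"
  have D: "0 < D" by (simp add: D_def)
  define C where "C = Gamma (D / 2 + \<gamma> + 1) / (pi powr (D / 2) * Gamma (\<gamma> + 1))"
  define Q where "Q = 2 * Gamma (D / 2 + \<gamma> + 1) / (Gamma (\<gamma> + 1) * Gamma (D / 2))"
  have C: "0 \<le> C"
    unfolding C_def using D g by (intro divide_nonneg_nonneg mult_nonneg_nonneg Gamma_real_nonneg) auto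
  have const: "unit_ball_vol D * D * C = Q"
  proof -
    have "unit_ball_vol D * D * C = 2 * (unit_ball_vol D * (D / 2)) * C" by simp
    also have "\<dots> = Q" unfolding radial_const[OF D] C_def Q_def by simp
    finally show ?thesis .
  qed
  have "distr (density lborel (\<lambda>x::'a. ennreal (C * max (1 - (norm x powr 1)\<^sup>2) 0 powr \<gamma>))) borel (\<lambda>x. norm x powr 1) =
    density lborel (\<lambda>r. ennreal (unit_ball_vol D) * (ennreal (C * max (1 - r\<^sup>2) 0 powr \<gamma>) *
      ennreal (indicator {0..} r * (D / 1 * r powr (D / 1 - 1)))))"
    unfolding D_def
    by (rule distr_norm_powr_radial_density[where g = "\<lambda>r. ennreal (C * max (1 - r\<^sup>2) 0 powr \<gamma>)"]) auto
  also have "(\<lambda>x::'a. ennreal (C * max (1 - (norm x powr 1)\<^sup>2) 0 powr \<gamma>)) = (\<lambda>x. ennreal (ball_density \<gamma> x))"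
    by (simp add: ball_density_def C_def D_def)
  also have "(\<lambda>x::'a. norm x powr 1) = norm" by simp
  also have "density lborel (\<lambda>r. ennreal (unit_ball_vol D) * (ennreal (C * max (1 - r\<^sup>2) 0 powr \<gamma>) *
      ennreal (indicator {0..} r * (D / 1 * r powr (D / 1 - 1))))) =
    density lborel (\<lambda>r. ennreal (indicator {0..} r * (Q * r ^ (DIM('a) - 1) * max (1 - r\<^sup>2) 0 powr \<gamma>)))"
  proof (rule density_cong)
    show "AE r in lborel. ennreal (unit_ball_vol D) * (ennreal (C * max (1 - r\<^sup>2) 0 powr \<gamma>) *
      ennreal (indicator {0..} r * (D / 1 * r powr (D / 1 - 1)))) =
      ennreal (indicator {0..} r * (Q * r ^ (DIM('a) - 1) * max (1 - r\<^sup>2) 0 powr \<gamma>))"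
    \<comment> \<open>The point \<open>0\<close> is excluded since for \<open>D = 1\<close> the
      factor \<open>r powr (D - 1)\<close> is \<open>0\<close> there while
      \<open>r ^ (DIM('a) - 1)\<close> is \<open>1\<close>.\<close>
    proof (rule AE_mp[OF AE_lborel_singleton[of 0]], rule AE_I2, rule impI)
      fix r :: real assume r: "r \<noteq> 0"
      have "unit_ball_vol D * (C * max (1 - r\<^sup>2) 0 powr \<gamma> * (indicator {0..} r * (D / 1 * r powr (D / 1 - 1)))) =
        (unit_ball_vol D * D * C) * (indicator {0..} r * r powr (D - 1) * max (1 - r\<^sup>2) 0 powr \<gamma>)"
        by simp
      also have "\<dots> = indicator {0..} r * (Q * r ^ (DIM('a) - 1) * max (1 - r\<^sup>2) 0 powr \<gamma>)"
      proof (cases "0 < r")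
        case True
        have "r powr (D - 1) = r ^ (DIM('a) - 1)"
          using True by (simp add: powr_realpow[symmetric] D_def of_nat_diff Suc_leI)
        then show ?thesis unfolding const by simp
      qed (use r in simp)
      finally have E: "unit_ball_vol D * (C * max (1 - r\<^sup>2) 0 powr \<gamma> *
          (indicator {0..} r * (D / 1 * r powr (D / 1 - 1)))) =
        indicator {0..} r * (Q * r ^ (DIM('a) - 1) * max (1 - r\<^sup>2) 0 powr \<gamma>)" .
      show "ennreal (unit_ball_vol D) * (ennreal (C * max (1 - r\<^sup>2) 0 powr \<gamma>) *
        ennreal (indicator {0..} r * (D / 1 * r powr (D / 1 - 1)))) =
        ennreal (indicator {0..} r * (Q * r ^ (DIM('a) - 1) * max (1 - r\<^sup>2) 0 powr \<gamma>))"
        using C D by (subst ennreal_mult'[symmetric], simp, subst ennreal_mult'[symmetric], simp)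
          (rule arg_cong[OF E])
    qed
  qed measurable
  finally show ?thesis unfolding Q_def D_def .
qed

text \<open>Boundary points belong to the support because each of their neighbourhoods contains a
  small ball inside the open unit ball, where the density is positive.\<close>

lemma measure_support_ball_density:
  assumes g: "0 < \<gamma> + 1"
  shows "measure_support (ball_law \<gamma> :: 'a::euclidean_space measure) = {x. norm x \<le> 1}"
proof (intro set_eqI iffI)
  let ?N = "ball_law \<gamma> :: 'a measure"
  fix x :: 'a
  {
    assume x: "x \<in> measure_support ?N"
    show "x \<in> {x. norm x \<le> 1}"
    proof (rule ccontr)
      assume "x \<notin> {x. norm x \<le> 1}"
      then have "x \<in> - cball 0 1" by simp
      moreover have "emeasure ?N (- cball 0 1) = 0"
        using AE_ball_density[of \<gamma>, where 'a = 'a] by (subst (asm) AE_iff_measurable[of "- cball 0 1"]) auto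
      ultimately show False using x by (auto simp: measure_support_def open_Compl)
    qed
  }
  {
    assume x: "x \<in> {x. norm x \<le> 1}"
    show "x \<in> measure_support ?N"
      unfolding measure_support_def
    proof (intro CollectI allI impI)
      fix U :: "'a set" assume U: "open U \<and> x \<in> U"
      have "x \<in> closure (ball 0 1)" using x by (simp add: closure_ball)
      then have "U \<inter> ball 0 1 \<noteq> {}" using open_Int_closure_eq_empty[of U "ball 0 1"] U by blast
      then obtain y where "y \<in> U \<inter> ball 0 1" by blast
      moreover have "open (U \<inter> ball 0 1)" using U by auto
      ultimately obtain r where r: "0 < r" "ball y r \<subseteq> U \<inter> ball 0 1"
        using open_contains_ball[of "U \<inter> ball 0 1"] by blast
      show "emeasure ?N U \<noteq> 0"
      proof
        assume "emeasure ?N U = 0"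
        then have "(\<integral>\<^sup>+x. ennreal (ball_density \<gamma> x) * indicator U x \<partial>lborel) = 0"
          using U by (simp add: emeasure_density borel_open)
        then have "AE x in lborel. ennreal (ball_density \<gamma> x) * indicator U x = 0"
          using U by (subst (asm) nn_integral_0_iff_AE) (auto simp: borel_open)
        then have "AE x in lborel. x \<notin> ball y r"
        proof eventually_elim
          case (elim x)
          show ?case
          proof
            assume "x \<in> ball y r"
            then have "x \<in> U" "norm x < 1" using r(2) by auto
            then show False using elim ball_density_pos[OF g, of x] by simp
          qed
        qed
        then have "emeasure lborel (ball y r) = 0"
          by (subst (asm) AE_iff_measurable[of "ball y r"]) auto
        then show False
          using r(1) less_imp_neq[OF unit_ball_vol_pos[of "real DIM('a)"]] by (simp add: emeasure_ball)
      qed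
    qed
  }
qed

text \<open>The exponential is expanded along the unit vector \<open>sgn \<xi>\<close>. Odd moments
  vanish, \<open>\<i> ^ (2 * j)\<close> is the alternating sign, and
  \<open>pochhammer (1/2) j\<close> in the moment cancels against that in
  \<open>fact (2 * j)\<close>.\<close>

lemma ball_density_char_sums:
  fixes \<xi> :: "real ^ 'd"
  assumes g: "0 < \<gamma> + 1" and \<xi>: "\<xi> \<noteq> 0"
  shows "(\<lambda>j. complex_of_real ((-1) ^ j * (norm \<xi> / 2) ^ (2 * j) /
      (fact j * pochhammer (CARD('d) / 2 + \<gamma> + 1) j))) sums
    (LINT x|lborel. complex_of_real (ball_density \<gamma> x) * exp (\<i> * complex_of_real (x \<bullet> \<xi>)))"
proof -
  let ?N = "ball_law \<gamma> :: (real ^ 'd) measure"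
  interpret N: prob_space ?N by (rule prob_space_ball_density[OF g])
  define b where "b = CARD('d) / 2 + \<gamma> + 1/2"
  define e where "e = sgn \<xi>"
  have e: "norm e = 1" using \<xi> by (simp add: e_def norm_sgn)
  let ?c = "\<lambda>k. (\<i> * complex_of_real (norm \<xi>)) ^ k / fact k"
  have exp_eq: "(\<Sum>k. (e \<bullet> x) ^ k *\<^sub>R ?c k) = exp (\<i> * complex_of_real (x \<bullet> \<xi>))" for x
  proof -
    have "x \<bullet> \<xi> = norm \<xi> * (e \<bullet> x)" using \<xi> by (simp add: e_def sgn_div_norm inner_commute)
    then show ?thesis
      by (simp add: exp_def power_mult_distrib scaleR_conv_of_real divide_inverse mult_ac)
  qed
  have bd: "AE x in ?N. \<bar>e \<bullet> x\<bar> \<le> 1"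
    using AE_ball_density
  proof eventually_elim
    case (elim x)
    then show ?case using Cauchy_Schwarz_ineq2[of e x] e by simp
  qed
  have "summable (\<lambda>k. 1 ^ k * norm (?c k))"
    using summable_exp[of "norm \<xi>"] by (simp add: norm_inverse norm_fact norm_power norm_mult divide_inverse mult.commute)
  from sums_integral_power_series(2)[OF N.finite_measure_axioms _ bd this]
  have "(\<lambda>k. ?c k * complex_of_real (sym_beta_moment b k)) sums (LINT x|?N. (\<Sum>k. (e \<bullet> x) ^ k *\<^sub>R ?c k))"
    unfolding ball_density_moment[OF g e] b_def by (simp add: scaleR_conv_of_real mult.commute)
  then have "(\<lambda>j. (\<i> * complex_of_real (norm \<xi>)) ^ (2 * j) / fact (2 * j) * complex_of_real (sym_beta_moment b (2 * j))) sums
      (LINT x|?N. (\<Sum>k. (e \<bullet> x) ^ k *\<^sub>R ?c k))"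
    by (subst (asm) sums_even_iff) (auto simp: sym_beta_moment_def)
  also have "(\<lambda>j. (\<i> * complex_of_real (norm \<xi>)) ^ (2 * j) / fact (2 * j) * complex_of_real (sym_beta_moment b (2 * j))) =
      (\<lambda>j. complex_of_real ((-1) ^ j * (norm \<xi> / 2) ^ (2 * j) / (fact j * pochhammer (CARD('d) / 2 + \<gamma> + 1) j)))"
  proof
    fix j
    have p: "pochhammer (1/2 :: real) j \<noteq> 0" using pochhammer_pos[of "1/2 :: real" j] by simp
    have "norm \<xi> ^ (2 * j) / fact (2 * j) * sym_beta_moment b (2 * j) =
        (norm \<xi> / 2) ^ (2 * j) / (fact j * pochhammer (CARD('d) / 2 + \<gamma> + 1) j)"
      unfolding fact_double using p by (simp add: sym_beta_moment_def b_def power_divide add_ac)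
    then have "complex_of_real ((-1) ^ j * (norm \<xi> / 2) ^ (2 * j) / (fact j * pochhammer (CARD('d) / 2 + \<gamma> + 1) j)) =
        complex_of_real ((-1) ^ j * (norm \<xi> ^ (2 * j) / fact (2 * j) * sym_beta_moment b (2 * j)))"
      by (simp only: times_divide_eq_right[symmetric])
    also have "\<dots> = (\<i> * complex_of_real (norm \<xi>)) ^ (2 * j) / fact (2 * j) * complex_of_real (sym_beta_moment b (2 * j))"
      unfolding power_mult_distrib power_mult[of \<i>] by simp
    finally show "(\<i> * complex_of_real (norm \<xi>)) ^ (2 * j) / fact (2 * j) * complex_of_real (sym_beta_moment b (2 * j)) =
        complex_of_real ((-1) ^ j * (norm \<xi> / 2) ^ (2 * j) / (fact j * pochhammer (CARD('d) / 2 + \<gamma> + 1) j))"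
      by (rule sym)
  qed
  also have "(LINT x|?N. (\<Sum>k. (e \<bullet> x) ^ k *\<^sub>R ?c k)) = (LINT x|?N. exp (\<i> * complex_of_real (x \<bullet> \<xi>)))"
    unfolding exp_eq ..
  also have "(LINT x|?N. exp (\<i> * complex_of_real (x \<bullet> \<xi>))) =
      (LINT x|lborel. ball_density \<gamma> x *\<^sub>R exp (\<i> * complex_of_real (x \<bullet> \<xi>)))"
    by (rule integral_density) (auto simp: ball_density_nonneg[OF g])
  finally show ?thesis by (simp add: scaleR_conv_of_real)
qed

text \<open>The series of the characteristic function becomes the Bessel series once each
  \<open>pochhammer (\<nu> + 1) j\<close> is written as a Gamma quotient and the factor
  \<open>(u / 2) powr \<nu> / Gamma (\<nu> + 1)\<close> is multiplied in.\<close>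

lemma fourier_ball_density:
  fixes \<xi> :: "real ^ 'd"
  assumes g: "0 < \<gamma> + 1" and \<xi>: "\<xi> \<noteq> 0"
  shows "fourier (\<lambda>x. complex_of_real (ball_density \<gamma> x)) \<xi> =
    complex_of_real (1 / (2 * pi) powr (CARD('d) / 2) * (2 / norm \<xi>) powr (CARD('d) / 2 + \<gamma>) *
      Gamma (CARD('d) / 2 + \<gamma> + 1) * bessel_J (CARD('d) / 2 + \<gamma>) (norm \<xi>))"
proof -
  define \<nu> where "\<nu> = CARD('d) / 2 + \<gamma>"
  define u where "u = norm \<xi>"
  have u: "0 < u" using \<xi> by (simp add: u_def)
  have "1 \<le> real CARD('d)" using zero_less_card_finite[where 'a = 'd] by linarith
  then have \<nu>: "0 < \<nu> + 1" using g by (simp add: \<nu>_def)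
  define x where "x j = (-1) ^ j * (u / 2) ^ (2 * j) / (fact j * pochhammer (\<nu> + 1) j)" for j
  let ?L = "LINT x|lborel. complex_of_real (ball_density \<gamma> x) * exp (\<i> * complex_of_real (x \<bullet> \<xi>))"
  have S: "(\<lambda>j. complex_of_real (x j)) sums ?L"
    using ball_density_char_sums[OF g \<xi>] by (simp add: x_def u_def \<nu>_def)
  \<comment> \<open>All terms are real, so the integral has imaginary part \<open>0\<close> and
    equals its real part.\<close>
  then have xs: "x sums Re ?L" and "Im ?L = 0"
    using sums_Re[OF S] sums_Im[OF S] sums_unique2[of "\<lambda>_. 0 :: real" "Im ?L" 0] by auto
  then have L: "?L = complex_of_real (Re ?L)" by (simp add: complex_eq_iff)
  have "(\<lambda>j. x j * ((u / 2) powr \<nu> / Gamma (\<nu> + 1))) sums (Re ?L * ((u / 2) powr \<nu> / Gamma (\<nu> + 1)))"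
    by (rule sums_mult2[OF xs])
  moreover have "x j * ((u / 2) powr \<nu> / Gamma (\<nu> + 1)) =
      (-1) ^ j * (u / 2) powr (2 * real j + \<nu>) / (fact j * Gamma (real j + \<nu> + 1))" for j
  proof -
    have "pochhammer (\<nu> + 1) j = Gamma (\<nu> + 1 + j) / Gamma (\<nu> + 1)"
      using \<nu> by (intro pochhammer_Gamma) (auto dest!: nonpos_Ints_nonpos)
    moreover have "Gamma (\<nu> + 1) \<noteq> 0" by (rule Gamma_real_neq_0[OF \<nu>])
    moreover have "(u / 2) powr (2 * real j + \<nu>) = (u / 2) ^ (2 * j) * (u / 2) powr \<nu>"
      using u by (simp add: powr_add powr_realpow[symmetric])
    ultimately show ?thesis by (simp add: x_def add_ac)
  qed
  ultimately have "bessel_J \<nu> u = Re ?L * ((u / 2) powr \<nu> / Gamma (\<nu> + 1))"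
    unfolding bessel_J_def by (simp add: sums_iff)
  moreover have "(2 / u) powr \<nu> * (u / 2) powr \<nu> = 1"
    using u by (simp flip: powr_mult)
  moreover have "Gamma (\<nu> + 1) \<noteq> 0" by (rule Gamma_real_neq_0[OF \<nu>])
  ultimately have "(2 / u) powr \<nu> * Gamma (\<nu> + 1) * bessel_J \<nu> u = Re ?L"
    by (simp add: mult_ac)
  then have "1 / (2 * pi) powr (CARD('d) / 2) * (2 / u) powr \<nu> * Gamma (\<nu> + 1) * bessel_J \<nu> u =
      (2 * pi) powr (- (CARD('d) / 2)) * Re ?L"
    by (simp add: powr_minus_divide mult.assoc)
  then show ?thesis
    unfolding fourier_def \<nu>_def[symmetric] u_def[symmetric] by (subst L) simp
qed

section \<open>The three cases joined, and the assertions on position and distance\<close>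

lemma flight_law:
  fixes V :: "nat \<Rightarrow> 'w \<Rightarrow> real ^ 'd"
  assumes M: "prob_space M" and V: "flight_directions M V" and T: "arrival_epochs M V T"
    and d: "d = CARD('d)" and n: "1 \<le> n" and \<alpha>: "0 < \<alpha>"
    and cases: "(d = 1 \<and> renewal_law M n T (f1 n) \<and>
            (\<exists>j::nat. 1 \<le> j \<and>
               ((n = 2 * j + 1 \<and> m = \<alpha> / (real n - 1) + 1) \<or>
                (n = 2 * j + 2 \<and> m = \<alpha> / (real n - 2) + 1))))
       \<or> (2 \<le> d \<and> renewal_law M n T (f2 d n) \<and>
            m = \<alpha> / (real n * (real d - 1) - 2) + 1 \<and> real d > 2 / real n + 1)
       \<or> (3 \<le> d \<and> renewal_law M n T (f3 d n) \<and>
            m = \<alpha> / (real n * (real d - 2) - 2) + 1 \<and> real d > 2 / real n + 2)"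
    and \<gamma>: "\<gamma> = \<alpha> / (2 * (m - 1))" and t: "0 < t" and c: "0 < c"
  shows "0 < \<gamma>" and "distr M borel (\<lambda>\<omega>. random_flight c n T V t \<omega> /\<^sub>R (c * t)) =
    ball_law \<gamma>" (is "?law \<gamma>")
proof -
  have n0: "0 < real n" using n by simp
  have "0 < \<gamma> \<and> ?law \<gamma>"
    using cases
  proof (elim disjE conjE exE)
    fix j :: nat
    assume "d = 1" "renewal_law M n T (f1 n)" "1 \<le> j" "n = 2 * j + 1" "m = \<alpha> / (real n - 1) + 1"
    moreover from this have "\<gamma> = real j" using \<gamma> \<alpha> by simp
    ultimately show ?thesis
      using distr_flight_one_dim[OF M V T, of n j t c] d t c by simp
  next
    fix j :: nat
    assume "d = 1" "renewal_law M n T (f1 n)" "1 \<le> j" "n = 2 * j + 2" "m = \<alpha> / (real n - 2) + 1"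
    moreover from this have "\<gamma> = real j" using \<gamma> \<alpha> by simp
    ultimately show ?thesis
      using distr_flight_one_dim[OF M V T, of n j t c] d t c by simp
  next
    assume d2: "2 \<le> d" and law: "renewal_law M n T (f2 d n)"
      and m: "m = \<alpha> / (real n * (real d - 1) - 2) + 1" and gt: "real d > 2 / real n + 1"
    define a where "a = real d - 1"
    have a: "0 < a" using d2 by (simp add: a_def)
    have pos: "0 < real n * a - 2" using gt n0 by (simp add: a_def field_simps)
    have g: "\<gamma> = (real n * a - 2) / 2" using \<gamma> \<alpha> pos unfolding m a_def[symmetric] by simp
    have b: "CARD('d) / 2 + \<gamma> + 1/2 = (real n + 1) * a / 2"
      unfolding g d[symmetric] a_def by (simp add: field_simps)
    have d1: "CARD('d) \<noteq> 1" using d d2 by simp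
    have "?law \<gamma>"
    \<comment> \<open>Directions and target both have exponent equal to twice their Beta parameter,
      which gives \<open>(1 - s\<^sup>2) powr (- b)\<close> with \<open>b\<close> half the
      exponent.\<close>
    proof (rule distr_flight_uniform[OF M V T d1 n t c a, where h = "\<lambda>s. (1 - s\<^sup>2) powr (- 1/2)"])
      show "renewal_law M n T (dirichlet_density n a)"
        using law unfolding a_def ext[of "f2 d n", OF dirichlet_density_f2] .
      fix s :: real assume s: "\<bar>s\<bar> < 1"
      then have s2: "0 < 1 - s\<^sup>2" by (simp add: abs_square_less_1)
      show "0 < (1 - s\<^sup>2) powr (- 1/2)" using s2 by simp
      have gen: "(\<lambda>k. pochhammer A k / fact k * s ^ k * sym_beta_moment (A / 2) k) sums ((1 - s\<^sup>2) powr (- 1/2)) powr A"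
        if "0 < A" for A
        using sym_beta_generating_2b[OF s, of "A / 2"] that by (simp add: powr_powr)
      show "(\<lambda>k. pochhammer a k / fact k * s ^ k * sym_beta_moment ((CARD('d) - 1) / 2) k) sums ((1 - s\<^sup>2) powr (- 1/2)) powr a"
      proof -
        have half: "real (CARD('d) - 1) / 2 = a / 2" using d d2 by (simp add: a_def of_nat_diff)
        show ?thesis unfolding half by (rule gen[OF a])
      qed
      show "(\<lambda>k. pochhammer ((real n + 1) * a) k / fact k * s ^ k * sym_beta_moment (CARD('d) / 2 + \<gamma> + 1/2) k) sums
          ((1 - s\<^sup>2) powr (- 1/2)) powr ((real n + 1) * a)"
        unfolding b using gen[of "(real n + 1) * a"] a n0 by simp
    qed (use g pos in simp)
    moreover have "0 < \<gamma>" using g pos by simp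
    ultimately show ?thesis by (rule conjI[rotated])
  next
    assume d3: "3 \<le> d" and law: "renewal_law M n T (f3 d n)"
      and m: "m = \<alpha> / (real n * (real d - 2) - 2) + 1" and gt: "real d > 2 / real n + 2"
    define a where "a = real d / 2 - 1"
    have a: "0 < a" using d3 by (simp add: a_def)
    have da: "real d - 2 = 2 * a" by (simp add: a_def)
    have pos: "0 < real n * a - 1" using gt n0 by (simp add: a_def field_simps)
    have "\<gamma> = (real n * (2 * a) - 2) / 2" using \<gamma> \<alpha> pos unfolding m da by simp
    then have g: "\<gamma> = real n * a - 1" by simp
    have b: "CARD('d) / 2 + \<gamma> + 1/2 = (real n + 1) * a + 1/2"
      unfolding g d[symmetric] a_def by (simp add: field_simps)
    have d1: "CARD('d) \<noteq> 1" using d d3 by simp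
    have "?law \<gamma>"
    \<comment> \<open>Directions and target both have exponent equal to their Beta parameter minus
      one half.\<close>
    proof (rule distr_flight_uniform[OF M V T d1 n t c a, where h = "\<lambda>s. 2 / (1 + sqrt (1 - s\<^sup>2))"])
      show "renewal_law M n T (dirichlet_density n a)"
        using law unfolding a_def ext[of "f3 d n", OF dirichlet_density_f3] .
      fix s :: real assume s: "\<bar>s\<bar> < 1"
      then have s2: "0 < 1 - s\<^sup>2" by (simp add: abs_square_less_1)
      show "0 < 2 / (1 + sqrt (1 - s\<^sup>2))" using s2 by (simp add: add_pos_pos)
      have b': "real (CARD('d) - 1) / 2 = a + 1/2"
        using d d3 by (simp add: a_def of_nat_diff field_simps)
      show "(\<lambda>k. pochhammer a k / fact k * s ^ k * sym_beta_moment ((CARD('d) - 1) / 2) k) sums (2 / (1 + sqrt (1 - s\<^sup>2))) powr a"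
        unfolding b' by (rule sym_beta_generating_half[OF s a])
      show "(\<lambda>k. pochhammer ((real n + 1) * a) k / fact k * s ^ k * sym_beta_moment (CARD('d) / 2 + \<gamma> + 1/2) k) sums
          (2 / (1 + sqrt (1 - s\<^sup>2))) powr ((real n + 1) * a)"
        unfolding b by (rule sym_beta_generating_half[OF s]) (use a n0 in simp)
    qed (use g pos in simp)
    moreover have "0 < \<gamma>" using g pos by simp
    ultimately show ?thesis by (rule conjI[rotated])
  qed
  then show "0 < \<gamma>" "?law \<gamma>" by blast+
qed

text \<open>Every assertion is a statement about the rescaled position \<open>Z t\<close>, whose law
  is \<open>ball_law \<gamma>\<close> at each time; position and distance follow by multiplying with
  \<open>K t\<close>.\<close>

theorem proposition3p2:
  fixes M :: "'w measure"
    and V :: "nat \<Rightarrow> 'w \<Rightarrow> real ^ 'd"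
    and T :: "real \<Rightarrow> nat \<Rightarrow> 'w \<Rightarrow> real"
    and X Y :: "real \<Rightarrow> 'w \<Rightarrow> real ^ 'd"
    and R :: "real \<Rightarrow> 'w \<Rightarrow> real"
    and w :: "real ^ 'd \<Rightarrow> real \<Rightarrow> real"
    and n d :: nat
    and \<alpha> m \<beta> \<kappa> c \<gamma> :: real
  assumes "prob_space M"
    and "flight_directions M V"
    and "arrival_epochs M V T"
    and "d = CARD('d)" and "1 \<le> n" and "0 < \<alpha>" and "\<alpha> \<le> 2" and "1 < m"
    and "(d = 1 \<and> renewal_law M n T (f1 n) \<and>
            (\<exists>j::nat. 1 \<le> j \<and>
               ((n = 2 * j + 1 \<and> m = \<alpha> / (real n - 1) + 1) \<or>
                (n = 2 * j + 2 \<and> m = \<alpha> / (real n - 2) + 1))))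
       \<or> (2 \<le> d \<and> renewal_law M n T (f2 d n) \<and>
            m = \<alpha> / (real n * (real d - 1) - 2) + 1 \<and> real d > 2 / real n + 1)
       \<or> (3 \<le> d \<and> renewal_law M n T (f3 d n) \<and>
            m = \<alpha> / (real n * (real d - 2) - 2) + 1 \<and> real d > 2 / real n + 2)"
    and "\<beta> = 1 / (real d * (m - 1) + \<alpha>)"
    and "\<kappa> = real d * Gamma (real d / 2) /
           ((real d * (m - 1) + \<alpha>) * 2 powr \<alpha> * Gamma (1 + \<alpha> / 2) * Gamma ((real d + \<alpha>) / 2))"
    and "c = \<kappa> powr (- 1 / \<alpha>)"
    and "\<gamma> = \<alpha> / (2 * (m - 1))"
    and "X = random_flight c n T V"
    and "Y = (\<lambda>t. X (t powr \<beta>))"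
    and "R = (\<lambda>t \<omega>. norm (Y t \<omega>))"
    and "w = (\<lambda>x t. Gamma (real d / 2 + \<gamma> + 1) / (pi powr (real d / 2) * Gamma (\<gamma> + 1)) *
                max (1 - (norm x)\<^sup>2) 0 powr \<gamma>)"
  shows
    "(\<forall>t>0. distributed M lborel (R t) (\<lambda>r. ennreal (indicator {0..} r *
        (2 * Gamma (real d / 2 + \<gamma> + 1) / (Gamma (\<gamma> + 1) * Gamma (real d / 2)) *
         (r ^ (d - 1) / (c * t powr \<beta>) ^ d) *
         max (1 - r\<^sup>2 / (c\<^sup>2 * t powr (2 * \<beta>))) 0 powr \<gamma>))))
   \<and> (2 \<le> d \<longrightarrow> (\<forall>t>0. \<forall>p::real. 1 \<le> p \<longrightarrow>
        integrable M (\<lambda>\<omega>. R t \<omega> powr p) \<and>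
        prob_space.expectation M (\<lambda>\<omega>. R t \<omega> powr p) =
          Gamma (real d / 2 + \<gamma> + 1) * Gamma ((real d + p) / 2) /
          (Gamma (\<gamma> + 1 + (real d + p) / 2) * Gamma (real d / 2)) * (c * t powr \<beta>) powr p))
   \<and> (d = 1 \<longrightarrow> (\<forall>t>0. \<forall>p::nat. 1 \<le> p \<longrightarrow>
        (odd p \<longrightarrow> (\<forall>i. integrable M (\<lambda>\<omega>. (Y t \<omega> $ i) ^ p) \<and>
                        prob_space.expectation M (\<lambda>\<omega>. (Y t \<omega> $ i) ^ p) = 0)) \<and>
        (even p \<longrightarrow> integrable M (\<lambda>\<omega>. R t \<omega> ^ p) \<and>
                    prob_space.expectation M (\<lambda>\<omega>. R t \<omega> ^ p) =
          Gamma (1 / 2 + \<gamma> + 1) * Gamma ((1 + real p) / 2) /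
          (Gamma (\<gamma> + 1 + (real p + 1) / 2) * sqrt pi) * (c * t powr \<beta>) ^ p)))
   \<and> (\<forall>t>0. distributed M lborel (\<lambda>\<omega>. X (t powr \<beta>) \<omega> /\<^sub>R (c * t powr \<beta>)) (\<lambda>x. ennreal (w x t)))
   \<and> (\<forall>s>0. \<forall>t>0. distr M borel (\<lambda>\<omega>. X (s powr \<beta>) \<omega> /\<^sub>R (c * s powr \<beta>)) =
                   distr M borel (\<lambda>\<omega>. X (t powr \<beta>) \<omega> /\<^sub>R (c * t powr \<beta>)))
   \<and> (\<forall>t>0. compact (measure_support (distr M borel (\<lambda>\<omega>. X (t powr \<beta>) \<omega> /\<^sub>R (c * t powr \<beta>)))) \<and>
            measure_support (distr M borel (\<lambda>\<omega>. X (t powr \<beta>) \<omega> /\<^sub>R (c * t powr \<beta>))) = {x. norm x \<le> 1})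
   \<and> (\<forall>t>0. \<forall>\<xi>. \<xi> \<noteq> 0 \<longrightarrow>
        fourier (\<lambda>x. complex_of_real (w x t)) \<xi> =
          complex_of_real (1 / (2 * pi) powr (real d / 2) *
            (2 / norm \<xi>) powr (real d / 2 + \<gamma>) * Gamma (real d / 2 + \<gamma> + 1) *
            bessel_J (real d / 2 + \<gamma>) (norm \<xi>)))
   \<and> (\<forall>t>0. distributed M lborel (\<lambda>\<omega>. (R t \<omega> / (c * t powr \<beta>))\<^sup>2)
        (\<lambda>x. ennreal (beta_density (real d / 2) (\<gamma> + 1) x)))"
proof -
  interpret prob_space M by (rule assms(1))
  note V = assms(2) and T = assms(3) and d = assms(4) and n = assms(5)
    and X = \<open>X = _\<close> and Y = \<open>Y = _\<close> and R = \<open>R = _\<close>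
  have d0: "0 < real d" using d by simp
  have "0 < \<kappa>"
    unfolding \<open>\<kappa> = _\<close> using d0 \<open>0 < \<alpha>\<close> \<open>1 < m\<close>
    by (intro divide_pos_pos mult_pos_pos Gamma_real_pos add_pos_pos) auto
  then have c: "0 < c" using \<open>c = _\<close> by simp
  \<comment> \<open>The length of the path up to the observation time \<open>t powr \<beta>\<close>,
    hence the radius of the reachable ball.\<close>
  define K where "K t = c * t powr \<beta>" for t
  have K: "0 < K t" if "0 < t" for t using c that by (simp add: K_def)
  define Z where "Z t u = X (t powr \<beta>) u /\<^sub>R K t" for t u
  let ?N = "ball_law \<gamma> :: (real ^ 'd) measure"
  note FL = flight_law[OF assms(1) V T d n \<open>0 < \<alpha>\<close> assms(9) \<open>\<gamma> = _\<close> _ c]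
  have \<gamma>: "0 < \<gamma>" using FL(1)[of 1] by simp
  then have g: "0 < \<gamma> + 1" by simp
  have law: "distr M borel (Z t) = ?N" if "0 < t" for t
    using FL(2)[of "t powr \<beta>"] that unfolding Z_def K_def X by simp
  have X_meas: "X r \<in> borel_measurable M" if "0 < r" for r
  proof -
    have ind: "independent_rvs M (PiM UNIV (\<lambda>_. borel)) (\<lambda>u k. V k u) (PiM UNIV (\<lambda>_. borel)) (\<lambda>u k. T r k u)"
      using T that by (auto simp: arrival_epochs_def)
    have mV: "(\<lambda>u k. V k u) \<in> M \<rightarrow>\<^sub>M PiM UNIV (\<lambda>_. borel)" and mT: "(\<lambda>u k. T r k u) \<in> M \<rightarrow>\<^sub>M PiM UNIV (\<lambda>_. borel)"
      using ind unfolding independent_rvs_def by blast+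
    show ?thesis
      unfolding X using measurable_compose[OF mV measurable_component_singleton] measurable_compose[OF mT measurable_component_singleton]
      by (intro random_flight_measurable) auto
  qed
  have Z_meas: "Z t \<in> borel_measurable M" if "0 < t" for t
    unfolding Z_def using X_meas[of "t powr \<beta>"] that by simp
  have YZ: "Y t u = K t *\<^sub>R Z t u" if "0 < t" for t u
    using K[OF that] by (simp add: Y Z_def)
  have RZ: "R t u = K t * norm (Z t u)" if "0 < t" for t u
    using K[OF that] by (simp add: R YZ[OF that])
  have w: "w x t = ball_density \<gamma> x" for x t
    unfolding \<open>w = _\<close> by (simp add: ball_density_def d)
  have KD: "(K t)\<^sup>2 = c\<^sup>2 * t powr (2 * \<beta>)" if "0 < t" for t
    using that by (simp add: K_def power_mult_distrib powr_powr mult.commute flip: powr_numeral)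
  have moment: "integrable M (\<lambda>u. R t u powr p)"
      "expectation (\<lambda>u. R t u powr p) =
        Gamma (real d / 2 + \<gamma> + 1) * Gamma ((real d + p) / 2) /
          (Gamma (\<gamma> + 1 + (real d + p) / 2) * Gamma (real d / 2)) * K t powr p"
    if t: "0 < t" and p: "0 \<le> p" for t p
  proof -
    define E where "E = Beta ((real d + p) / 2) (\<gamma> + 1) / Beta (real d / 2) (\<gamma> + 1)"
    have E: "0 \<le> E" unfolding E_def using d0 p g by (intro divide_nonneg_nonneg less_imp_le[OF Beta_real_pos]) auto
    have "(\<integral>\<^sup>+u. ennreal (norm (Z t u) powr p) \<partial>M) = (\<integral>\<^sup>+x. ennreal (norm x powr p) \<partial>?N)"
      unfolding law[OF t, symmetric] using Z_meas[OF t] by (subst nn_integral_distr) auto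
    also have "\<dots> = (\<integral>\<^sup>+x. ennreal (ball_density \<gamma> (x :: real ^ 'd)) * ennreal (norm x powr p) \<partial>lborel)"
      by (rule nn_integral_density) measurable
    also have "\<dots> = ennreal E"
      using nn_integral_ball_density_norm[OF g p, where 'a = "real ^ 'd"] by (simp add: E_def d mult.commute)
    finally have "has_bochner_integral M (\<lambda>u. norm (Z t u) powr p) E"
      using E Z_meas[OF t] by (intro has_bochner_integral_nn_integral) auto
    then have "has_bochner_integral M (\<lambda>u. K t powr p * norm (Z t u) powr p) (K t powr p * E)"
      by (rule has_bochner_integral_mult_right)
    then have h: "has_bochner_integral M (\<lambda>u. R t u powr p) (K t powr p * E)"
      using K[OF t] by (simp add: RZ[OF t] powr_mult)
    show "integrable M (\<lambda>u. R t u powr p)" using h by (rule integrable.intros)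
    have G: "Gamma (\<gamma> + 1) \<noteq> 0" by (rule Gamma_real_neq_0[OF g])
    have "E = Gamma (real d / 2 + \<gamma> + 1) * Gamma ((real d + p) / 2) /
          (Gamma (\<gamma> + 1 + (real d + p) / 2) * Gamma (real d / 2))"
      using G by (simp add: E_def Beta_def add_ac)
    then show "expectation (\<lambda>u. R t u powr p) =
        Gamma (real d / 2 + \<gamma> + 1) * Gamma ((real d + p) / 2) /
          (Gamma (\<gamma> + 1 + (real d + p) / 2) * Gamma (real d / 2)) * K t powr p"
      using has_bochner_integral_integral_eq[OF h] by simp
  qed
  have radius: "distributed M lborel (R t) (\<lambda>r. ennreal (indicator {0..} r *
        (2 * Gamma (real d / 2 + \<gamma> + 1) / (Gamma (\<gamma> + 1) * Gamma (real d / 2)) *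
         (r ^ (d - 1) / (c * t powr \<beta>) ^ d) *
         max (1 - r\<^sup>2 / (c\<^sup>2 * t powr (2 * \<beta>))) 0 powr \<gamma>)))" if t: "0 < t" for t
  proof -
    define Q where "Q = 2 * Gamma (real d / 2 + \<gamma> + 1) / (Gamma (\<gamma> + 1) * Gamma (real d / 2))"
    define f where "f r = ennreal (indicator {0..} r * (Q * r ^ (d - 1) * max (1 - r\<^sup>2) 0 powr \<gamma>))" for r
    have f_meas: "f \<in> borel_measurable lborel" unfolding f_def [abs_def] by measurable
    have "distr M lborel (\<lambda>u. norm (Z t u)) = distr (distr M borel (Z t)) borel norm"
      using Z_meas[OF t] by (subst distr_distr) (auto simp: comp_def intro!: distr_cong)
    also have "\<dots> = density lborel f"
      unfolding law[OF t] distr_ball_density_norm[OF g] f_def Q_def by (simp add: d)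
    finally have "distributed M lborel (\<lambda>u. norm (Z t u)) f"
      unfolding distributed_def using Z_meas[OF t] f_meas by auto
    from distributed_affine[OF this, of "K t" 0]
    have D: "distributed M lborel (\<lambda>u. 0 + K t * norm (Z t u)) (\<lambda>r. f ((r - 0) / K t) / \<bar>K t\<bar>)"
      using K[OF t] by simp
    have "f ((r - 0) / K t) / \<bar>K t\<bar> = ennreal (indicator {0..} r * (Q * (r ^ (d - 1) / (c * t powr \<beta>) ^ d) *
         max (1 - r\<^sup>2 / (c\<^sup>2 * t powr (2 * \<beta>))) 0 powr \<gamma>))" for r
    proof (cases "0 \<le> r")
      case True
      have Q: "0 \<le> Q" unfolding Q_def using d0 g
        by (intro divide_nonneg_nonneg mult_nonneg_nonneg Gamma_real_nonneg) auto
      \<comment> \<open>The quotient \<open>r / K t\<close> supplies \<open>d - 1\<close> of these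
        factors; the last one is the Jacobian of the rescaling.\<close>
      have Kd: "K t ^ d = K t ^ (d - 1) * K t" using d0 by (cases d) auto
      have "f ((r - 0) / K t) / \<bar>K t\<bar> = ennreal (Q * (r / K t) ^ (d - 1) * max (1 - (r / K t)\<^sup>2) 0 powr \<gamma> / K t)"
        using True K[OF t] Q by (simp add: f_def divide_ennreal)
      also have "Q * (r / K t) ^ (d - 1) * max (1 - (r / K t)\<^sup>2) 0 powr \<gamma> / K t =
          Q * (r ^ (d - 1) / K t ^ d) * max (1 - r\<^sup>2 / (K t)\<^sup>2) 0 powr \<gamma>"
        by (simp add: Kd power_divide)
      finally show ?thesis using True unfolding KD[OF t] by (simp add: K_def)
    next
      case False
      then show ?thesis using K[OF t] by (simp add: f_def zero_le_divide_iff)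
    qed
    then show ?thesis using D unfolding Q_def by (simp add: RZ[OF t, abs_def])
  qed
  \<comment> \<open>The Beta law with these parameters is that of the squared rescaled
    distance.\<close>
  have beta: "distributed M lborel (\<lambda>u. (R t u / K t)\<^sup>2) (\<lambda>x. ennreal (beta_density (real d / 2) (\<gamma> + 1) x))"
    if t: "0 < t" for t
  proof -
    have "distr M lborel (\<lambda>u. (norm (Z t u))\<^sup>2) = distr (distr M borel (Z t)) borel (\<lambda>x. (norm x)\<^sup>2)"
      using Z_meas[OF t] by (subst distr_distr) (auto simp: comp_def intro!: distr_cong)
    also have "\<dots> = density lborel (\<lambda>x. ennreal (beta_density (real d / 2) (\<gamma> + 1) x))"
      unfolding law[OF t] distr_ball_density_norm_sq[OF g] by (simp add: d)
    finally have "distributed M lborel (\<lambda>u. (norm (Z t u))\<^sup>2) (\<lambda>x. ennreal (beta_density (real d / 2) (\<gamma> + 1) x))"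
      unfolding distributed_def using Z_meas[OF t] by auto
    then show ?thesis using K[OF t] by (simp add: RZ[OF t])
  qed
  have position: "distributed M lborel (Z t) (\<lambda>x. ennreal (w x t))" if t: "0 < t" for t
  proof -
    have "distr M lborel (Z t) = distr M borel (Z t)" by (rule distr_cong) auto
    then show ?thesis
      unfolding distributed_def w using law[OF t] Z_meas[OF t] by simp
  qed
  \<comment> \<open>The vanishing odd moments are those of the signed coordinate of
    \<open>Y\<close>; powers of the norm are nonnegative and would not average to
    \<open>0\<close>.\<close>
  have odd_moment: "integrable M (\<lambda>u. (Y t u $ i) ^ p)" "expectation (\<lambda>u. (Y t u $ i) ^ p) = 0"
    if t: "0 < t" and p: "odd p" for t p i
  proof -
    have Yi: "(Y t u $ i) ^ p = K t ^ p * (axis i 1 \<bullet> Z t u) ^ p" for u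
      by (simp add: YZ[OF t] inner_axis' power_mult_distrib)
    have "AE x in distr M borel (Z t). norm x \<le> 1" unfolding law[OF t] by (rule AE_ball_density)
    then have ae: "AE u in M. norm (Z t u) \<le> 1" using Z_meas[OF t] by (subst (asm) AE_distr_iff) auto
    have "integrable M (\<lambda>u. (axis i 1 \<bullet> Z t u) ^ p)"
    proof (rule integrable_const_bound[where B = 1])
      show "AE u in M. norm ((axis i 1 \<bullet> Z t u) ^ p) \<le> 1"
        using ae
      proof eventually_elim
        case (elim u)
        then have "\<bar>Z t u $ i\<bar> \<le> 1" using component_le_norm_cart[of "Z t u" i] by simp
        then show ?case by (simp add: inner_axis' power_abs power_le_one)
      qed
    qed (use Z_meas[OF t] in measurable)
    then show "integrable M (\<lambda>u. (Y t u $ i) ^ p)" unfolding Yi by simp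
    have "expectation (\<lambda>u. (axis i 1 \<bullet> Z t u) ^ p) = (LINT x|?N. (axis i 1 \<bullet> x) ^ p)"
      unfolding law[OF t, symmetric] using Z_meas[OF t] by (subst integral_distr) auto
    also have "\<dots> = 0"
      using p by (subst ball_density_moment[OF g]) (auto simp: sym_beta_moment_def)
    finally show "expectation (\<lambda>u. (Y t u $ i) ^ p) = 0" unfolding Yi by simp
  qed
  have even_moment: "integrable M (\<lambda>u. R t u ^ p) \<and> expectation (\<lambda>u. R t u ^ p) =
          Gamma (1 / 2 + \<gamma> + 1) * Gamma ((1 + real p) / 2) /
          (Gamma (\<gamma> + 1 + (real p + 1) / 2) * sqrt pi) * K t ^ p"
    if t: "0 < t" and p: "1 \<le> p" and d1: "d = 1" for t and p :: nat
  proof -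
    have "R t u powr real p = R t u ^ p" for u
      using p by (intro powr_realpow') (auto simp: R)
    moreover have "K t powr real p = K t ^ p" using K[OF t] by (rule powr_realpow)
    ultimately show ?thesis
      using moment[OF t, of "real p"] d1 by (simp add: Gamma_one_half_real add_ac)
  qed
  have support: "measure_support (distr M borel (Z t)) = {x. norm x \<le> 1}" if "0 < t" for t
    unfolding law[OF that] by (rule measure_support_ball_density[OF g])
  have C: "compact {x :: real ^ 'd. norm x \<le> 1}"
    using compact_cball[of "0 :: real ^ 'd" 1] by (simp add: cball_def dist_norm)
  have fourier: "fourier (\<lambda>x. complex_of_real (w x t)) \<xi> =
          complex_of_real (1 / (2 * pi) powr (real d / 2) *
            (2 / norm \<xi>) powr (real d / 2 + \<gamma>) * Gamma (real d / 2 + \<gamma> + 1) *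
            bessel_J (real d / 2 + \<gamma>) (norm \<xi>))" if "\<xi> \<noteq> 0" for t \<xi>
    unfolding w d by (rule fourier_ball_density[OF g that])
  show ?thesis
    unfolding K_def[symmetric] Z_def[symmetric, abs_def]
  proof (intro conjI allI impI)
    fix t s :: real assume "0 < s" "0 < t"
    then show "distr M borel (Z s) = distr M borel (Z t)" by (simp only: law)
  qed (use radius[folded K_def] moment odd_moment even_moment position support C fourier beta in auto)
qed

end
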